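(* Let $\dot A$ be a non-negative symmetric Schrödinger operator $\dot A y=-y''+q(x)y$, $y(\ell)=y'(\ell)=0$, in $L_2[\ell,+\infty)$, with real locally summable potential $q$, deficiency indices $(1,1)$, and $m_\infty(-0)$ finite. Let $\alpha$ be real and let $\Theta_{\tan\alpha,i}$ be the Schrödinger L-system realizing the function $-m_\alpha(z)$ associated with $\dot A$. Suppose that $\Theta_{\tan\alpha,i}$ is accumulative and that its main operator $T_i$ is sectorial with exact angle of sectoriality $\beta\in(0,\pi/2)$. Let $\tilde{\mathbb A}_{\tan\alpha,i}=2\,\mathrm{Re}\,\dot A^*-\mathbb A_{\tan\alpha,i}$ be the associated operator. Then: (1) $\tilde{\mathbb A}_{\tan\alpha,i}$ is $\beta$-sectorial (with the same angle of sectoriality $\beta$ as $T_i$) if and only if $\tan\alpha=-m_\infty(-0)$; (2) $\tilde{\mathbb A}_{\tan\alpha,i}$ is accretive but not $\beta'$-sectorial for any $\beta'\in(0,\pi/2)$ if and only if $\alpha=0$ modulo $\pi$ (i.e. $\tan\alpha=0$).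
   Context: Setting. Let $\ell\ge 0$, $l(y)=-y''+q(x)y$ with $q$ real and locally summable on $[\ell,+\infty)$. $\dot A$ is the minimal symmetric operator $\dot A y=l(y)$ with $y(\ell)=y'(\ell)=0$ in $\mathcal H=L_2[\ell,+\infty)$, assumed to have deficiency indices $(1,1)$; non-negativity means $(\dot A f,f)\ge0$ for $f\in\mathrm{Dom}(\dot A)$. $\mathcal H_+=\mathrm{Dom}(\dot A^* )$ is the set of $y\in L_2[\ell,+\infty)$ that are locally absolutely continuous together with $y'$ and satisfy $l(y)\in L_2[\ell,+\infty)$; it carries the inner product $(y,w)_+=(y,w)+(l(y),l(w))$. $\mathcal H_+\subset\mathcal H\subset\mathcal H_-$ is the corresponding rigged Hilbert space, where $\mathcal H_-$ is the space of antilinear functionals on $\mathcal H_+$ and the pairing $(\cdot,\cdot)$ extends that of $\mathcal H$. $[\mathcal X,\mathcal Y]$ denotes the bounded linear operators from $\mathcal X$ to $\mathcal Y$. For $\mathbb A\in[\mathcal H_+,\mathcal H_-]$ the adjoint $\mathbb A^*$ is again in $[\mathcal H_+,\mathcal H_-]$, and $\mathrm{Re}\,\mathbb A=(\mathbb A+\mathbb A^* )/2$, $\mathrm{Im}\,\mathbb A=(\mathbb A-\mathbb A^* )/(2i)$. The elements $\delta(x-\ell),\delta'(x-\ell)\in\mathcal H_-$ act by $(y,\delta(x-\ell))=y(\ell)$, $(y,\delta'(x-\ell))=-y'(\ell)$ for $y\in\mathcal H_+$. Weyl-Titchmarsh functions. Let $\varphi_1,\varphi_2$ solve $l(\varphi_k)=z\varphi_k$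 with $\varphi_1(\ell,z)=0,\ \varphi_1'(\ell,z)=1$ and $\varphi_2(\ell,z)=-1,\ \varphi_2'(\ell,z)=0$. Then $m_\infty(z)$ is the function for which $\varphi_2(x,z)+m_\infty(z)\varphi_1(x,z)\in L_2[\ell,+\infty)$. For non-negative $\dot A$ it is holomorphic off $[0,+\infty)$, and $m_\infty(-0)=\lim_{x\to-0}m_\infty(x)$. For real $\alpha$, $m_\alpha(z)=\dfrac{\sin\alpha+m_\infty(z)\cos\alpha}{\cos\alpha-m_\infty(z)\sin\alpha}$. L-system. $T_i y=l(y)$ on $\{y\in\mathcal H_+:y'(\ell)=i\,y(\ell)\}$. For $\mu\in\mathbb R$ let $$\mathbb A_{\mu,i}\,y=l(y)-\frac1{\mu-i}\,[y'(\ell)-iy(\ell)]\,[\mu\,\delta(x-\ell)+\delta'(x-\ell)],$$ $g_{\mu,i}=\frac1{|\mu-i|}[\mu\,\delta(x-\ell)+\delta'(x-\ell)]$ and $K_{\mu,i}c=c\,g_{\mu,i}$, $c\in\mathbb C$, so that $\mathrm{Im}\,\mathbb A_{\mu,i}=K_{\mu,i}K_{\mu,i}^*$. For $\mu=\infty$ take the limits $\mathbb A_{\infty,i}y=l(y)-[y'(\ell)-iy(\ell)]\delta(x-\ell)$ and $g_{\infty,i}=\delta(x-\ell)$. The Schrödinger L-system $\Theta_{\mu,i}$ consists of the state-space operator $\mathbb A_{\mu,i}$, the channel operator $K_{\mu,i}$, the main operator $T_i$ and the triplet $\mathcal H_+\subset\mathcal H\subset\mathcal H_-$. Its impedance function is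 $V_{\Theta_{\mu,i}}(z)=K_{\mu,i}^*(\mathrm{Re}\,\mathbb A_{\mu,i}-zI)^{-1}K_{\mu,i}$, and $\Theta_{\tan\alpha,i}$ realizes $-m_\alpha$ in the sense that $V_{\Theta_{\tan\alpha,i}}(z)=-m_\alpha(z)$ (with $\tan\alpha=\infty$ if $\cos\alpha=0$). Accumulativity and associated operator. $\Theta_{\mu,i}$ is accumulative if $(\mathrm{Re}\,\mathbb A_{\mu,i}f,f)\le(\dot A^*f,f)+(f,\dot A^*f)$ for all $f\in\mathcal H_+$. The associated operator is $\tilde{\mathbb A}_{\mu,i}=2\,\mathrm{Re}\,\dot A^*-\mathbb A_{\mu,i}\in[\mathcal H_+,\mathcal H_-]$, where $\dot A^*$ is regarded as an element of $[\mathcal H_+,\mathcal H_-]$. Explicitly, for $\mu\in\mathbb R$, $$\tilde{\mathbb A}_{\mu,i}y=l(y)-y'(\ell)\delta(x-\ell)-y(\ell)\delta'(x-\ell)+\frac1{\mu-i}[y'(\ell)-iy(\ell)][\mu\,\delta(x-\ell)+\delta'(x-\ell)].$$ Sectoriality. An operator $T$ (acting in $\mathcal H$, or in $[\mathcal H_+,\mathcal H_-]$ with domain $\mathcal H_+$) is accretive if $\mathrm{Re}(Tf,f)\ge0$ for all $f$ in its domain. For $\beta\in(0,\pi/2)$ it is $\beta$-sectorial if $(\cot\beta)\,|\mathrm{Im}(Tf,f)|\le\mathrm{Re}(Tf,f)$ for all $f$ in its domain. The angle $\beta$ is exact if $\tan\beta=\sup_f |\mathrm{Im}(Tf,f)|/\mathrm{Re}(Tf,f)$.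 *)

theory Defs
  imports "HOL-Analysis.Analysis" "HOL-Library.Function_Algebras"
begin

section \<open>Functions on a half-line\<close>

text \<open>A function on \<open>[l, \<infinity>)\<close> is represented by its extension by \<open>0\<close> to the whole real line, so
  that equality on \<open>[l, \<infinity>)\<close> is equality of HOL functions.\<close>

type_synonym fn = "real \<Rightarrow> complex"

text \<open>At the endpoint \<open>l\<close> this is the one-sided derivative.\<close>

definition hderiv :: "real \<Rightarrow> fn \<Rightarrow> fn" where
  "hderiv l y x = vector_derivative y (at x within {l..})"

definition abs_cont_on :: "real \<Rightarrow> real \<Rightarrow> fn \<Rightarrow> bool" where
  "abs_cont_on a b f \<longleftrightarrow>
     (\<forall>\<epsilon>>0. \<exists>\<delta>>0. \<forall>I :: (real \<times> real) set.
        finite I \<and> (\<forall>(u, v)\<in>I. a \<le> u \<and> u \<le> v \<and> v \<le> b) \<and>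
        disjoint_family_on (\<lambda>(u, v). {u<..<v}) I \<and> (\<Sum>(u, v)\<in>I. v - u) < \<delta>
        \<longrightarrow> (\<Sum>(u, v)\<in>I. cmod (f v - f u)) < \<epsilon>)"

definition loc_abs_cont :: "real \<Rightarrow> fn \<Rightarrow> bool" where
  "loc_abs_cont l f \<longleftrightarrow> (\<forall>b\<ge>l. abs_cont_on l b f)"

text \<open>\<open>y\<close> and \<open>y'\<close> are locally absolutely continuous on \<open>[l, \<infinity>)\<close>. The last clause is implied by the
  absolute continuity of \<open>y'\<close>; it records that \<open>hderiv l (hderiv l y)\<close> is a meaningful derivative almost
  everywhere.\<close>

definition loc_abs_cont2 :: "real \<Rightarrow> fn \<Rightarrow> bool" where
  "loc_abs_cont2 l y \<longleftrightarrow>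
     (\<forall>x<l. y x = 0) \<and>
     loc_abs_cont l y \<and>
     (\<forall>x\<ge>l. y differentiable (at x within {l..})) \<and>
     loc_abs_cont l (hderiv l y) \<and>
     (AE x in lebesgue_on {l..}. hderiv l y differentiable (at x within {l..}))"

definition L2 :: "real \<Rightarrow> fn set" where
  "L2 l = {f. f \<in> borel_measurable (lebesgue_on {l..}) \<and>
              integrable (lebesgue_on {l..}) (\<lambda>x. (cmod (f x))\<^sup>2)}"

definition ip :: "real \<Rightarrow> fn \<Rightarrow> fn \<Rightarrow> complex" where
  "ip l f g = (LINT x|lebesgue_on {l..}. f x * cnj (g x))"

section \<open>The Schroedinger expression and its operators\<close>

definition schr :: "(real \<Rightarrow> real) \<Rightarrow> real \<Rightarrow> fn \<Rightarrow> fn" where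
  "schr q l y x = - hderiv l (hderiv l y) x + complex_of_real (q x) * y x"

definition Hplus :: "(real \<Rightarrow> real) \<Rightarrow> real \<Rightarrow> fn set" where
  "Hplus q l = {y. loc_abs_cont2 l y \<and> y \<in> L2 l \<and> schr q l y \<in> L2 l}"

text \<open>The domain of the minimal operator, which acts as \<^term>\<open>schr q l\<close>. Its adjoint acts as
  \<^term>\<open>schr q l\<close> on \<^term>\<open>Hplus q l\<close>.\<close>

definition dom_min :: "(real \<Rightarrow> real) \<Rightarrow> real \<Rightarrow> fn set" where
  "dom_min q l = {y \<in> Hplus q l. y l = 0 \<and> hderiv l y l = 0}"

definition nonneg_min :: "(real \<Rightarrow> real) \<Rightarrow> real \<Rightarrow> bool" where
  "nonneg_min q l \<longleftrightarrow> (\<forall>f\<in>dom_min q l. 0 \<le> Re (ip l (schr q l f) f))"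

text \<open>The kernel of (adjoint of the minimal operator) \<open>- z\<close>, and its complex dimension.\<close>

definition defect_space :: "(real \<Rightarrow> real) \<Rightarrow> real \<Rightarrow> complex \<Rightarrow> fn set" where
  "defect_space q l z =
     {y \<in> Hplus q l. AE x in lebesgue_on {l..}. schr q l y x = z * y x}"

definition deficiency_index :: "(real \<Rightarrow> real) \<Rightarrow> real \<Rightarrow> complex \<Rightarrow> nat" where
  "deficiency_index q l z = vector_space.dim (\<lambda>c (f :: fn) x. c * f x) (defect_space q l z)"

section \<open>The Weyl--Titchmarsh function\<close>

definition solves :: "(real \<Rightarrow> real) \<Rightarrow> real \<Rightarrow> complex \<Rightarrow> fn \<Rightarrow> bool" where
  "solves q l z y \<longleftrightarrow>
     loc_abs_cont2 l y \<and> (AE x in lebesgue_on {l..}. schr q l y x = z * y x)"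

definition phi1 :: "(real \<Rightarrow> real) \<Rightarrow> real \<Rightarrow> complex \<Rightarrow> fn" where
  "phi1 q l z = (THE y. solves q l z y \<and> y l = 0 \<and> hderiv l y l = 1)"

definition phi2 :: "(real \<Rightarrow> real) \<Rightarrow> real \<Rightarrow> complex \<Rightarrow> fn" where
  "phi2 q l z = (THE y. solves q l z y \<and> y l = -1 \<and> hderiv l y l = 0)"

definition m_inf :: "(real \<Rightarrow> real) \<Rightarrow> real \<Rightarrow> complex \<Rightarrow> complex" where
  "m_inf q l z = (THE m. (\<lambda>x. phi2 q l z x + m * phi1 q l z x) \<in> L2 l)"

section \<open>Operators from \<open>\<H>\<^sub>+\<close> to \<open>\<H>\<^sub>-\<close>\<close>

text \<open>An element \<open>F\<close> of \<open>\<H>\<^sub>-\<close> is the antilinear functional \<open>w \<mapsto> (F, w)\<close> on \<open>\<H>\<^sub>+\<close>; an operator \<open>A\<close>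
  from \<open>\<H>\<^sub>+\<close> to \<open>\<H>\<^sub>-\<close> is therefore given by \<open>A y w = (A y, w)\<close>. Only arguments in \<open>\<H>\<^sub>+\<close> matter.\<close>

type_synonym functional = "fn \<Rightarrow> complex"
type_synonym operator = "fn \<Rightarrow> functional"

definition emb_H :: "real \<Rightarrow> fn \<Rightarrow> functional" where
  "emb_H l f w = ip l f w"

text \<open>\<open>(\<delta>, w)\<close> and \<open>(\<delta>', w)\<close> are the conjugates of \<open>(w, \<delta>) = w(l)\<close> and \<open>(w, \<delta>') = - w'(l)\<close>.\<close>

definition delta :: "real \<Rightarrow> functional" where
  "delta l w = cnj (w l)"

definition delta' :: "real \<Rightarrow> functional" where
  "delta' l w = cnj (- hderiv l w l)"

text \<open>\<open>(A\<^sup>* y, w) = (y, A w)\<close>\<close>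

definition adj :: "operator \<Rightarrow> operator" where
  "adj A y w = cnj (A w y)"

definition Re_op :: "operator \<Rightarrow> operator" where
  "Re_op A y w = (A y w + adj A y w) / 2"

text \<open>The adjoint of the minimal operator, as an operator from \<open>\<H>\<^sub>+\<close> to \<open>\<H>\<^sub>-\<close>.\<close>

definition max_op :: "(real \<Rightarrow> real) \<Rightarrow> real \<Rightarrow> operator" where
  "max_op q l y = emb_H l (schr q l y)"

section \<open>Accretivity and sectoriality\<close>

text \<open>\<open>S\<close> is the domain of \<open>T\<close>. An operator \<open>T\<close> acting in \<open>\<H>\<close> is composed with \<^term>\<open>emb_H l\<close>, so
  that in all cases \<open>T f f = (T f, f)\<close>.\<close>

definition accretive :: "fn set \<Rightarrow> operator \<Rightarrow> bool" where
  "accretive S T \<longleftrightarrow> (\<forall>f\<in>S. 0 \<le> Re (T f f))"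

definition sectorial :: "real \<Rightarrow> fn set \<Rightarrow> operator \<Rightarrow> bool" where
  "sectorial \<beta> S T \<longleftrightarrow> (\<forall>f\<in>S. cot \<beta> * \<bar>Im (T f f)\<bar> \<le> Re (T f f))"

text \<open>By sectoriality the quotients are bounded by \<open>tan \<beta>\<close>, and a vanishing denominator forces a
  vanishing numerator, in which case the quotient is \<open>0 / 0 = 0\<close> and does not affect the
  supremum.\<close>

definition exact_angle :: "real \<Rightarrow> fn set \<Rightarrow> operator \<Rightarrow> bool" where
  "exact_angle \<beta> S T \<longleftrightarrow>
     sectorial \<beta> S T \<and> tan \<beta> = (SUP f\<in>S. \<bar>Im (T f f)\<bar> / Re (T f f))"

section \<open>Schroedinger L-systems\<close>

record l_system =
  state_op :: operator
  channel_op :: "complex \<Rightarrow> functional"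
  main_dom :: "fn set"
  main_op :: "fn \<Rightarrow> fn"

text \<open>The parameter \<open>\<mu>\<close> ranges over the one-point compactification of the reals: both infinities of
  \<^typ>\<open>ereal\<close> stand for its point at infinity.\<close>

definition A_op :: "(real \<Rightarrow> real) \<Rightarrow> real \<Rightarrow> ereal \<Rightarrow> operator" where
  "A_op q l \<mu> y w =
     (case \<mu> of
        ereal m \<Rightarrow> max_op q l y w
          - 1 / (complex_of_real m - \<i>) * (hderiv l y l - \<i> * y l)
            * (complex_of_real m * delta l w + delta' l w)
      | _ \<Rightarrow> max_op q l y w - (hderiv l y l - \<i> * y l) * delta l w)"

definition g_vec :: "real \<Rightarrow> ereal \<Rightarrow> functional" where
  "g_vec l \<mu> w =
     (case \<mu> of
        ereal m \<Rightarrow> 1 / complex_of_real (cmod (complex_of_real m - \<i>))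
            * (complex_of_real m * delta l w + delta' l w)
      | _ \<Rightarrow> delta l w)"

definition schr_system :: "(real \<Rightarrow> real) \<Rightarrow> real \<Rightarrow> ereal \<Rightarrow> l_system" where
  "schr_system q l \<mu> =
     \<lparr> state_op = A_op q l \<mu>,
       channel_op = (\<lambda>c w. c * g_vec l \<mu> w),
       main_dom = {y \<in> Hplus q l. hderiv l y l = \<i> * y l},
       main_op = schr q l \<rparr>"

definition accumulative :: "(real \<Rightarrow> real) \<Rightarrow> real \<Rightarrow> l_system \<Rightarrow> bool" where
  "accumulative q l \<Theta> \<longleftrightarrow>
     (\<forall>f\<in>Hplus q l.
        Re (Re_op (state_op \<Theta>) f f) \<le> Re (ip l (schr q l f) f + ip l f (schr q l f)))"

definition assoc_op :: "(real \<Rightarrow> real) \<Rightarrow> real \<Rightarrow> l_system \<Rightarrow> operator" where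
  "assoc_op q l \<Theta> y w = 2 * Re_op (max_op q l) y w - state_op \<Theta> y w"

text \<open>In HOL \<^term>\<open>tan \<alpha> = 0\<close> when \<^term>\<open>cos \<alpha> = 0\<close>, hence the extended tangent.\<close>

definition tan_ext :: "real \<Rightarrow> ereal" where
  "tan_ext \<alpha> = (if cos \<alpha> = 0 then \<infinity> else ereal (tan \<alpha>))"

end

theory Submission
  imports Defs
begin

text \<open>
  Write \<open>a = y l\<close> and \<open>b = y' l\<close> for the boundary values of \<open>y \<in> \<H>\<^sub>+\<close>. The theorem rests on one variational fact: among
  all \<open>y\<close> with given \<open>a\<close> and \<open>b\<close>, the real part of \<open>(S y, y)\<close>, where \<open>S y = - y'' + q y\<close>, has infimum
  \<open>m\<^sub>0 * \<bar>a\<bar>\<^sup>2 + Re (b * cnj a)\<close> (\<open>form_lower_bound\<close> and \<open>form_sharp\<close>). Its imaginary part is \<open>Im (b * cnj a)\<close> by Green's formula.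

  On the domain of \<open>T\<^sub>i\<close>, where \<open>b = \<i> * a\<close>, the imaginary part is \<open>\<bar>a\<bar>\<^sup>2\<close> and the infimum of the real part is
  \<open>m\<^sub>0 * \<bar>a\<bar>\<^sup>2\<close>, so that \<open>cot \<beta> = m\<^sub>0\<close> (\<open>exact_angle_main_op\<close>). For the associated operator with parameter \<open>\<mu> = - \<nu>\<close> put
  \<open>w = \<bar>b + \<nu> * a\<bar>\<^sup>2 / (\<nu>\<^sup>2 + 1)\<close>. Its form has imaginary part \<open>- w\<close> and a real part with infimum
  \<open>(m\<^sub>0 - \<nu>) * \<bar>a\<bar>\<^sup>2 + \<nu> * w\<close> (\<open>assoc_op_form\<close>). The system is accumulative exactly if this operator is accretive, that
  is, if \<open>0 \<le> \<nu> \<le> m\<^sub>0\<close>; the parameter \<open>\<infinity>\<close> is excluded. As \<open>a = 0\<close> is possible for any \<open>w\<close>, the operator is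
  \<open>\<beta>'\<close>-sectorial if and only if \<open>cot \<beta>' \<le> \<nu>\<close>. For \<open>\<beta>' = \<beta>\<close> this means \<open>\<nu> = m\<^sub>0\<close>, and it fails for every \<open>\<beta>'\<close> if and
  only if \<open>\<nu> = 0\<close>.

  For the variational fact let \<open>\<psi>\<close> be the square integrable solution of \<open>S \<psi> = - \<lambda> \<psi>\<close>, \<open>\<lambda> > 0\<close>, with \<open>\<psi> l = 1\<close>, so
  that \<open>\<psi>' l\<close> is minus the value of \<open>m\<^sub>\<infinity>\<close> at \<open>- \<lambda>\<close>. Writing \<open>y = h + a * \<psi>\<close> with \<open>h l = 0\<close>, Green's formula turns
  \<open>(S y, y) + \<lambda> (y, y)\<close> into boundary terms plus \<open>(S h, h) + \<lambda> (h, h)\<close>. The latter has nonnegative real part, since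
  nonnegativity of the minimal operator extends to functions that only satisfy \<open>h l = 0\<close>, and it can be made small
  for any prescribed \<open>h' l\<close>. Then \<open>\<lambda>\<close> tends to \<open>0\<close>.

  The deficiency indices enter through a Gronwall argument: if the Wronskian of two elements of \<open>\<H>\<^sub>+\<close> did not vanish
  at infinity, then all solutions for \<open>z = \<i>\<close> would be square integrable. This gives Green's formula without a
  contribution from infinity and the uniqueness of \<open>\<psi>\<close>. The existence of \<open>\<psi>\<close> follows by approximation with solutions
  that vanish at a point \<open>c\<close>: nonnegativity bounds their norms uniformly in \<open>c\<close>.

  As \<open>q\<close> is only locally integrable, second derivatives exist only almost everywhere. The first sections therefore
  supply the fundamental theorem of calculus for absolutely continuous functions, Lebesgue's differentiation theorem
  on the line, and existence and uniqueness for linear initial value problems with integrable coefficients.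
\<close>

section \<open>Absolutely continuous functions\<close>

lemma AE_lebesgue_on_iff_negligible:
  fixes S :: "real set"
  assumes "S \<in> sets lebesgue"
  shows "(AE x in lebesgue_on S. P x) \<longleftrightarrow> (\<exists>N. negligible N \<and> (\<forall>x\<in>S - N. P x))"
proof -
  have "(AE x in lebesgue_on S. P x) \<longleftrightarrow> (AE x in lebesgue. x \<in> S \<longrightarrow> P x)"
    using assms by (intro AE_restrict_space_iff) auto
  also have "\<dots> \<longleftrightarrow> {x. x \<in> S \<and> \<not> P x} \<in> null_sets lebesgue"
    by (simp add: completion.AE_iff_null_sets)
  also have "\<dots> \<longleftrightarrow> (\<exists>N. negligible N \<and> (\<forall>x\<in>S - N. P x))"
    unfolding negligible_iff_null_sets [symmetric]
    by (metis (mono_tags, lifting) Diff_iff mem_Collect_eq negligible_subset subsetI)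
  finally show ?thesis .
qed

text \<open>Off \<open>N\<close> differentiability makes a fine tagged interval contribute almost nothing to the error, as in the
  classical theorem. The tags in \<open>N\<close> get a gauge with values in one open set of small measure that contains \<open>N\<close>:
  absolute continuity then bounds the total increment of \<open>f\<close> over their intervals, while the integrand may be
  taken to be \<open>0\<close> on \<open>N\<close>.\<close>

lemma abs_cont_on_imp_FTC:
  fixes f g :: fn
  assumes ab: "a \<le> b" and ac: "abs_cont_on a b f" and N: "negligible N"
    and der: "\<And>x. x \<in> {a..b} - N \<Longrightarrow> (f has_vector_derivative g x) (at x within {a..b})"
  shows "(g has_integral (f b - f a)) {a..b}"
proof -
  define g0 where "g0 x = (if x \<in> N then 0 else g x)" for x
  have "(g0 has_integral (f b - f a)) {a..b}"
    unfolding has_integral_real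
  proof (intro allI impI)
    fix e :: real assume e: "e > 0"
    define e1 where "e1 = e / (4 * (b - a + 1))"
    have e1: "e1 > 0" "e1 * (b - a) \<le> e / 4"
      using e ab by (auto simp: e1_def field_simps)
    have "\<exists>d>0. \<forall>y\<in>{a..b}. \<bar>y - x\<bar> < d \<longrightarrow> cmod (f y - f x - (y - x) *\<^sub>R g x) \<le> e1 * \<bar>y - x\<bar>"
      if "x \<in> {a..b} - N" for x
    proof -
      have "\<forall>e>0. \<exists>d>0. \<forall>y\<in>{a..b}. norm (y - x) < d \<longrightarrow>
             norm (f y - f x - (y - x) *\<^sub>R g x) \<le> e * norm (y - x)"
        using der[OF that] that
        unfolding has_vector_derivative_def has_derivative_within_alt by auto
      then show ?thesis using e1(1) by auto
    qed
    then obtain d where d: "\<And>x. x \<in> {a..b} - N \<Longrightarrow> d x > 0"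
      "\<And>x y. x \<in> {a..b} - N \<Longrightarrow> y \<in> {a..b} \<Longrightarrow> \<bar>y - x\<bar> < d x \<Longrightarrow>
         cmod (f y - f x - (y - x) *\<^sub>R g x) \<le> e1 * \<bar>y - x\<bar>"
      by metis
    have "e / 2 > 0" using e by simp
    from ac[unfolded abs_cont_on_def, rule_format, OF this]
    obtain \<delta> where \<delta>: "\<delta> > 0" and
      ac: "\<And>I :: (real \<times> real) set. finite I \<Longrightarrow> (\<forall>(u, v)\<in>I. a \<le> u \<and> u \<le> v \<and> v \<le> b) \<Longrightarrow>
        disjoint_family_on (\<lambda>(u, v). {u<..<v}) I \<Longrightarrow> (\<Sum>(u, v)\<in>I. v - u) < \<delta>
        \<Longrightarrow> (\<Sum>(u, v)\<in>I. cmod (f v - f u)) < e/2"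
      by auto
    obtain U where U: "open U" "N \<subseteq> U" "U - N \<in> lmeasurable" "emeasure lebesgue (U - N) < ennreal \<delta>"
      using sets_lebesgue_outer_open[of N \<delta>] N \<delta> negligible_imp_sets by blast
    have "U \<in> lmeasurable" "measure lebesgue U < \<delta>"
    proof -
      have "U = (U - N) \<union> N" using U by auto
      moreover have "N \<in> null_sets lebesgue" using N by (simp add: negligible_iff_null_sets)
      ultimately have "emeasure lebesgue U = emeasure lebesgue (U - N)"
        by (metis U(3) emeasure_Un_null_set fmeasurableD)
      with U(4) have "emeasure lebesgue U < ennreal \<delta>" by simp
      moreover from this show "U \<in> lmeasurable"
        using U(1) by (intro fmeasurableI) (auto intro: less_trans)
      ultimately show "measure lebesgue U < \<delta>"
        using \<delta> by (simp add: emeasure_eq_measure2 ennreal_less_iff)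
    qed
    define \<gamma> where "\<gamma> x = (if x \<in> N then U else if x \<in> {a..b} then ball x (d x) else ball x 1)" for x
    show "\<exists>\<gamma>. gauge \<gamma> \<and> (\<forall>\<D>. \<D> tagged_division_of {a..b} \<and> \<gamma> fine \<D> \<longrightarrow>
            norm ((\<Sum>(x, k)\<in>\<D>. measure lborel k *\<^sub>R g0 x) - (f b - f a)) < e)"
    proof (intro exI[of _ \<gamma>] conjI allI impI)
      show "gauge \<gamma>" using U d by (auto simp: gauge_def \<gamma>_def)
      fix D assume D: "D tagged_division_of {a..b} \<and> \<gamma> fine D"
      then have finD: "finite D" by auto
      have K: "\<exists>u v. K = {u..v} \<and> u \<le> x \<and> x \<le> v \<and> a \<le> u \<and> v \<le> b \<and> {u..v} \<subseteq> \<gamma> x \<and>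
                Sup K = v \<and> Inf K = u \<and> measure lborel K = v - u \<and>
                interior K = {u<..<v} \<and> K \<in> sets lebesgue"
        if "(x, K) \<in> D" for x K
      proof -
        have "x \<in> K" "K \<subseteq> {a..b}" "\<exists>u v. K = cbox u v" "K \<subseteq> \<gamma> x"
          using D that tagged_division_ofD(2-4)[OF conjunct1[OF D] that] by (auto simp: fine_def)
        then obtain u v where "K = {u..v}" "u \<le> x" "x \<le> v" "a \<le> u" "v \<le> b" "K \<subseteq> \<gamma> x" by force
        then show ?thesis by (intro exI[of _ u] exI[of _ v]) auto
      qed
      \<comment> \<open>Degenerate intervals are left out so that an interval determines its tag.\<close>
      define DN where "DN = {(x, K) \<in> D. x \<in> N \<and> Inf K < Sup K}"
      define h where "h = (\<lambda>(x :: real, K :: real set). (Inf K :: real, Sup K :: real))"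
      have DND: "DN \<subseteq> D" by (auto simp: DN_def)
      have injh: "inj_on h DN"
      proof (rule inj_onI)
        fix p p' assume p: "p \<in> DN" "p' \<in> DN" "h p = h p'"
        obtain x K x' K' where [simp]: "p = (x, K)" "p' = (x', K')" by (metis surj_pair)
        from p have xK: "(x, K) \<in> D" "(x', K') \<in> D" "Inf K < Sup K" by (auto simp: DN_def)
        from K[OF this(1)] K[OF this(2)] p have "K = K'" by (auto simp: h_def)
        moreover have "interior K \<noteq> {}" using K[OF xK(1)] xK(3) by (metis greaterThanLessThan_empty_iff not_le)
        ultimately show "p = p'" using tagged_division_ofD(5)[OF conjunct1[OF D], of x K x' K'] xK by auto
      qed
      have "(\<Sum>(x, K)\<in>DN. Sup K - Inf K) = (\<Sum>(x, K)\<in>DN. measure lborel K)"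
        using DND K by (intro sum.cong) fastforce+
      also have "\<dots> = sum (measure lborel) (snd ` DN)"
      proof -
        have "inj_on snd DN"
          by (rule inj_onI) (use injh in \<open>force simp: inj_on_def h_def\<close>)
        then show ?thesis by (simp add: sum.reindex case_prod_unfold)
      qed
      also have "\<dots> = measure lebesgue (\<Union>(snd ` DN))"
      proof -
        have "DN tagged_partial_division_of {a..b}"
          using DND D tagged_partial_division_subset by (metis tagged_division_of_def)
        then have "(\<Sum>K\<in>snd ` DN. measure lebesgue K) = measure lebesgue (\<Union>(snd ` DN))"
          using content_division partial_division_of_tagged_division by blast
        moreover have "(\<Sum>K\<in>snd ` DN. measure lebesgue K) = sum (measure lborel) (snd ` DN)"
          using DND K by (intro sum.cong refl) (metis (no_types, lifting) imageE measure_completion sets_lborel cbox_borel box_real(2) prod.collapse subsetD)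
        ultimately show ?thesis by simp
      qed
      also have "\<dots> \<le> measure lebesgue U"
      proof (rule measure_mono_fmeasurable)
        show "\<Union> (snd ` DN) \<subseteq> U"
        proof clarsimp
          fix y x L assume "(x, L) \<in> DN" "y \<in> L"
          then show "y \<in> U" using K[of x L] by (auto simp: DN_def \<gamma>_def)
        qed
        show "\<Union> (snd ` DN) \<in> sets lebesgue"
          by (intro sets.finite_Union finite_imageI finite_subset[OF DND finD])
            (clarsimp, metis K DND subsetD)
      qed fact
      finally have small: "(\<Sum>(x, K)\<in>DN. Sup K - Inf K) < \<delta>"
        using \<open>measure lebesgue U < \<delta>\<close> by simp
      have "(\<Sum>(u, v)\<in>h ` DN. cmod (f v - f u)) < e/2"
      proof (rule ac)
        show "finite (h ` DN)" using finD DND finite_subset by blast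
        show "\<forall>(u, v)\<in>h ` DN. a \<le> u \<and> u \<le> v \<and> v \<le> b"
          using DND K by (fastforce simp: h_def)
        show "(\<Sum>(u, v)\<in>h ` DN. v - u) < \<delta>"
          using small by (subst sum.reindex[OF injh]) (simp add: h_def case_prod_unfold)
        show "disjoint_family_on (\<lambda>(u, v). {u<..<v}) (h ` DN)"
          unfolding disjoint_family_on_def
        proof (intro ballI impI)
          fix p p' assume "p \<in> h ` DN" "p' \<in> h ` DN" "p \<noteq> p'"
          then obtain x K x' K' where A: "(x, K) \<in> DN" "(x', K') \<in> DN" "K \<noteq> K'"
            and p: "p = h (x, K)" "p' = h (x', K')"
            by (auto simp: h_def)
          then have D': "(x, K) \<in> D" "(x', K') \<in> D" using DND by auto
          then have "interior K \<inter> interior K' = {}"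
            using tagged_division_ofD(5)[OF conjunct1[OF D], of x K x' K'] A by blast
          moreover have "interior K = {Inf K<..<Sup K}" "interior K' = {Inf K'<..<Sup K'}"
            using K[OF D'(1)] K[OF D'(2)] by metis+
          ultimately show "(case p of (u, v) \<Rightarrow> {u<..<v}) \<inter> (case p' of (u, v) \<Rightarrow> {u<..<v}) = {}"
            by (simp add: h_def p)
        qed
      qed
      then have S2: "(\<Sum>(x, K)\<in>DN. cmod (f (Sup K) - f (Inf K))) < e/2"
        by (subst (asm) sum.reindex[OF injh]) (simp add: h_def case_prod_unfold)
      have "(\<Sum>(x, K)\<in>D. measure lborel K *\<^sub>R g0 x) - (f b - f a)
          = (\<Sum>(x, K)\<in>D. measure lborel K *\<^sub>R g0 x - (f (Sup K) - f (Inf K)))"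
        using additive_tagged_division_1[OF ab, of D f] D
        by (simp add: sum_subtractf case_prod_unfold)
      also have "norm \<dots> \<le> (\<Sum>(x, K)\<in>D. cmod (measure lborel K *\<^sub>R g0 x - (f (Sup K) - f (Inf K))))"
        by (simp add: case_prod_unfold norm_sum)
      also have "\<dots> \<le> (\<Sum>p\<in>D. (case p of (x, K) \<Rightarrow> e1 * measure lborel K) + (if p \<in> DN then (case p of (x, K) \<Rightarrow> cmod (f (Sup K) - f (Inf K))) else 0))"
      proof (rule sum_mono)
        fix p assume "p \<in> D"
        moreover obtain x L where [simp]: "p = (x, L)" by fastforce
        ultimately obtain u v where uv: "L = {u..v}" "u \<le> x" "x \<le> v" "a \<le> u" "v \<le> b" "{u..v} \<subseteq> \<gamma> x"
                "Sup L = v" "Inf L = u" "measure lborel L = v - u" using K[of x L] by auto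
        show "(case p of (x, K) \<Rightarrow> cmod (measure lborel K *\<^sub>R g0 x - (f (Sup K) - f (Inf K))))
           \<le> (case p of (x, K) \<Rightarrow> e1 * measure lborel K) + (if p \<in> DN then (case p of (x, K) \<Rightarrow> cmod (f (Sup K) - f (Inf K))) else 0)"
        proof (cases "x \<in> N")
          case True
          show ?thesis
          proof (cases "u < v")
            case True
            then have "p \<in> DN" using \<open>x \<in> N\<close> \<open>p \<in> D\<close> uv by (simp add: DN_def)
            then show ?thesis using True \<open>x \<in> N\<close> uv e1 by (simp add: g0_def norm_minus_commute)
          next
            case False
            then have "u = v" using uv by auto
            then show ?thesis using uv e1 by (auto simp del: uv(1))
          qed
        next
          case False
          have xab: "x \<in> {a..b} - N" using uv False by auto
          have "{u..v} \<subseteq> ball x (d x)" using uv(6) xab by (simp add: \<gamma>_def)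
          then have "u \<in> ball x (d x)" "v \<in> ball x (d x)"
            using uv(2,3) by (meson atLeastAtMost_iff order_refl order_trans subsetD)+
          then have du: "cmod (f u - f x - (u - x) *\<^sub>R g x) \<le> e1 * (x - u)"
            and dv: "cmod (f v - f x - (v - x) *\<^sub>R g x) \<le> e1 * (v - x)"
            using d(2)[OF xab, of u] d(2)[OF xab, of v] uv by (auto simp: dist_real_def)
          have eq: "(v - u) *\<^sub>R g x - (f v - f u) = (f u - f x - (u - x) *\<^sub>R g x) - (f v - f x - (v - x) *\<^sub>R g x)"
            by (simp add: algebra_simps)
          have "cmod ((v - u) *\<^sub>R g x - (f v - f u)) \<le> e1 * (x - u) + e1 * (v - x)"
            unfolding eq using du dv norm_triangle_ineq4[of "f u - f x - (u - x) *\<^sub>R g x" "f v - f x - (v - x) *\<^sub>R g x"]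
            by linarith
          then have "cmod ((v - u) *\<^sub>R g x - (f v - f u)) \<le> e1 * (v - u)" by (simp add: algebra_simps)
          moreover have "p \<notin> DN" using False by (simp add: DN_def)
          ultimately show ?thesis using uv False by (simp add: g0_def)
        qed
      qed
      also have "\<dots> = e1 * (\<Sum>(x, K)\<in>D. measure lborel K) + (\<Sum>(x, K)\<in>DN. cmod (f (Sup K) - f (Inf K)))"
        using finD DND by (simp add: sum.distrib sum_distrib_left case_prod_unfold flip: sum.inter_restrict sum.inter_filter)
           (simp add: Int_absorb1 sum.If_cases)
      also have "(\<Sum>(x, K)\<in>D. measure lborel K) = b - a"
        using additive_content_tagged_division[of D a b] D ab by simp
      also have "e1 * (b - a) + (\<Sum>(x, K)\<in>DN. cmod (f (Sup K) - f (Inf K))) < e"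
        using e1 S2 e by linarith
      finally show "norm ((\<Sum>(x, k)\<in>D. measure lborel k *\<^sub>R g0 x) - (f b - f a)) < e" .
    qed
  qed
  then show ?thesis
    by (rule has_integral_spike[OF N, rotated]) (auto simp: g0_def)
qed


lemma sum_integral_disjoint_le:
  fixes h :: "real \<Rightarrow> real"
  assumes "finite I" and I: "\<And>u v. (u, v) \<in> I \<Longrightarrow> a \<le> u \<and> u \<le> v \<and> v \<le> b"
    and disj: "disjoint_family_on (\<lambda>(u, v). {u<..<v}) I"
    and h: "h absolutely_integrable_on {a..b}" and nn: "\<And>x. 0 \<le> h x"
  shows "(\<Sum>(u, v)\<in>I. integral {u..v} h) \<le> integral {a..b} h"
proof -
  have int: "set_integrable lebesgue {u<..<v} h" if "(u, v) \<in> I" for u v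
    by (rule set_integrable_subset[OF h]) (use I[OF that] in auto)
  have "(\<Sum>(u, v)\<in>I. integral {u..v} h) = (\<Sum>p\<in>I. integral\<^sup>L lebesgue (\<lambda>x. indicator (case p of (u, v) \<Rightarrow> {u<..<v}) x * h x))"
  proof (intro sum.cong refl)
    fix p assume "p \<in> I"
    obtain u v where p: "p = (u, v)" by fastforce
    have "integral {u..v} h = integral {u<..<v} h" by (simp add: integral_open_interval_real)
    also have "\<dots> = (LINT x:{u<..<v}|lebesgue. h x)"
      using int \<open>p \<in> I\<close> p by (simp add: set_lebesgue_integral_eq_integral(2))
    finally show "(case p of (u, v) \<Rightarrow> integral {u..v} h) = integral\<^sup>L lebesgue (\<lambda>x. indicator (case p of (u, v) \<Rightarrow> {u<..<v}) x * h x)"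
      by (simp add: p set_lebesgue_integral_def)
  qed
  also have "\<dots> = integral\<^sup>L lebesgue (\<lambda>x. \<Sum>p\<in>I. indicator (case p of (u, v) \<Rightarrow> {u<..<v}) x * h x)"
    using int by (intro Bochner_Integration.integral_sum[symmetric]) (auto simp: set_integrable_def)
  also have "\<dots> \<le> integral\<^sup>L lebesgue (\<lambda>x. indicator {a..b} x * h x)"
  proof (rule integral_mono)
    show "integrable lebesgue (\<lambda>x. \<Sum>p\<in>I. indicat_real (case p of (u, v) \<Rightarrow> {u<..<v}) x * h x)"
      using int by (intro Bochner_Integration.integrable_sum) (auto simp: set_integrable_def)
    show "integrable lebesgue (\<lambda>x. indicat_real {a..b} x * h x)"
      using h by (simp add: set_integrable_def)
    fix x
    have "(\<Sum>p\<in>I. indicat_real (case p of (u, v) \<Rightarrow> {u<..<v}) x) = indicat_real (\<Union>p\<in>I. case p of (u, v) \<Rightarrow> {u<..<v}) x"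
      using disj \<open>finite I\<close> by (intro indicator_UN_disjoint[symmetric]) auto
    also have "\<dots> \<le> indicator {a..b} x"
    proof -
      have "(\<Union>p\<in>I. case p of (u, v) \<Rightarrow> {u<..<v}) \<subseteq> {a..b}" using I by fastforce
      then show ?thesis by (auto simp: indicator_def)
    qed
    finally show "(\<Sum>p\<in>I. indicat_real (case p of (u, v) \<Rightarrow> {u<..<v}) x * h x) \<le> indicat_real {a..b} x * h x"
      using nn by (simp add: mult_right_mono flip: sum_distrib_right)
  qed
  also have "\<dots> = integral {a..b} h"
    using set_lebesgue_integral_eq_integral(2)[OF h] by (simp add: set_lebesgue_integral_def)
  finally show ?thesis .
qed

text \<open>Uniform integrability of a single function: its part above a high level has small integral.\<close>

lemma integral_truncation_small:
  fixes h :: "real \<Rightarrow> real"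
  assumes h: "h absolutely_integrable_on {a..b}" and nn: "\<And>x. 0 \<le> h x" and e: "e > 0"
  obtains M where "M \<ge> 0" "(\<lambda>x. max 0 (h x - M)) absolutely_integrable_on {a..b}"
     "integral {a..b} (\<lambda>x. max 0 (h x - M)) < e"
proof -
  have I: "integrable (lebesgue_on {a..b}) h" using h by (simp add: absolutely_integrable_imp_integrable)
  have "(\<lambda>n. integral\<^sup>L (lebesgue_on {a..b}) (\<lambda>x. max 0 (h x - real n))) \<longlonglongrightarrow> integral\<^sup>L (lebesgue_on {a..b}) (\<lambda>x. 0)"
  proof (rule integral_dominated_convergence)
    show "integrable (lebesgue_on {a..b}) h" by fact
    show "AE x in lebesgue_on {a..b}. (\<lambda>n. max 0 (h x - real n)) \<longlonglongrightarrow> 0"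
    proof (rule AE_I2)
      fix x
      obtain N where "h x \<le> real N" using real_arch_simple by blast
      then have "\<forall>\<^sub>F n in sequentially. max 0 (h x - real n) = 0"
        by (intro eventually_sequentiallyI[of N]) auto
      then show "(\<lambda>n. max 0 (h x - real n)) \<longlonglongrightarrow> 0" by (rule tendsto_eventually)
    qed
    show "AE x in lebesgue_on {a..b}. norm (max 0 (h x - real n)) \<le> h x" for n
      using nn by (intro AE_I2) (auto simp: max_def)
    show "(\<lambda>x. max 0 (h x - real n)) \<in> borel_measurable (lebesgue_on {a..b})" for n
      using I by measurable
  qed auto
  then have "\<forall>\<^sub>F n in sequentially. integral\<^sup>L (lebesgue_on {a..b}) (\<lambda>x. max 0 (h x - real n)) < e"
    using e by (simp add: order_tendsto_iff)
  then obtain n where n: "integral\<^sup>L (lebesgue_on {a..b}) (\<lambda>x. max 0 (h x - real n)) < e"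
    unfolding eventually_sequentially by blast
  have In: "integrable (lebesgue_on {a..b}) (\<lambda>x. max 0 (h x - real n))"
    by (rule Bochner_Integration.integrable_bound[OF I]) (use I nn in \<open>auto intro!: AE_I2 simp: max_def\<close>)
  show ?thesis
  proof (rule that[of "real n"])
    show "(\<lambda>x. max 0 (h x - real n)) absolutely_integrable_on {a..b}"
      using In by (simp add: set_integrable_def integrable_restrict_space)
    show "integral {a..b} (\<lambda>x. max 0 (h x - real n)) < e"
      using n lebesgue_integral_eq_integral[OF In] by simp
  qed auto
qed

text \<open>Over disjoint intervals of total length \<open>d\<close> the increments add up to at most \<open>M * d\<close> plus the integral of the
  excess of \<open>\<bar>f\<bar>\<close> over \<open>M\<close>, and that excess is small for large \<open>M\<close>.\<close>

lemma abs_cont_on_indefinite_integral: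
  fixes f :: fn
  assumes f: "f absolutely_integrable_on {a..b}"
    and F: "\<And>u v. a \<le> u \<Longrightarrow> u \<le> v \<Longrightarrow> v \<le> b \<Longrightarrow> F v - F u = integral {u..v} f"
  shows "abs_cont_on a b F"
  unfolding abs_cont_on_def
proof (intro allI impI)
  fix e :: real assume e: "e > 0"
  define h where "h x = cmod (f x)" for x
  have h: "h absolutely_integrable_on {a..b}"
    using f unfolding h_def by (rule set_integrable_norm)
  obtain M where M: "M \<ge> 0" "(\<lambda>x. max 0 (h x - M)) absolutely_integrable_on {a..b}"
     "integral {a..b} (\<lambda>x. max 0 (h x - M)) < e / 2"
    using integral_truncation_small[OF h, of "e/2"] e by (auto simp: h_def)
  define r where "r x = max 0 (h x - M)" for x
  have hr: "h x \<le> M + r x" "0 \<le> r x" for x by (auto simp: r_def)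
  have rint: "r absolutely_integrable_on {a..b}" using M by (simp add: r_def[abs_def])
  show "\<exists>\<delta>>0. \<forall>I. finite I \<and> (\<forall>(u, v)\<in>I. a \<le> u \<and> u \<le> v \<and> v \<le> b) \<and>
         disjoint_family_on (\<lambda>(u, v). {u<..<v}) I \<and> (\<Sum>(u, v)\<in>I. v - u) < \<delta> \<longrightarrow>
         (\<Sum>(u, v)\<in>I. cmod (F v - F u)) < e"
  proof (intro exI[of _ "e / (2 * (M + 1))"] conjI allI impI; (elim conjE)?)
    show "0 < e / (2 * (M + 1))" using e M by simp
    fix I :: "(real \<times> real) set"
    assume I: "finite I" "\<forall>(u, v)\<in>I. a \<le> u \<and> u \<le> v \<and> v \<le> b"
      "disjoint_family_on (\<lambda>(u, v). {u<..<v}) I" and small: "(\<Sum>(u, v)\<in>I. v - u) < e / (2 * (M + 1))"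
    have "(\<Sum>(u, v)\<in>I. cmod (F v - F u)) \<le> (\<Sum>(u, v)\<in>I. M * (v - u) + integral {u..v} r)"
    proof (rule sum_mono, clarify)
      fix u v assume uv: "(u, v) \<in> I"
      then have uvI: "a \<le> u" "u \<le> v" "v \<le> b" using I by auto
      have sub: "{u..v} \<subseteq> {a..b}" using uvI by auto
      have fi: "f absolutely_integrable_on {u..v}" "r absolutely_integrable_on {u..v}"
        using f rint sub by (auto intro: absolutely_integrable_on_subinterval)
      have "cmod (F v - F u) = norm (integral {u..v} f)" using F uvI by simp
      also have "\<dots> \<le> integral {u..v} (\<lambda>x. M + r x)"
        using fi hr by (intro integral_norm_bound_integral integrable_add)
          (auto simp: h_def absolutely_integrable_on_def)
      also have "\<dots> = M * (v - u) + integral {u..v} r"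
        using fi uvI by (subst integral_add) (auto simp: absolutely_integrable_on_def)
      finally show "cmod (F v - F u) \<le> M * (v - u) + integral {u..v} r" .
    qed
    also have "\<dots> = M * (\<Sum>(u, v)\<in>I. v - u) + (\<Sum>(u, v)\<in>I. integral {u..v} r)"
      by (simp add: sum.distrib sum_distrib_left case_prod_unfold)
    also have "\<dots> \<le> M * (e / (2 * (M + 1))) + integral {a..b} r"
      using small M(1) I by (intro add_mono mult_left_mono sum_integral_disjoint_le rint hr) auto
    also have "\<dots> < e / 2 + e / 2"
    proof (rule add_le_less_mono)
      show "M * (e / (2 * (M + 1))) \<le> e / 2" using M(1) e by (simp add: field_simps)
    qed (use M in \<open>simp add: r_def[abs_def]\<close>)
    finally show "(\<Sum>(u, v)\<in>I. cmod (F v - F u)) < e" by simp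
  qed
qed

text \<open>Lebesgue's differentiation theorem from the right; reflection will give it from the left.\<close>

lemma indefinite_integral_right_derivative_AE:
  fixes g :: "real \<Rightarrow> complex"
  assumes g: "\<And>a b. g integrable_on {a..b}"
  obtains N where "negligible N"
    "\<And>x e. x \<notin> N \<Longrightarrow> 0 < e \<Longrightarrow> \<exists>d>0. \<forall>h. 0 < h \<and> h < d \<longrightarrow> cmod (integral {x..x + h} g - h *\<^sub>R g x) \<le> e * h"
proof -
  obtain N where N: "negligible N"
    "\<And>x e. x \<notin> N \<Longrightarrow> 0 < e \<Longrightarrow> \<exists>d>0. \<forall>h. 0 < h \<and> h < d \<longrightarrow>
       norm (integral (cbox x (x + h *\<^sub>R One)) g /\<^sub>R h ^ DIM(real) - g x) < e"
    using integrable_ccontinuous_explicit[of g] g by (metis box_real(2))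
  show ?thesis
  proof (rule that[OF N(1)])
    fix x :: real and e :: real assume "x \<notin> N" "0 < e"
    then obtain d where d: "d > 0" "\<And>h. 0 < h \<Longrightarrow> h < d \<Longrightarrow> norm (integral {x..x + h} g /\<^sub>R h - g x) < e"
      using N(2)[of x e] by auto
    have "cmod (integral {x..x + h} g - h *\<^sub>R g x) \<le> e * h" if "0 < h" "h < d" for h
    proof -
      have "integral {x..x + h} g - h *\<^sub>R g x = h *\<^sub>R (integral {x..x + h} g /\<^sub>R h - g x)"
        using that by (simp add: scaleR_diff_right)
      then have "cmod (integral {x..x + h} g - h *\<^sub>R g x) = h * norm (integral {x..x + h} g /\<^sub>R h - g x)"
        using that by simp
      also have "\<dots> \<le> h * e" using d(2)[OF that] that by (intro mult_left_mono) auto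
      finally show ?thesis by (simp add: mult.commute)
    qed
    with d(1) show "\<exists>d>0. \<forall>h. 0 < h \<and> h < d \<longrightarrow> cmod (integral {x..x + h} g - h *\<^sub>R g x) \<le> e * h" by blast
  qed
qed

lemma indefinite_integral_derivative_AE:
  fixes f :: "real \<Rightarrow> complex"
  assumes f: "\<And>b. f integrable_on {l..b}"
  obtains N where "negligible N"
    "\<And>x. x \<in> {l..} - N \<Longrightarrow> ((\<lambda>x. integral {l..x} f) has_vector_derivative f x) (at x within {l..})"
proof -
  \<comment> \<open>Extended by \<open>0\<close>, the function can be integrated to both sides of any point.\<close>
  define g where "g x = (if x \<in> {l..} then f x else 0)" for x
  have gint: "g integrable_on {a..b}" for a b
  proof -
    have "f integrable_on {max a l..b}"
      using f[of b] by (rule integrable_on_subinterval) auto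
    moreover have "{l..} \<inter> {a..b} = {max a l..b}" by auto
    ultimately show ?thesis
      unfolding g_def[abs_def] by (simp only: integrable_restrict_Int)
  qed
  have gint': "(\<lambda>x. g (- x)) integrable_on {a..b}" for a b
    using gint[of "-b" "-a"] Henstock_Kurzweil_Integration.integrable_reflect_real[of g "-a" "-b"] by simp
  obtain N1 where N1: "negligible N1"
    "\<And>x e. x \<notin> N1 \<Longrightarrow> 0 < e \<Longrightarrow> \<exists>d>0. \<forall>h. 0 < h \<and> h < d \<longrightarrow> cmod (integral {x..x + h} g - h *\<^sub>R g x) \<le> e * h"
    using indefinite_integral_right_derivative_AE[OF gint] by blast
  obtain N2 where N2: "negligible N2"
    "\<And>x e. x \<notin> N2 \<Longrightarrow> 0 < e \<Longrightarrow> \<exists>d>0. \<forall>h. 0 < h \<and> h < d \<longrightarrow> cmod (integral {x..x + h} (\<lambda>x. g (- x)) - h *\<^sub>R g (- x)) \<le> e * h"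
    using indefinite_integral_right_derivative_AE[OF gint'] by blast
  have N2': "negligible (uminus ` N2)"
    by (rule negligible_differentiable_image_negligible[OF order_refl N2(1)])
      (auto intro!: derivative_intros)
  show ?thesis
  proof (rule that[of "N1 \<union> uminus ` N2"])
    show "negligible (N1 \<union> uminus ` N2)" using N1 N2' by simp
    fix x assume x: "x \<in> {l..} - (N1 \<union> uminus ` N2)"
    then have "x \<notin> uminus ` N2" by blast
    then have "- x \<notin> N2" by (metis imageI minus_minus)
    with x have x1: "x \<notin> N1" "- x \<notin> N2" "x \<ge> l" by auto
    have diff: "integral {l..v} f - integral {l..u} f = integral {u..v} g" if "l \<le> u" "u \<le> v" for u v
    proof -
      have "integral {l..u} f + integral {u..v} f = integral {l..v} f"
        using that f by (intro Henstock_Kurzweil_Integration.integral_combine) auto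
      moreover have "integral {u..v} f = integral {u..v} g"
        using that by (intro Henstock_Kurzweil_Integration.integral_cong) (auto simp: g_def)
      ultimately show ?thesis by (simp add: algebra_simps)
    qed
    have gx: "g x = f x" using x1 by (simp add: g_def)
    show "((\<lambda>x. integral {l..x} f) has_vector_derivative f x) (at x within {l..})"
      unfolding has_vector_derivative_def has_derivative_within_alt
    proof (intro conjI allI impI bounded_linear_scaleR_left)
      fix e :: real assume "e > 0"
      obtain d1 where d1: "d1 > 0" "\<And>h. 0 < h \<and> h < d1 \<Longrightarrow> cmod (integral {x..x + h} g - h *\<^sub>R g x) \<le> e * h"
        using N1(2)[OF x1(1) \<open>e > 0\<close>] by blast
      obtain d2 where d2: "d2 > 0" "\<And>h. 0 < h \<and> h < d2 \<Longrightarrow> cmod (integral {-x..-x + h} (\<lambda>x. g (- x)) - h *\<^sub>R g x) \<le> e * h"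
        using N2(2)[OF x1(2) \<open>e > 0\<close>] by auto
      show "\<exists>d>0. \<forall>y\<in>{l..}. norm (y - x) < d \<longrightarrow>
              norm (integral {l..y} f - integral {l..x} f - (y - x) *\<^sub>R f x) \<le> e * norm (y - x)"
      proof (intro exI[of _ "min d1 d2"] conjI ballI impI)
        show "0 < min d1 d2" using d1 d2 by simp
        fix y assume y: "y \<in> {l..}" "norm (y - x) < min d1 d2"
        consider "y = x" | "y > x" | "y < x" by linarith
        then show "norm (integral {l..y} f - integral {l..x} f - (y - x) *\<^sub>R f x) \<le> e * norm (y - x)"
        proof cases
          case 2
          then show ?thesis using d1(2)[of "y - x"] y x1 diff[of x y] by (simp add: gx)
        next
          case 3
          have "integral {-x..-y} (\<lambda>x. g (- x)) = integral {y..x} g"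
            using Henstock_Kurzweil_Integration.integral_reflect_real[of x y g] by simp
          moreover have "integral {l..y} f - integral {l..x} f - (y - x) *\<^sub>R f x = - (integral {y..x} g - (x - y) *\<^sub>R f x)"
            using diff[of y x] 3 y by (simp add: algebra_simps)
          moreover have "cmod (integral {-x..-x + (x - y)} (\<lambda>x. g (- x)) - (x - y) *\<^sub>R g x) \<le> e * (x - y)"
            using d2(2)[of "x - y"] y 3 by auto
          ultimately show ?thesis using 3 by (simp only: gx norm_minus_cancel) simp
        qed simp
      qed
    qed
  qed
qed

section \<open>Local primitives on a half-line\<close>

text \<open>By the results of the preceding section, \<open>F\<close> is a local primitive of \<open>f\<close> exactly if \<open>f\<close> is locally
  integrable and \<open>F\<close> is locally absolutely continuous with derivative \<open>f\<close> almost everywhere. The integral form is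
  the definition because it has no exceptional set.\<close>

definition loc_primitive :: "real \<Rightarrow> fn \<Rightarrow> fn \<Rightarrow> bool" where
  "loc_primitive l F f \<longleftrightarrow>
     (\<forall>b. f absolutely_integrable_on {l..b}) \<and> (\<forall>x\<ge>l. F x = F l + integral {l..x} f)"

lemma loc_primitiveD_int: "loc_primitive l F f \<Longrightarrow> l \<le> a \<Longrightarrow> f absolutely_integrable_on {a..b}"
  unfolding loc_primitive_def
  by (rule absolutely_integrable_on_subinterval[where S="{l..b}"]) auto

lemma loc_primitiveD: "loc_primitive l F f \<Longrightarrow> l \<le> x \<Longrightarrow> F x = F l + integral {l..x} f"
  unfolding loc_primitive_def by blast

lemma loc_primitive_diff:
  assumes "loc_primitive l F f" "l \<le> a" "a \<le> b"
  shows "F b - F a = integral {a..b} f"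
proof -
  have "integral {l..a} f + integral {a..b} f = integral {l..b} f"
    using assms loc_primitiveD_int[OF assms(1) order_refl]
    by (intro Henstock_Kurzweil_Integration.integral_combine)
       (auto intro: set_lebesgue_integral_eq_integral(1))
  moreover have "F a = F l + integral {l..a} f" "F b = F l + integral {l..b} f"
    using assms unfolding loc_primitive_def by (meson order_trans)+
  ultimately show ?thesis by (simp add: algebra_simps)
qed

lemma loc_primitive_has_integral:
  assumes "loc_primitive l F f" "l \<le> a" "a \<le> b"
  shows "(f has_integral (F b - F a)) {a..b}"
  using loc_primitive_diff[OF assms] loc_primitiveD_int[OF assms(1,2)]
  by (metis set_lebesgue_integral_eq_integral(1) integrable_integral)

lemma loc_primitive_cong:
  assumes "loc_primitive l F f" "\<And>x. x \<ge> l \<Longrightarrow> F x = G x" "negligible N" "\<And>x. x \<in> {l..} - N \<Longrightarrow> f x = g x"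
  shows "loc_primitive l G g"
  unfolding loc_primitive_def
proof (intro conjI allI impI)
  show "g absolutely_integrable_on {l..b}" for b
    using assms(3,4) loc_primitiveD_int[OF assms(1) order_refl]
    by (intro absolutely_integrable_spike[where f=f and T="{l..b}" and S=N and g=g]) auto
  fix x assume "l \<le> x"
  have "integral {l..x} f = integral {l..x} g"
    using assms(3,4) by (intro integral_spike[where S=N]) auto
  then show "G x = G l + integral {l..x} g"
    using assms(1,2) \<open>l \<le> x\<close> by (metis loc_primitive_def order_refl)
qed

lemma loc_primitive_loc_abs_cont: "loc_primitive l F f \<Longrightarrow> loc_abs_cont l F"
  unfolding loc_abs_cont_def
  by (intro allI impI abs_cont_on_indefinite_integral[where f=f])
     (auto simp: loc_primitiveD_int loc_primitive_diff)

text \<open>This and the preceding lemma lead from the integral form to the form with derivatives; the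
  converse is \<open>loc_primitiveI\<close>.\<close>

lemma loc_primitive_derivative_AE:
  assumes "loc_primitive l F f"
  obtains N where "negligible N" "\<And>x. x \<in> {l..} - N \<Longrightarrow> (F has_vector_derivative f x) (at x within {l..})"
proof -
  obtain N where N: "negligible N"
    "\<And>x. x \<in> {l..} - N \<Longrightarrow> ((\<lambda>x. integral {l..x} f) has_vector_derivative f x) (at x within {l..})"
    using indefinite_integral_derivative_AE[of f l] loc_primitiveD_int[OF assms order_refl]
    by (metis set_lebesgue_integral_eq_integral(1))
  show ?thesis
  proof (rule that[OF N(1)])
    fix x assume x: "x \<in> {l..} - N"
    have "((\<lambda>x. F l + integral {l..x} f) has_vector_derivative 0 + f x) (at x within {l..})"
      using N(2)[OF x] by (intro has_vector_derivative_add) auto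
    moreover have "F u = F l + integral {l..u} f" if "u \<in> {l..}" for u
      using that by (intro loc_primitiveD[OF assms]) auto
    ultimately show "(F has_vector_derivative f x) (at x within {l..})"
      using x has_vector_derivative_transform[of x "{l..}" F "\<lambda>u. F l + integral {l..u} f" "f x"]
      unfolding add_0_left by blast
  qed
qed

lemma loc_primitiveI:
  assumes ac: "loc_abs_cont l F" and int: "\<And>b. f absolutely_integrable_on {l..b}"
    and N: "negligible N" and der: "\<And>x. x \<in> {l..} - N \<Longrightarrow> (F has_vector_derivative f x) (at x within {l..})"
  shows "loc_primitive l F f"
  unfolding loc_primitive_def
proof (intro conjI allI impI int)
  fix x assume "l \<le> x"
  have "(f has_integral (F x - F l)) {l..x}"
    by (rule abs_cont_on_imp_FTC[OF \<open>l \<le> x\<close> _ N])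
       (use ac \<open>l \<le> x\<close> in \<open>auto simp: loc_abs_cont_def intro!: has_vector_derivative_within_subset[OF der]\<close>)
  then show "F x = F l + integral {l..x} f" by (simp add: integral_unique)
qed

lemma at_within_halfline:
  fixes l x :: real
  shows "l \<le> x \<Longrightarrow> at x within {l..x + 1} = at x within {l..}"
  by (intro at_within_nhd[of _ "{..<x+1}"]) auto

lemma continuous_on_halfline:
  fixes f :: "real \<Rightarrow> 'a :: topological_space"
  assumes "\<And>b. continuous_on {l..b} f" shows "continuous_on {l..} f"
  unfolding continuous_on_eq_continuous_within
proof
  fix x assume "x \<in> {l..}"
  then show "continuous (at x within {l..}) f"
    using assms[of "x + 1"] by (simp add: continuous_on_eq_continuous_within flip: at_within_halfline)
qed

lemma loc_primitive_continuous_on: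
  assumes "loc_primitive l F f" shows "continuous_on {l..} F"
proof (rule continuous_on_halfline)
  fix b
  have "continuous_on {l..b} (\<lambda>x. F l + integral {l..x} f)"
    using loc_primitiveD_int[OF assms order_refl, of b]
    by (intro continuous_intros indefinite_integral_continuous_1 set_lebesgue_integral_eq_integral(1))
  then show "continuous_on {l..b} F"
    by (rule continuous_on_eq) (auto intro: loc_primitiveD[OF assms, symmetric])
qed

lemma absolutely_integrable_mult_continuous:
  fixes f g :: "real \<Rightarrow> 'b :: {real_normed_field, euclidean_space}"
  assumes "f absolutely_integrable_on {a..b}" "continuous_on {a..b} g"
  shows "(\<lambda>x. f x * g x) absolutely_integrable_on {a..b}" "(\<lambda>x. g x * f x) absolutely_integrable_on {a..b}"
proof -
  have "(\<lambda>x. g x * f x) absolutely_integrable_on {a..b}"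
    using assms
    by (intro absolutely_integrable_bounded_measurable_product[OF bilinear_times])
       (auto intro: continuous_imp_measurable_on_sets_lebesgue compact_imp_bounded compact_continuous_image)
  then show "(\<lambda>x. f x * g x) absolutely_integrable_on {a..b}" "(\<lambda>x. g x * f x) absolutely_integrable_on {a..b}"
    by (simp_all add: mult.commute)
qed

lemma abs_cont_on_mult:
  assumes f: "abs_cont_on a b f" and g: "abs_cont_on a b g"
    and cf: "continuous_on {a..b} f" and cg: "continuous_on {a..b} g"
  shows "abs_cont_on a b (\<lambda>x. f x * g x)"
proof -
  have "bounded (f ` {a..b})" "bounded (g ` {a..b})"
    using cf cg by (auto intro: compact_imp_bounded compact_continuous_image)
  then obtain A B where A: "A > 0" "\<And>x. x \<in> {a..b} \<Longrightarrow> cmod (f x) \<le> A"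
    and B: "B > 0" "\<And>x. x \<in> {a..b} \<Longrightarrow> cmod (g x) \<le> B"
    unfolding bounded_pos by auto
  show ?thesis
    unfolding abs_cont_on_def
  proof (intro allI impI)
    fix e :: real assume e: "e > 0"
    have e2: "e / (2 * A) > 0" "e / (2 * B) > 0" using e A B by auto
    obtain d1 where d1: "d1 > 0" "\<And>I. finite I \<and> (\<forall>(u, v)\<in>I. a \<le> u \<and> u \<le> v \<and> v \<le> b) \<and>
        disjoint_family_on (\<lambda>(u, v). {u<..<v}) I \<and> (\<Sum>(u, v)\<in>I. v - u) < d1
        \<Longrightarrow> (\<Sum>(u, v)\<in>I. cmod (f v - f u)) < e / (2 * B)"
      using f[unfolded abs_cont_on_def, rule_format, OF e2(2)] by blast
    obtain d2 where d2: "d2 > 0" "\<And>I. finite I \<and> (\<forall>(u, v)\<in>I. a \<le> u \<and> u \<le> v \<and> v \<le> b) \<and>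
        disjoint_family_on (\<lambda>(u, v). {u<..<v}) I \<and> (\<Sum>(u, v)\<in>I. v - u) < d2
        \<Longrightarrow> (\<Sum>(u, v)\<in>I. cmod (g v - g u)) < e / (2 * A)"
      using g[unfolded abs_cont_on_def, rule_format, OF e2(1)] by blast
    show "\<exists>\<delta>>0. \<forall>I. finite I \<and> (\<forall>(u, v)\<in>I. a \<le> u \<and> u \<le> v \<and> v \<le> b) \<and>
        disjoint_family_on (\<lambda>(u, v). {u<..<v}) I \<and> (\<Sum>(u, v)\<in>I. v - u) < \<delta> \<longrightarrow>
        (\<Sum>(u, v)\<in>I. cmod (f v * g v - f u * g u)) < e"
    proof (intro exI[of _ "min d1 d2"] conjI allI impI)
      show "min d1 d2 > 0" using d1 d2 by simp
      fix I :: "(real \<times> real) set"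
      assume I: "finite I \<and> (\<forall>(u, v)\<in>I. a \<le> u \<and> u \<le> v \<and> v \<le> b) \<and>
        disjoint_family_on (\<lambda>(u, v). {u<..<v}) I \<and> (\<Sum>(u, v)\<in>I. v - u) < min d1 d2"
      have "(\<Sum>(u, v)\<in>I. cmod (f v * g v - f u * g u)) \<le>
            (\<Sum>(u, v)\<in>I. B * cmod (f v - f u) + A * cmod (g v - g u))"
      proof (rule sum_mono, clarify)
        fix u v assume "(u, v) \<in> I"
        then have uv: "u \<in> {a..b}" "v \<in> {a..b}" using I by fastforce+
        have "f v * g v - f u * g u = g v * (f v - f u) + f u * (g v - g u)" by (simp add: algebra_simps)
        then have "cmod (f v * g v - f u * g u) \<le> cmod (g v) * cmod (f v - f u) + cmod (f u) * cmod (g v - g u)"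
          by (metis norm_mult norm_triangle_ineq)
        also have "\<dots> \<le> B * cmod (f v - f u) + A * cmod (g v - g u)"
          using A(2)[OF uv(1)] B(2)[OF uv(2)] by (intro add_mono mult_right_mono) auto
        finally show "cmod (f v * g v - f u * g u) \<le> B * cmod (f v - f u) + A * cmod (g v - g u)" .
      qed
      also have "\<dots> = B * (\<Sum>(u, v)\<in>I. cmod (f v - f u)) + A * (\<Sum>(u, v)\<in>I. cmod (g v - g u))"
        by (simp add: sum.distrib sum_distrib_left case_prod_unfold)
      also have "\<dots> < B * (e / (2 * B)) + A * (e / (2 * A))"
        using A(1) B(1) I by (intro add_strict_mono mult_strict_left_mono d1(2) d2(2)) auto
      also have "\<dots> = e" using A B by simp
      finally show "(\<Sum>(u, v)\<in>I. cmod (f v * g v - f u * g u)) < e" .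
    qed
  qed
qed

text \<open>Integration by parts for functions that are differentiable only almost everywhere. The product rule is applied
  pointwise, and the product is again absolutely continuous.\<close>

lemma loc_primitive_mult:
  assumes F: "loc_primitive l F f" and G: "loc_primitive l G g"
  shows "loc_primitive l (\<lambda>x. F x * G x) (\<lambda>x. f x * G x + F x * g x)"
proof -
  obtain N where N: "negligible N" "\<And>x. x \<in> {l..} - N \<Longrightarrow> (F has_vector_derivative f x) (at x within {l..})"
    using loc_primitive_derivative_AE[OF F] by blast
  obtain M where M: "negligible M" "\<And>x. x \<in> {l..} - M \<Longrightarrow> (G has_vector_derivative g x) (at x within {l..})"
    using loc_primitive_derivative_AE[OF G] by blast
  have cF: "continuous_on {l..b} F" and cG: "continuous_on {l..b} G" for b
    using loc_primitive_continuous_on[OF F] loc_primitive_continuous_on[OF G]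
    by (auto intro: continuous_on_subset)
  show ?thesis
  proof (rule loc_primitiveI)
    show "loc_abs_cont l (\<lambda>x. F x * G x)"
      using loc_primitive_loc_abs_cont[OF F] loc_primitive_loc_abs_cont[OF G] cF cG
      by (auto simp: loc_abs_cont_def intro!: abs_cont_on_mult)
    show "(\<lambda>x. f x * G x + F x * g x) absolutely_integrable_on {l..b}" for b
      using loc_primitiveD_int[OF F order_refl, of b] loc_primitiveD_int[OF G order_refl, of b] cF[of b] cG[of b]
      by (intro set_integral_add absolutely_integrable_mult_continuous)
    show "negligible (N \<union> M)" using N M by simp
    fix x assume "x \<in> {l..} - (N \<union> M)"
    then show "((\<lambda>x. F x * G x) has_vector_derivative f x * G x + F x * g x) (at x within {l..})"
      using has_vector_derivative_mult[OF N(2)[of x] M(2)[of x]] by (simp add: add.commute)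
  qed
qed

lemma loc_primitive_add:
  assumes F: "loc_primitive l F f" and G: "loc_primitive l G g"
  shows "loc_primitive l (\<lambda>x. F x + G x) (\<lambda>x. f x + g x)"
  unfolding loc_primitive_def
proof (intro conjI allI impI)
  show "(\<lambda>x. f x + g x) absolutely_integrable_on {l..b}" for b
    using loc_primitiveD_int[OF F order_refl] loc_primitiveD_int[OF G order_refl]
    by (intro set_integral_add) auto
  fix x assume "l \<le> x"
  have "integral {l..x} (\<lambda>x. f x + g x) = integral {l..x} f + integral {l..x} g"
    using loc_primitiveD_int[OF F order_refl] loc_primitiveD_int[OF G order_refl]
    by (intro Henstock_Kurzweil_Integration.integral_add set_lebesgue_integral_eq_integral(1)) auto
  moreover have "F x = F l + integral {l..x} f" "G x = G l + integral {l..x} g"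
    using F G \<open>l \<le> x\<close> unfolding loc_primitive_def by blast+
  ultimately show "F x + G x = F l + G l + integral {l..x} (\<lambda>x. f x + g x)" by simp
qed

lemma loc_primitive_cmult:
  assumes F: "loc_primitive l F f"
  shows "loc_primitive l (\<lambda>x. c * F x) (\<lambda>x. c * f x)"
  unfolding loc_primitive_def
proof (intro conjI allI impI)
  show "(\<lambda>x. c * f x) absolutely_integrable_on {l..b}" for b
    using loc_primitiveD_int[OF F order_refl, of b] by (rule set_integrable_mult_right) 
  fix x assume "l \<le> x"
  then have "F x = F l + integral {l..x} f"
    using F unfolding loc_primitive_def by blast
  then show "c * F x = c * F l + integral {l..x} (\<lambda>x. c * f x)"
    by (simp add: distrib_left)
qed

lemma loc_primitive_cnj:
  assumes F: "loc_primitive l F f"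
  shows "loc_primitive l (\<lambda>x. cnj (F x)) (\<lambda>x. cnj (f x))"
  unfolding loc_primitive_def
proof (intro conjI allI impI)
  show "(\<lambda>x. cnj (f x)) absolutely_integrable_on {l..b}" for b
    using absolutely_integrable_linear[OF loc_primitiveD_int[OF F order_refl, of b] bounded_linear_cnj]
    by (simp add: o_def)
  show "cnj (F x) = cnj (F l) + integral {l..x} (\<lambda>x. cnj (f x))" if "x \<ge> l" for x
  proof -
    have "F x = F l + integral {l..x} f"
      using F that unfolding loc_primitive_def by blast
    then show ?thesis by (simp add: integral_cnj)
  qed
qed

lemma loc_primitive_C1:
  assumes "\<And>x. x \<ge> l \<Longrightarrow> (F has_vector_derivative f x) (at x within {l..})" and c: "continuous_on {l..} f"
  shows "loc_primitive l F f"
  unfolding loc_primitive_def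
proof (intro conjI allI impI)
  show "f absolutely_integrable_on {l..b}" for b
    by (rule absolutely_integrable_continuous_real) (rule continuous_on_subset[OF c], auto)
  fix x assume x: "l \<le> x"
  have "(f has_integral (F x - F l)) {l..x}"
    using x by (intro fundamental_theorem_of_calculus) (auto intro: has_vector_derivative_within_subset[OF assms(1)])
  then show "F x = F l + integral {l..x} f" by (simp add: integral_unique)
qed

lemma loc_primitive_continuous_derivative:
  assumes F: "loc_primitive l F f" and c: "continuous_on {l..} f" and x: "x \<ge> l"
  shows "(F has_vector_derivative f x) (at x within {l..})"
proof -
  have "((\<lambda>u. integral {l..u} f) has_vector_derivative f x) (at x within {l..x+1})"
    using x by (intro integral_has_vector_derivative continuous_on_subset[OF c]) auto
  then have "((\<lambda>u. integral {l..u} f) has_vector_derivative f x) (at x within {l..})"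
    unfolding at_within_halfline[OF x] .
  then have "((\<lambda>u. F l + integral {l..u} f) has_vector_derivative 0 + f x) (at x within {l..})"
    by (intro has_vector_derivative_add) auto
  moreover have "F u = F l + integral {l..u} f" if "u \<in> {l..}" for u
    using that by (intro loc_primitiveD[OF F]) auto
  ultimately show ?thesis
    using x has_vector_derivative_transform[of x "{l..}" F "\<lambda>u. F l + integral {l..u} f" "f x"]
    unfolding add_0_left by blast
qed

section \<open>The differential equation as a first-order system\<close>

text \<open>The system for \<open>y\<close> and its derivative that expresses \<open>- y'' + q y = f\<close>. The derivative is carried as a function of
  its own, so that second derivatives, which exist only almost everywhere, never occur. Only values on \<open>[l, \<infinity>)\<close>
  matter.\<close>

definition schr_eq :: "(real \<Rightarrow> real) \<Rightarrow> real \<Rightarrow> fn \<Rightarrow> fn \<Rightarrow> fn \<Rightarrow> bool" where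
  "schr_eq q l f y y' \<longleftrightarrow>
     loc_primitive l y y' \<and> loc_primitive l y' (\<lambda>x. complex_of_real (q x) * y x - f x)"

lemma vector_derivative_within_halfline:
  assumes "(f has_vector_derivative f') (at x within {l..})" "x \<ge> (l::real)"
  shows "vector_derivative f (at x within {l..}) = f'"
proof (rule vector_derivative_within[OF _ assms(1)])
  have "at_right x \<noteq> bot" by simp
  moreover have "at_right x \<le> at x within {l..}" using assms(2) by (intro at_le) auto
  ultimately show "at x within {l..} \<noteq> bot" by (metis bot.extremum_uniqueI)
qed

lemma schr_eq_cong:
  assumes "schr_eq q l f y y'" "\<And>x. x \<ge> l \<Longrightarrow> y x = u x" "\<And>x. x \<ge> l \<Longrightarrow> y' x = u' x" "\<And>x. x \<ge> l \<Longrightarrow> f x = g x"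
  shows "schr_eq q l g u u'"
  using assms unfolding schr_eq_def
  by (auto intro!: loc_primitive_cong[of l y y' u "{}" u'] loc_primitive_cong[of l y' _ u' "{}"])

text \<open>This lemma and the next translate between the system and the pointwise formulation with \<^const>\<open>hderiv\<close>
  and \<^const>\<open>schr\<close>. Here the second derivative exists almost everywhere by Lebesgue differentiation.\<close>

lemma schr_eq_imp_loc_abs_cont2:
  assumes y: "schr_eq q l f y y'" and 0: "\<And>x. x < l \<Longrightarrow> y x = 0"
  shows "loc_abs_cont2 l y" "\<And>x. x \<ge> l \<Longrightarrow> hderiv l y x = y' x"
    "AE x in lebesgue_on {l..}. schr q l y x = f x"
proof -
  have y1: "loc_primitive l y y'" and y2: "loc_primitive l y' (\<lambda>x. complex_of_real (q x) * y x - f x)"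
    using y by (auto simp: schr_eq_def)
  have der: "(y has_vector_derivative y' x) (at x within {l..})" if "x \<ge> l" for x
    by (rule loc_primitive_continuous_derivative[OF y1 loc_primitive_continuous_on[OF y2] that])
  show hd: "hderiv l y x = y' x" if "x \<ge> l" for x
    unfolding hderiv_def by (rule vector_derivative_within_halfline[OF der[OF that] that])
  have h2: "loc_primitive l (hderiv l y) (\<lambda>x. complex_of_real (q x) * y x - f x)"
    by (rule loc_primitive_cong[OF y2 _ negligible_empty]) (auto simp: hd)
  obtain N where N: "negligible N"
     "\<And>x. x \<in> {l..} - N \<Longrightarrow> (hderiv l y has_vector_derivative (complex_of_real (q x) * y x - f x)) (at x within {l..})"
    using loc_primitive_derivative_AE[OF h2] by blast
  show "loc_abs_cont2 l y"
    unfolding loc_abs_cont2_def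
  proof (intro conjI allI impI)
    show "AE x in lebesgue_on {l..}. hderiv l y differentiable at x within {l..}"
      using N by (subst AE_lebesgue_on_iff_negligible) (auto intro!: exI[of _ N] intro: differentiableI_vector)
  qed (use 0 der loc_primitive_loc_abs_cont[OF y1] loc_primitive_loc_abs_cont[OF h2] in \<open>auto intro: differentiableI_vector\<close>)
  show "AE x in lebesgue_on {l..}. schr q l y x = f x"
  proof (subst AE_lebesgue_on_iff_negligible)
    have "schr q l y x = f x" if "x \<in> {l..} - N" for x
      using vector_derivative_within_halfline[OF N(2)[OF that]] that
      by (simp add: schr_def hderiv_def[of l "hderiv l y"])
    with N(1) show "\<exists>N. negligible N \<and> (\<forall>x\<in>{l..} - N. schr q l y x = f x)" by blast
  qed auto
qed

lemma loc_abs_cont2_imp_schr_eq: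
  assumes y: "loc_abs_cont2 l y" and q: "\<And>b. q absolutely_integrable_on {l..b}"
    and f: "\<And>b. f absolutely_integrable_on {l..b}" and eq: "AE x in lebesgue_on {l..}. schr q l y x = f x"
  shows "schr_eq q l f y (hderiv l y)"
proof -
  obtain N where N: "negligible N" "\<And>x. x \<in> {l..} - N \<Longrightarrow> schr q l y x = f x"
    using eq by (subst (asm) AE_lebesgue_on_iff_negligible) auto
  have "AE x in lebesgue_on {l..}. hderiv l y differentiable (at x within {l..})"
    using y by (simp add: loc_abs_cont2_def)
  then obtain M where M: "negligible M" "\<And>x. x \<in> {l..} - M \<Longrightarrow> hderiv l y differentiable (at x within {l..})"
    by (subst (asm) AE_lebesgue_on_iff_negligible) auto
  have d1: "(y has_vector_derivative hderiv l y x) (at x within {l..})" if "x \<ge> l" for x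
    using y that unfolding loc_abs_cont2_def hderiv_def by (simp add: vector_derivative_works)
  have d2: "(hderiv l y has_vector_derivative (complex_of_real (q x) * y x - f x)) (at x within {l..})"
    if "x \<in> {l..} - (N \<union> M)" for x
  proof -
    have "(hderiv l y has_vector_derivative hderiv l (hderiv l y) x) (at x within {l..})"
      using M(2)[of x] that unfolding hderiv_def[of l "hderiv l y"] by (simp add: vector_derivative_works)
    moreover have "hderiv l (hderiv l y) x = complex_of_real (q x) * y x - f x"
      using N(2)[of x] that by (auto simp: schr_def algebra_simps)
    ultimately show ?thesis by simp
  qed
  have cy: "continuous_on {l..} y"
    using d1 by (auto simp: continuous_on_eq_continuous_within intro: has_vector_derivative_continuous)
  have qc: "(\<lambda>x. complex_of_real (q x)) absolutely_integrable_on {l..b}" for b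
    using absolutely_integrable_linear[OF q bounded_linear_of_real, of b] by (simp add: o_def)
  have qy: "(\<lambda>x. complex_of_real (q x) * y x - f x) absolutely_integrable_on {l..b}" for b
    by (intro set_integral_diff absolutely_integrable_mult_continuous qc f continuous_on_subset[OF cy]) auto
  have p2: "loc_primitive l (hderiv l y) (\<lambda>x. complex_of_real (q x) * y x - f x)"
  proof (rule loc_primitiveI[OF _ qy])
    show "negligible (N \<union> M)" using N M by simp
  qed (use y d2 in \<open>auto simp: loc_abs_cont2_def\<close>)
  have p1: "loc_primitive l y (hderiv l y)"
    by (rule loc_primitive_C1[OF d1 loc_primitive_continuous_on[OF p2]])
  show ?thesis using p1 p2 by (simp add: schr_eq_def)
qed

lemma solves_imp_schr_eq:
  assumes y: "solves q l z y" and q: "\<And>b. q absolutely_integrable_on {l..b}"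
  shows "schr_eq q l (\<lambda>x. z * y x) y (hderiv l y)"
proof (rule loc_abs_cont2_imp_schr_eq[OF _ q])
  show "loc_abs_cont2 l y" "AE x in lebesgue_on {l..}. schr q l y x = z * y x"
    using y by (auto simp: solves_def)
  have "continuous_on {l..} y"
    using y unfolding solves_def loc_abs_cont2_def
    by (auto simp: continuous_on_eq_continuous_within intro: differentiable_imp_continuous_within)
  then show "(\<lambda>x. z * y x) absolutely_integrable_on {l..b}" for b
    by (intro absolutely_integrable_continuous_real continuous_intros) (auto intro: continuous_on_subset)
qed

lemma schr_eq_imp_solves:
  assumes "schr_eq q l (\<lambda>x. z * y x) y y'" "\<And>x. x < l \<Longrightarrow> y x = 0"
  shows "solves q l z y"
  using schr_eq_imp_loc_abs_cont2[OF assms] by (simp add: solves_def)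

lemma schr_eq_add:
  assumes "schr_eq q l f y y'" "schr_eq q l g u u'"
  shows "schr_eq q l (\<lambda>x. f x + g x) (\<lambda>x. y x + u x) (\<lambda>x. y' x + u' x)"
  unfolding schr_eq_def
proof
  show "loc_primitive l (\<lambda>x. y x + u x) (\<lambda>x. y' x + u' x)"
    using assms unfolding schr_eq_def by (blast intro: loc_primitive_add)
  have "loc_primitive l (\<lambda>x. y' x + u' x) (\<lambda>x. (q x * y x - f x) + (q x * u x - g x))"
    using assms unfolding schr_eq_def by (intro loc_primitive_add) auto
  then show "loc_primitive l (\<lambda>x. y' x + u' x) (\<lambda>x. q x * (y x + u x) - (f x + g x))"
    by (simp add: algebra_simps)
qed

lemma schr_eq_cmult:
  assumes "schr_eq q l f y y'"
  shows "schr_eq q l (\<lambda>x. c * f x) (\<lambda>x. c * y x) (\<lambda>x. c * y' x)"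
  unfolding schr_eq_def
proof
  show "loc_primitive l (\<lambda>x. c * y x) (\<lambda>x. c * y' x)"
    using assms unfolding schr_eq_def by (blast intro: loc_primitive_cmult)
  have "loc_primitive l (\<lambda>x. c * y' x) (\<lambda>x. c * (q x * y x - f x))"
    using assms unfolding schr_eq_def by (intro loc_primitive_cmult) auto
  then show "loc_primitive l (\<lambda>x. c * y' x) (\<lambda>x. q x * (c * y x) - c * f x)"
    by (simp add: algebra_simps)
qed

lemma schr_eq_cnj:
  assumes "schr_eq q l f y y'"
  shows "schr_eq q l (\<lambda>x. cnj (f x)) (\<lambda>x. cnj (y x)) (\<lambda>x. cnj (y' x))"
  using assms loc_primitive_cnj[of l y y'] loc_primitive_cnj[of l y'] unfolding schr_eq_def by fastforce

lemma schr_eq_continuous: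
  assumes "schr_eq q l f y y'"
  shows "continuous_on {l..} y" "continuous_on {l..} y'"
  using assms loc_primitive_continuous_on by (auto simp: schr_eq_def)

text \<open>The potential cancels, so the derivative of the Wronskian involves only \<open>y\<close>, \<open>u\<close> and their images.\<close>

lemma wronskian_primitive:
  assumes y: "schr_eq q l f y y'" and u: "schr_eq q l g u u'"
  shows "loc_primitive l (\<lambda>x. y x * u' x - y' x * u x) (\<lambda>x. f x * u x - y x * g x)"
proof -
  have "loc_primitive l (\<lambda>x. y x * u' x + (-1) * (y' x * u x))
          (\<lambda>x. (y' x * u' x + y x * (complex_of_real (q x) * u x - g x)) +
               (-1) * ((complex_of_real (q x) * y x - f x) * u x + y' x * u' x))"
    using y u unfolding schr_eq_def
    by (intro loc_primitive_add loc_primitive_cmult loc_primitive_mult) auto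
  then show ?thesis
    by (rule loc_primitive_cong[OF _ _ negligible_empty]) (auto simp: algebra_simps)
qed

section \<open>Initial value problems\<close>

text \<open>\<open>K ^ (n + 1) / (n + 1)\<close> is a primitive of \<open>k * K ^ n\<close> although \<open>k\<close> is merely integrable. This replaces, for
  integrable kernels, the powers of \<open>x\<close> that occur in Gronwall's inequality and in Picard iteration with bounded
  kernels.\<close>

lemma integral_power_primitive:
  fixes k :: "real \<Rightarrow> real"
  assumes k: "\<And>b. k absolutely_integrable_on {l..b}" and x: "l \<le> x"
  defines "K \<equiv> \<lambda>x. integral {l..x} k"
  shows "((\<lambda>t. k t * K t ^ n) has_integral (K x ^ Suc n / real (Suc n))) {l..x}"
proof -
  have kc: "(\<lambda>x. complex_of_real (k x)) absolutely_integrable_on {l..b}" for b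
    using absolutely_integrable_linear[OF k bounded_linear_of_real, of b] by (simp add: o_def)
  have int_of: "integral {l..x} (\<lambda>x. complex_of_real (k x)) = complex_of_real (K x)" for x
    using integral_linear[OF set_lebesgue_integral_eq_integral(1)[OF k] bounded_linear_of_real, of x]
    by (simp add: o_def K_def)
  have K: "loc_primitive l (\<lambda>x. complex_of_real (K x)) (\<lambda>x. complex_of_real (k x))"
    unfolding loc_primitive_def using kc by (auto simp: int_of) (simp add: K_def)
  have P: "loc_primitive l (\<lambda>x. complex_of_real (K x) ^ Suc n) (\<lambda>x. of_nat (Suc n) * (complex_of_real (k x) * complex_of_real (K x) ^ n))"
  proof (induction n)
    case 0 then show ?case using K by simp
  next
    case (Suc n)
    show ?case
      by (rule loc_primitive_cong[OF loc_primitive_mult[OF K Suc.IH] _ negligible_empty]) (auto simp: algebra_simps)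
  qed
  have "((\<lambda>t. inverse (of_nat (Suc n)) * (of_nat (Suc n) * (complex_of_real (k t) * complex_of_real (K t) ^ n))) has_integral
      inverse (of_nat (Suc n)) * (complex_of_real (K x) ^ Suc n - complex_of_real (K l) ^ Suc n)) {l..x}"
    by (intro has_integral_mult_right loc_primitive_has_integral[OF P] x order_refl)
  moreover have "inverse (of_nat (Suc n)) * (of_nat (Suc n) * (complex_of_real (k t) * complex_of_real (K t) ^ n))
      = complex_of_real (k t * K t ^ n)" for t
    by (simp add: mult.assoc[symmetric] del: of_nat_Suc)
  moreover have "inverse (of_nat (Suc n)) * (complex_of_real (K x) ^ Suc n - complex_of_real (K l) ^ Suc n)
      = complex_of_real (K x ^ Suc n / real (Suc n))"
  proof -
    have "K l = 0" by (simp add: K_def)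
    then show ?thesis by (simp add: divide_inverse mult.commute del: of_nat_Suc)
  qed
  ultimately have "((\<lambda>t. complex_of_real (k t * K t ^ n)) has_integral complex_of_real (K x ^ Suc n / real (Suc n))) {l..x}"
    by (simp only:)
  from has_integral_Re[OF this] show ?thesis
    unfolding Re_complex_of_real .
qed

text \<open>Inserting the hypothesis into itself \<open>n\<close> times bounds \<open>f\<close> by the first \<open>n\<close> terms of the series of \<open>C * exp K\<close>
  plus a remainder of size \<open>M * K ^ n / n!\<close>.\<close>

lemma gronwall:
  fixes f k :: "real \<Rightarrow> real"
  assumes k: "\<And>b. k absolutely_integrable_on {l..b}" "\<And>x. 0 \<le> k x"
    and f: "continuous_on {l..} f" "\<And>x. 0 \<le> f x"
    and le: "\<And>x. l \<le> x \<Longrightarrow> f x \<le> C + integral {l..x} (\<lambda>t. k t * f t)"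
    and C: "0 \<le> C" and x: "l \<le> x"
  shows "f x \<le> C * exp (integral {l..x} k)"
proof -
  define K where "K x = integral {l..x} k" for x
  have "bounded (f ` {l..x})" by (intro compact_imp_bounded compact_continuous_image continuous_on_subset[OF f(1)]) auto
  then obtain M where M: "M > 0" "\<And>t. t \<in> {l..x} \<Longrightarrow> f t \<le> M" unfolding bounded_pos using f(2) by auto
  have bd: "f y \<le> C * (\<Sum>j<n. K y ^ j / fact j) + M * (K y ^ n / fact n)" if "y \<in> {l..x}" for n y
    using that
  proof (induction n arbitrary: y)
    case 0 then show ?case using M by simp
  next
    case (Suc n)
    have I: "((\<lambda>t. C * (\<Sum>j<n. k t * K t ^ j / fact j) + M * (k t * K t ^ n / fact n)) has_integral
      (C * (\<Sum>j<n. K y ^ Suc j / real (Suc j) / fact j) + M * (K y ^ Suc n / real (Suc n) / fact n))) {l..y}"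
      using Suc.prems integral_power_primitive[OF k(1)] unfolding K_def
      by (intro has_integral_add has_integral_mult_right has_integral_sum has_integral_divide) auto
    have "f y \<le> C + integral {l..y} (\<lambda>t. k t * f t)" using le Suc.prems by auto
    also have "integral {l..y} (\<lambda>t. k t * f t) \<le> C * (\<Sum>j<n. K y ^ Suc j / real (Suc j) / fact j) + M * (K y ^ Suc n / real (Suc n) / fact n)"
    proof (rule has_integral_le[OF integrable_integral I])
      show "(\<lambda>t. k t * f t) integrable_on {l..y}"
        by (intro set_lebesgue_integral_eq_integral(1) absolutely_integrable_mult_continuous k continuous_on_subset[OF f(1)]) auto
      fix t assume "t \<in> {l..y}"
      then have "k t * f t \<le> k t * (C * (\<Sum>j<n. K t ^ j / fact j) + M * (K t ^ n / fact n))"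
        using Suc.prems k(2) by (intro mult_left_mono Suc.IH) auto
      then show "k t * f t \<le> C * (\<Sum>j<n. k t * K t ^ j / fact j) + M * (k t * K t ^ n / fact n)"
        by (simp add: algebra_simps sum_distrib_left)
    qed
    also have "C + (C * (\<Sum>j<n. K y ^ Suc j / real (Suc j) / fact j) + M * (K y ^ Suc n / real (Suc n) / fact n))
        = C * (\<Sum>j<Suc n. K y ^ j / fact j) + M * (K y ^ Suc n / fact (Suc n))"
      by (subst sum.lessThan_Suc_shift) (simp add: algebra_simps)
    finally show ?case by simp
  qed
  have "(\<lambda>n. C * (\<Sum>j<n. K x ^ j / fact j) + M * (K x ^ n / fact n)) \<longlonglongrightarrow> C * exp (K x) + M * 0"
  proof (intro tendsto_intros)
    show "(\<lambda>n. \<Sum>j<n. K x ^ j / fact j) \<longlonglongrightarrow> exp (K x)"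
      using exp_converges[of "K x"] by (simp add: sums_def divide_inverse mult.commute)
    show "(\<lambda>n. K x ^ n / fact n) \<longlonglongrightarrow> 0"
      using summable_LIMSEQ_zero[OF summable_exp[of "K x"]] by (simp add: divide_inverse mult.commute)
  qed
  moreover have "x \<in> {l..x}" using x by simp
  ultimately show ?thesis
    using bd[of x] LIMSEQ_le_const[of _ "C * exp (K x)" "f x"] by (auto simp: K_def)
qed

text \<open>Gronwall's inequality with constant \<open>0\<close>, applied to \<open>\<bar>y\<bar> + \<bar>y'\<bar>\<close>.\<close>

lemma schr_eq_zero_initial:
  assumes y: "schr_eq q l (\<lambda>x. z * y x) y y'" and q: "\<And>b. q absolutely_integrable_on {l..b}"
    and 0: "y l = 0" "y' l = 0" and x: "l \<le> x"
  shows "y x = 0" "y' x = 0"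
proof -
  define k where "k x = 1 + (\<bar>q x\<bar> + cmod z)" for x
  define f where "f x = cmod (y x) + cmod (y' x)" for x
  have y1: "loc_primitive l y y'" and y2: "loc_primitive l y' (\<lambda>x. complex_of_real (q x) * y x - z * y x)"
    using y by (auto simp: schr_eq_def)
  note cy = schr_eq_continuous[OF y]
  have k: "k absolutely_integrable_on {l..b}" for b
    using set_integrable_norm[OF q[of b]]
    unfolding k_def by (intro set_integral_add) (auto simp: lmeasurable_interval)
  have cf: "continuous_on {l..} f" unfolding f_def by (intro continuous_intros cy)
  have kf: "(\<lambda>t. k t * f t) integrable_on {l..x}" for x
    by (intro set_lebesgue_integral_eq_integral(1) absolutely_integrable_mult_continuous k continuous_on_subset[OF cf]) auto
  have "f x \<le> 0 * exp (integral {l..x} k)"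
  proof (rule gronwall[OF k _ cf])
    fix x assume x: "l \<le> x"
    have "cmod (y x) + cmod (y' x) = cmod (integral {l..x} y') + cmod (integral {l..x} (\<lambda>x. complex_of_real (q x) * y x - z * y x))"
      using loc_primitiveD[OF y1 x] loc_primitiveD[OF y2 x] 0 by simp
    also have "\<dots> \<le> integral {l..x} (\<lambda>x. cmod (y' x)) + integral {l..x} (\<lambda>x. cmod (complex_of_real (q x) * y x - z * y x))"
      using loc_primitiveD_int[OF y1 order_refl] loc_primitiveD_int[OF y2 order_refl]
      by (intro add_mono integral_norm_bound_integral) (auto simp: absolutely_integrable_on_def)
    also have "\<dots> = integral {l..x} (\<lambda>x. cmod (y' x) + cmod (complex_of_real (q x) * y x - z * y x))"
      using loc_primitiveD_int[OF y1 order_refl] loc_primitiveD_int[OF y2 order_refl]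
      by (intro Henstock_Kurzweil_Integration.integral_add[symmetric]) (auto simp: absolutely_integrable_on_def)
    also have "\<dots> \<le> integral {l..x} (\<lambda>t. k t * f t)"
    proof (rule integral_le[OF _ kf])
      show "(\<lambda>x. cmod (y' x) + cmod (complex_of_real (q x) * y x - z * y x)) integrable_on {l..x}"
        using loc_primitiveD_int[OF y1 order_refl] loc_primitiveD_int[OF y2 order_refl]
        by (intro integrable_add) (auto simp: absolutely_integrable_on_def)
      fix t
      have "cmod (complex_of_real (q t) * y t - z * y t) \<le> \<bar>q t\<bar> * cmod (y t) + cmod z * cmod (y t)"
        by (metis norm_mult norm_of_real norm_triangle_ineq4)
      moreover have "k t * f t = cmod (y' t) + (\<bar>q t\<bar> * cmod (y t) + cmod z * cmod (y t))
          + (cmod (y t) + (\<bar>q t\<bar> + cmod z) * cmod (y' t))"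
        by (simp add: k_def f_def algebra_simps)
      moreover have "0 \<le> cmod (y t) + (\<bar>q t\<bar> + cmod z) * cmod (y' t)" by simp
      ultimately show "cmod (y' t) + cmod (complex_of_real (q t) * y t - z * y t) \<le> k t * f t" by linarith
    qed
    finally show "f x \<le> 0 + integral {l..x} (\<lambda>t. k t * f t)" by (simp add: f_def)
  qed (use x in \<open>auto simp: k_def f_def\<close>)
  then have "f x \<le> 0" by simp
  then show "y x = 0" "y' x = 0" unfolding f_def
    by (metis add_nonneg_eq_0_iff antisym norm_ge_zero add_nonneg_nonneg norm_eq_zero)+
qed

text \<open>Picard iteration for the equation \<open>y = u\<^sub>0 + V y\<close>, where \<open>u\<^sub>0\<close> is the affine function with the given initial
  data and \<open>V u\<close> is the second primitive of \<open>p * u\<close>, \<open>p = q - z\<close>. On \<open>[l, B]\<close> the iterates \<open>V ^ n u\<^sub>0\<close> are bounded by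
  multiples of \<open>((B - l) * K) ^ n / n!\<close>, where \<open>K\<close> is the primitive of \<open>\<bar>p\<bar>\<close>, so that their sum converges locally
  uniformly.\<close>

lemma schr_eq_exists:
  fixes a b z :: complex
  assumes q: "\<And>b. q absolutely_integrable_on {l..b}"
  obtains y y' where "schr_eq q l (\<lambda>x. z * y x) y y'" "y l = a" "y' l = b" "\<And>x. x < l \<Longrightarrow> y x = 0"
proof -
  define p where "p x = complex_of_real (q x) - z" for x
  have p: "p absolutely_integrable_on {l..B}" for B
  proof -
    have "(\<lambda>x. complex_of_real (q x)) absolutely_integrable_on {l..B}"
      using absolutely_integrable_linear[OF q bounded_linear_of_real, of B] by (simp add: o_def)
    then show ?thesis unfolding p_def[abs_def] by (intro set_integral_diff) (auto simp: lmeasurable_interval)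
  qed
  define k where "k x = cmod (p x)" for x
  have k: "k absolutely_integrable_on {l..B}" for B
    unfolding k_def[abs_def] by (rule set_integrable_norm[OF p])
  define K where "K x = integral {l..x} k" for x
  have K0: "0 \<le> K x" for x unfolding K_def using k
    by (intro Henstock_Kurzweil_Integration.integral_nonneg set_lebesgue_integral_eq_integral(1)) (auto simp: k_def)
  have Kmono: "K s \<le> K t" if "s \<le> t" for s t
    unfolding K_def using k that
    by (intro integral_subset_le set_lebesgue_integral_eq_integral(1)) (auto simp: k_def)
  define G where "G u s = integral {l..s} (\<lambda>t. p t * u t)" for u :: fn and s
  define V where "V u x = integral {l..x} (G u)" for u :: fn and x
  have pu: "(\<lambda>t. p t * u t) absolutely_integrable_on {l..B}" if "continuous_on {l..} u" for u :: fn and B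
    by (intro absolutely_integrable_mult_continuous p continuous_on_subset[OF that]) auto
  have pui: "(\<lambda>t. p t * u t) integrable_on {l..B}" if "continuous_on {l..} u" for u :: fn and B
    using pu[OF that] by (rule set_lebesgue_integral_eq_integral(1))
  have GP: "loc_primitive l (\<lambda>s. c + G u s) (\<lambda>t. p t * u t)" if "continuous_on {l..} u" for u :: fn and c
    unfolding loc_primitive_def using pu[OF that] by (auto simp: G_def)
  have cG: "continuous_on {l..} (G u)" if "continuous_on {l..} u" for u
    using loc_primitive_continuous_on[OF GP[OF that, of 0]] by simp
  have Gint: "G u integrable_on {l..B}" if "continuous_on {l..} u" for u B
    by (intro integrable_continuous_real continuous_on_subset[OF cG[OF that]]) auto
  have cV: "continuous_on {l..} (V u)" if "continuous_on {l..} u" for u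
  proof -
    have "loc_primitive l (V u) (G u)"
      unfolding loc_primitive_def V_def
      by (auto intro!: absolutely_integrable_continuous_real continuous_on_subset[OF cG[OF that]])
    then show ?thesis by (rule loc_primitive_continuous_on)
  qed
  define u where "u n = (V ^^ n) (\<lambda>x. a + b * complex_of_real (x - l))" for n
  have u_Suc: "u (Suc n) = V (u n)" for n by (simp add: u_def)
  have cu: "continuous_on {l..} (u n)" for n
    by (induction n) (auto simp: u_def intro!: continuous_intros cV)
  have bd: "\<exists>M\<ge>0. \<forall>n. \<forall>x\<in>{l..B}. cmod (u n x) \<le> M * (((B - l) * K x) ^ n / fact n)" for B
  proof -
    have "bounded (u 0 ` {l..B})" by (intro compact_imp_bounded compact_continuous_image continuous_on_subset[OF cu]) auto
    then obtain M where M: "M > 0" "\<And>x. x \<in> {l..B} \<Longrightarrow> cmod (u 0 x) \<le> M" unfolding bounded_pos by auto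
    have "cmod (u n x) \<le> M * (((B - l) * K x) ^ n / fact n)" if "x \<in> {l..B}" for n x
      using that
    proof (induction n arbitrary: x)
      case 0 then show ?case using M by simp
    next
      case (Suc n)
      have Bl: "0 \<le> B - l" using Suc.prems by simp
      have Gb: "cmod (G (u n) s) \<le> M * (B - l) ^ n * (K s ^ Suc n / fact (Suc n))" if s: "s \<in> {l..x}" for s
      proof -
        have I: "((\<lambda>t. M * (B - l) ^ n / fact n * (k t * K t ^ n)) has_integral
             M * (B - l) ^ n / fact n * (K s ^ Suc n / real (Suc n))) {l..s}"
          using s integral_power_primitive[OF k] unfolding K_def by (intro has_integral_mult_right) auto
        have "cmod (G (u n) s) \<le> integral {l..s} (\<lambda>t. M * (B - l) ^ n / fact n * (k t * K t ^ n))"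
          unfolding G_def
        proof (rule integral_norm_bound_integral)
          show "(\<lambda>t. p t * u n t) integrable_on {l..s}"
            using pu[OF cu] by (rule set_lebesgue_integral_eq_integral(1))
          show "(\<lambda>t. M * (B - l) ^ n / fact n * (k t * K t ^ n)) integrable_on {l..s}" using I by blast
          fix t assume "t \<in> {l..s}"
          then have "cmod (u n t) \<le> M * (((B - l) * K t) ^ n / fact n)"
            using Suc s by auto
          then have "cmod (p t * u n t) \<le> k t * (M * (((B - l) * K t) ^ n / fact n))"
            unfolding norm_mult k_def by (rule mult_left_mono) simp
          also have "k t * (M * (((B - l) * K t) ^ n / fact n)) = M * (B - l) ^ n / fact n * (k t * K t ^ n)"
            by (simp add: power_mult_distrib)
          finally show "cmod (p t * u n t) \<le> M * (B - l) ^ n / fact n * (k t * K t ^ n)"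
            .
        qed
        also have "\<dots> = M * (B - l) ^ n / fact n * (K s ^ Suc n / real (Suc n))" using I by (rule integral_unique)
        also have "\<dots> = M * (B - l) ^ n * (K s ^ Suc n / fact (Suc n))" by (simp add: algebra_simps)
        finally show ?thesis .
      qed
      have "cmod (u (Suc n) x) \<le> integral {l..x} (\<lambda>s. M * (B - l) ^ n * (K x ^ Suc n / fact (Suc n)))"
        unfolding u_Suc V_def
      proof (rule integral_norm_bound_integral[OF Gint[OF cu]])
        fix s assume s: "s \<in> {l..x}"
        have "M * (B - l) ^ n * (K s ^ Suc n / fact (Suc n)) \<le> M * (B - l) ^ n * (K x ^ Suc n / fact (Suc n))"
          using s M Bl K0 by (intro mult_left_mono divide_right_mono power_mono Kmono) auto
        with Gb[OF s] show "cmod (G (u n) s) \<le> M * (B - l) ^ n * (K x ^ Suc n / fact (Suc n))" by simp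
      qed auto
      also have "\<dots> = (x - l) * (M * (B - l) ^ n * (K x ^ Suc n / fact (Suc n)))" using Suc.prems by simp
      also have "\<dots> \<le> (B - l) * (M * (B - l) ^ n * (K x ^ Suc n / fact (Suc n)))"
        using Suc.prems M Bl K0 by (intro mult_right_mono) auto
      also have "\<dots> = M * (((B - l) * K x) ^ Suc n / fact (Suc n))" by (simp add: power_mult_distrib)
      finally show ?case .
    qed
    with M(1) show ?thesis by (intro exI[of _ M]) auto
  qed
  define S where "S n x = (\<Sum>i<n. u i x)" for n x
  define y where "y x = (\<Sum>i. u i x)" for x
  have ul: "uniform_limit {l..B} S y sequentially" for B
  proof -
    obtain M where M: "M \<ge> 0" "\<And>n x. x \<in> {l..B} \<Longrightarrow> cmod (u n x) \<le> M * (((B - l) * K x) ^ n / fact n)"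
      using bd[of B] by blast
    have sm: "summable (\<lambda>n. M * (((B - l) * K B) ^ n / fact n))"
      using summable_exp[of "(B - l) * K B"] by (intro summable_mult) (simp add: divide_inverse mult.commute)
    have "cmod (u n x) \<le> M * (((B - l) * K B) ^ n / fact n)" if "x \<in> {l..B}" for n x
    proof -
      have "M * (((B - l) * K x) ^ n / fact n) \<le> M * (((B - l) * K B) ^ n / fact n)"
        using that K0 M(1) by (intro mult_left_mono divide_right_mono power_mono Kmono mult_nonneg_nonneg) auto
      with M(2)[OF that, of n] show ?thesis by simp
    qed
    then have "uniform_limit {l..B} (\<lambda>n x. \<Sum>i<n. u i x) (\<lambda>x. suminf (\<lambda>i. u i x)) sequentially"
      by (rule Weierstrass_m_test[OF _ sm])
    then show ?thesis by (simp add: S_def[abs_def] y_def[abs_def])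
  qed
  have cS: "continuous_on {l..} (S n)" for n unfolding S_def by (intro continuous_intros cu)
  have cy: "continuous_on {l..} y"
  proof (rule continuous_on_halfline)
    show "continuous_on {l..B} y" for B
      by (rule uniform_limit_theorem[OF _ ul]) (auto intro!: always_eventually continuous_on_subset[OF cS])
  qed
  have Gdiff: "cmod (G w s - G v s) \<le> e * K s"
    if w: "continuous_on {l..} w" and v: "continuous_on {l..} v" and e: "\<And>t. t \<in> {l..s} \<Longrightarrow> cmod (w t - v t) \<le> e" for w v s e
  proof -
    have "G w s - G v s = integral {l..s} (\<lambda>t. p t * w t - p t * v t)"
      unfolding G_def
      by (intro Henstock_Kurzweil_Integration.integral_diff[symmetric] pui w v)
    also have "cmod \<dots> \<le> integral {l..s} (\<lambda>t. e * k t)"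
    proof (rule integral_norm_bound_integral)
      show "(\<lambda>t. p t * w t - p t * v t) integrable_on {l..s}"
        by (intro integrable_diff pui w v)
      show "(\<lambda>t. e * k t) integrable_on {l..s}"
        using k set_lebesgue_integral_eq_integral(1) by (intro integrable_on_mult_right) blast
      fix t assume "t \<in> {l..s}"
      then have "cmod (p t) * cmod (w t - v t) \<le> cmod (p t) * e" by (intro mult_left_mono e) auto
      then show "cmod (p t * w t - p t * v t) \<le> e * k t"
        by (simp add: k_def mult.commute flip: right_diff_distrib norm_mult)
    qed
    also have "\<dots> = e * K s" by (simp add: K_def)
    finally show ?thesis .
  qed
  have Vlim: "(\<lambda>n. V (S n) x) \<longlonglongrightarrow> V y x" if x: "x \<ge> l" for x
  proof (rule LIMSEQ_I)
    fix r :: real assume r: "r > 0"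
    define c where "c = (x - l) * K x + 1"
    define e where "e = r / (2 * c)"
    have pos: "c > 0" unfolding c_def using x K0 by (simp add: add_nonneg_pos)
    have e: "e > 0" "(x - l) * K x * e < r"
    proof -
      show "e > 0" using r pos by (simp add: e_def)
      have "c * e = r / 2" using pos by (simp add: e_def)
      then show "(x - l) * K x * e < r" using \<open>e > 0\<close> r unfolding c_def distrib_right by linarith
    qed
    from ul[of x] e(1) obtain N where N: "\<And>n t. n \<ge> N \<Longrightarrow> t \<in> {l..x} \<Longrightarrow> dist (S n t) (y t) < e"
      unfolding uniform_limit_sequentially_iff by meson
    show "\<exists>N. \<forall>n\<ge>N. norm (V (S n) x - V y x) < r"
    proof (intro exI[of _ N] allI impI)
      fix n assume n: "n \<ge> N"
      have "V (S n) x - V y x = integral {l..x} (\<lambda>s. G (S n) s - G y s)"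
        unfolding V_def using Gint cS cy by (intro Henstock_Kurzweil_Integration.integral_diff[symmetric]) auto
      also have "norm \<dots> \<le> integral {l..x} (\<lambda>s. e * K x)"
      proof (rule integral_norm_bound_integral)
        show "(\<lambda>s. G (S n) s - G y s) integrable_on {l..x}" using Gint cS cy by (intro integrable_diff) auto
        fix s assume s: "s \<in> {l..x}"
        have "cmod (G (S n) s - G y s) \<le> e * K s"
          using N[OF n] s by (intro Gdiff cS cy) (auto simp: dist_norm intro: less_imp_le)
        also have "\<dots> \<le> e * K x" using s e by (intro mult_left_mono Kmono) auto
        finally show "cmod (G (S n) s - G y s) \<le> e * K x" .
      qed auto
      also have "\<dots> = (x - l) * K x * e" using x by simp
      finally show "norm (V (S n) x - V y x) < r" using e by simp
    qed
  qed
  have Vadd: "V (\<lambda>x. w x + v x) = (\<lambda>x. V w x + V v x)" if w: "continuous_on {l..} w" and v: "continuous_on {l..} v" for w v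
  proof -
    have "G (\<lambda>x. w x + v x) = (\<lambda>s. G w s + G v s)"
      unfolding G_def using pu[OF w] pu[OF v]
      by (auto simp: distrib_left intro!: Henstock_Kurzweil_Integration.integral_add set_lebesgue_integral_eq_integral(1))
    then show ?thesis unfolding V_def using Gint w v
      by (auto intro!: Henstock_Kurzweil_Integration.integral_add)
  qed
  have SS: "S (Suc n) x = u 0 x + V (S n) x" for n x
  proof (induction n)
    case 0
    have "S 0 = (\<lambda>_. 0)" by (auto simp: S_def)
    moreover have "G (\<lambda>_. 0) = (\<lambda>_. 0)" by (rule ext) (simp add: G_def)
    ultimately have "V (S 0) x = 0" by (simp add: V_def)
    moreover have "S (Suc 0) x = u 0 x" by (simp add: S_def)
    ultimately show ?case by simp
  next
    case (Suc n)
    have "S (Suc n) = (\<lambda>x. S n x + u n x)" by (rule ext) (simp add: S_def)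
    then have "V (S (Suc n)) x = V (S n) x + u (Suc n) x" using cS cu by (simp add: Vadd u_Suc)
    moreover have "S (Suc (Suc n)) x = S (Suc n) x + u (Suc n) x" by (simp add: S_def)
    ultimately show ?case using Suc by simp
  qed
  have y_eq: "y x = u 0 x + V y x" if x: "x \<ge> l" for x
  proof -
    have "(\<lambda>n. S (Suc n) x) \<longlonglongrightarrow> u 0 x + V y x" unfolding SS by (intro tendsto_intros Vlim x)
    moreover have "(\<lambda>n. S n x) \<longlonglongrightarrow> y x" using tendsto_uniform_limitI[OF ul[of x], of x] x by simp
    ultimately show ?thesis using LIMSEQ_unique LIMSEQ_Suc by blast
  qed
  define y' where "y' x = b + G y x" for x
  have V_l: "V y l = 0" and G_l: "G y l = 0" by (auto simp: V_def G_def)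
  have yl: "y l = a" using y_eq[of l] V_l by (simp add: u_def)
  have P2: "loc_primitive l y' (\<lambda>x. p x * y x)" using GP[OF cy, of b] by (simp add: y'_def[abs_def])
  have P1: "loc_primitive l y y'"
    unfolding loc_primitive_def
  proof (intro conjI allI impI)
    have cy': "continuous_on {l..} y'" by (rule loc_primitive_continuous_on[OF P2])
    show "y' absolutely_integrable_on {l..B}" for B
      by (intro absolutely_integrable_continuous_real continuous_on_subset[OF cy']) auto
    fix x assume x: "l \<le> x"
    have "integral {l..x} y' = integral {l..x} (\<lambda>_. b) + integral {l..x} (G y)"
      unfolding y'_def using Gint[OF cy] by (intro Henstock_Kurzweil_Integration.integral_add) auto
    then show "y x = y l + integral {l..x} y'"
      using y_eq[OF x] x yl by (simp add: V_def u_def scaleR_conv_of_real)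
  qed
  have se: "schr_eq q l (\<lambda>x. z * y x) y y'"
    unfolding schr_eq_def using P1 P2 by (simp add: p_def algebra_simps)
  \<comment> \<open>The definition of \<open>\<H>\<^sub>+\<close> requires functions that vanish left of \<open>l\<close>.\<close>
  define y0 where "y0 x = (if x < l then 0 else y x)" for x
  show ?thesis
  proof (rule that[of y0 y'])
    show "schr_eq q l (\<lambda>x. z * y0 x) y0 y'"
      by (rule schr_eq_cong[OF se]) (auto simp: y0_def)
  qed (auto simp: y0_def yl y'_def G_l)
qed

section \<open>Square integrable functions\<close>

lemma lebesgue_on_AE_cong_measurable:
  fixes f g :: fn
  assumes f: "f \<in> borel_measurable (lebesgue_on {l..})" and ae: "AE x in lebesgue_on {l..}. f x = g x"
  shows "g \<in> borel_measurable (lebesgue_on {l..})"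
proof -
  have "(\<lambda>x. indicator {l..} x *\<^sub>R f x) \<in> borel_measurable lebesgue"
    using f by (simp add: borel_measurable_restrict_space_iff)
  moreover have "AE x in lebesgue. indicator {l..} x *\<^sub>R f x = indicator {l..} x *\<^sub>R g x"
  proof -
    have "AE x in lebesgue. x \<in> {l..} \<longrightarrow> f x = g x"
      using ae by (subst (asm) AE_restrict_space_iff) auto
    then show ?thesis by (rule AE_mp) (auto simp: indicator_def intro!: AE_I2)
  qed
  ultimately have "(\<lambda>x. indicator {l..} x *\<^sub>R g x) \<in> borel_measurable lebesgue"
    by (rule borel_measurable_AE)
  then show ?thesis by (simp add: borel_measurable_restrict_space_iff)
qed

lemma L2_bound:
  assumes "g \<in> borel_measurable (lebesgue_on {l..})" "integrable (lebesgue_on {l..}) h"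
    "\<And>x. x \<ge> l \<Longrightarrow> (cmod (g x))\<^sup>2 \<le> h x"
  shows "g \<in> L2 l"
  unfolding L2_def
proof (intro CollectI conjI)
  show "integrable (lebesgue_on {l..}) (\<lambda>x. (cmod (g x))\<^sup>2)"
  proof (rule Bochner_Integration.integrable_bound[OF assms(2)])
    show "(\<lambda>x. (cmod (g x))\<^sup>2) \<in> borel_measurable (lebesgue_on {l..})" using assms(1) by measurable
    show "AE x in lebesgue_on {l..}. norm ((cmod (g x))\<^sup>2) \<le> norm (h x)"
      by (intro AE_I2) (use order_trans[OF assms(3) abs_ge_self] in simp)
  qed
qed fact

lemma L2D:
  assumes "f \<in> L2 l"
  shows "f \<in> borel_measurable (lebesgue_on {l..})" "integrable (lebesgue_on {l..}) (\<lambda>x. (cmod (f x))\<^sup>2)"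
  using assms by (auto simp: L2_def)

lemma L2_AE_cong:
  assumes "f \<in> L2 l" "AE x in lebesgue_on {l..}. f x = g x"
  shows "g \<in> L2 l"
proof -
  have m: "g \<in> borel_measurable (lebesgue_on {l..})"
    using lebesgue_on_AE_cong_measurable[OF L2D(1)[OF assms(1)] assms(2)] .
  have "integrable (lebesgue_on {l..}) (\<lambda>x. (cmod (g x))\<^sup>2)"
    using L2D(1)[OF assms(1)] m assms(2)
    by (intro integrable_cong_AE_imp[OF L2D(2)[OF assms(1)]]) auto
  with m show ?thesis by (simp add: L2_def)
qed

lemma L2_integrable_mult:
  assumes f: "f \<in> L2 l" and g: "g \<in> L2 l"
  shows "integrable (lebesgue_on {l..}) (\<lambda>x. f x * g x)"
proof (rule Bochner_Integration.integrable_bound)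
  show "integrable (lebesgue_on {l..}) (\<lambda>x. (cmod (f x))\<^sup>2 + (cmod (g x))\<^sup>2)"
    by (intro Bochner_Integration.integrable_add L2D f g)
  show "(\<lambda>x. f x * g x) \<in> borel_measurable (lebesgue_on {l..})"
    using L2D(1)[OF f] L2D(1)[OF g] by measurable
  have "cmod (f x * g x) \<le> (cmod (f x))\<^sup>2 + (cmod (g x))\<^sup>2" for x
    using sum_squares_bound[of "cmod (f x)" "cmod (g x)"] mult_nonneg_nonneg[OF norm_ge_zero norm_ge_zero, of "f x" "g x"]
    unfolding norm_mult by linarith
  then show "AE x in lebesgue_on {l..}. norm (f x * g x) \<le> norm ((cmod (f x))\<^sup>2 + (cmod (g x))\<^sup>2)"
    by (intro AE_I2) simp
qed

lemma L2_cnj: "f \<in> L2 l \<Longrightarrow> (\<lambda>x. cnj (f x)) \<in> L2 l"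
  unfolding L2_def using measurable_compose[OF _ borel_measurable_continuous_onI[OF continuous_on_cnj[OF continuous_on_id]], of f]
  by auto

lemma L2_integrable_mult_cnj:
  "f \<in> L2 l \<Longrightarrow> g \<in> L2 l \<Longrightarrow> integrable (lebesgue_on {l..}) (\<lambda>x. f x * cnj (g x))"
  by (intro L2_integrable_mult L2_cnj)

lemma L2_cmult: "f \<in> L2 l \<Longrightarrow> (\<lambda>x. c * f x) \<in> L2 l"
  unfolding L2_def by (auto simp: norm_mult power_mult_distrib)

lemma L2_add:
  assumes f: "f \<in> L2 l" and g: "g \<in> L2 l"
  shows "(\<lambda>x. f x + g x) \<in> L2 l"
proof (rule L2_bound)
  show "integrable (lebesgue_on {l..}) (\<lambda>x. 2 * (cmod (f x))\<^sup>2 + 2 * (cmod (g x))\<^sup>2)"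
    by (intro Bochner_Integration.integrable_add integrable_mult_right L2D f g)
  show "(\<lambda>x. f x + g x) \<in> borel_measurable (lebesgue_on {l..})"
    using L2D(1)[OF f] L2D(1)[OF g] by measurable
  have "(cmod (f x + g x))\<^sup>2 \<le> (cmod (f x) + cmod (g x))\<^sup>2" for x
    by (intro power_mono norm_triangle_ineq) auto
  also have "(cmod (f x) + cmod (g x))\<^sup>2 \<le> 2 * (cmod (f x))\<^sup>2 + 2 * (cmod (g x))\<^sup>2" for x
    using sum_squares_bound[of "cmod (f x)" "cmod (g x)"] by (simp add: power2_sum)
  finally show "(cmod (f x + g x))\<^sup>2 \<le> 2 * (cmod (f x))\<^sup>2 + 2 * (cmod (g x))\<^sup>2" for x .
qed

lemma L2_mult_bounded:
  assumes f: "f \<in> L2 l" and h: "continuous_on {l..} h" and B: "\<And>x. x \<ge> l \<Longrightarrow> cmod (h x) \<le> B"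
  shows "(\<lambda>x. h x * f x) \<in> L2 l"
proof (rule L2_bound)
  show "integrable (lebesgue_on {l..}) (\<lambda>x. B\<^sup>2 * (cmod (f x))\<^sup>2)"
    by (intro integrable_mult_right L2D f)
  have "h \<in> borel_measurable (lebesgue_on {l..})"
    by (rule continuous_imp_measurable_on_sets_lebesgue[OF h]) auto
  then show "(\<lambda>x. h x * f x) \<in> borel_measurable (lebesgue_on {l..})"
    using L2D(1)[OF f] by measurable
  show "(cmod (h x * f x))\<^sup>2 \<le> B\<^sup>2 * (cmod (f x))\<^sup>2" if "x \<ge> l" for x
    unfolding norm_mult power_mult_distrib using B[OF that] by (intro mult_right_mono power_mono) auto
qed

lemma integral_halfline_truncation:
  fixes h :: "real \<Rightarrow> 'b::euclidean_space"
  assumes "h absolutely_integrable_on {l..d}"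
  shows "integrable (lebesgue_on {l..}) (\<lambda>x. indicat_real {l..d} x *\<^sub>R h x)"
    "integral\<^sup>L (lebesgue_on {l..}) (\<lambda>x. indicat_real {l..d} x *\<^sub>R h x) = integral {l..d} h"
proof -
  have eq: "(\<lambda>x. indicat_real {l..} x *\<^sub>R (indicat_real {l..d} x *\<^sub>R h x)) = (\<lambda>x. indicat_real {l..d} x *\<^sub>R h x)"
    by (auto simp: indicator_def)
  show "integrable (lebesgue_on {l..}) (\<lambda>x. indicat_real {l..d} x *\<^sub>R h x)"
    using assms by (subst integrable_restrict_space) (simp_all only: eq set_integrable_def, simp_all)
  show "integral\<^sup>L (lebesgue_on {l..}) (\<lambda>x. indicat_real {l..d} x *\<^sub>R h x) = integral {l..d} h"
    using set_lebesgue_integral_eq_integral(2)[OF assms]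
    by (subst integral_restrict_space) (simp_all only: eq set_lebesgue_integral_def, simp_all)
qed

lemma integrable_indicator_halfline:
  fixes l c :: real
  shows "integrable (lebesgue_on {l..}) (indicat_real {l..c})"
  using integral_halfline_truncation(1)[where h = "\<lambda>_. 1 :: real" and l = l and d = c] by simp

lemma L2_compact_support:
  assumes h: "continuous_on {l..} h" and 0: "\<And>x. x > c \<Longrightarrow> h x = 0"
  shows "h \<in> L2 l"
proof -
  have "bounded (h ` {l..c})" by (intro compact_imp_bounded compact_continuous_image continuous_on_subset[OF h]) auto
  then obtain B where B: "\<And>x. x \<in> {l..c} \<Longrightarrow> cmod (h x) \<le> B" unfolding bounded_iff by (meson imageI)
  show ?thesis
  proof (rule L2_bound)
    show "h \<in> borel_measurable (lebesgue_on {l..})"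
      by (rule continuous_imp_measurable_on_sets_lebesgue[OF h]) auto
    show "integrable (lebesgue_on {l..}) (\<lambda>x. B\<^sup>2 * indicat_real {l..c} x)"
      by (intro integrable_mult_right integrable_indicator_halfline)
    show "(cmod (h x))\<^sup>2 \<le> B\<^sup>2 * indicat_real {l..c} x" if "x \<ge> l" for x
      using B[of x] 0[of x] that by (cases "x \<le> c") (auto intro: power_mono)
  qed
qed

lemma integrable_halfline_loc:
  fixes h :: "real \<Rightarrow> 'b::euclidean_space"
  assumes "integrable (lebesgue_on {l..}) h" "l \<le> a"
  shows "h absolutely_integrable_on {a..b}"
proof -
  have "h absolutely_integrable_on {l..}"
    using assms(1) by (simp add: set_integrable_def integrable_restrict_space)
  then show ?thesis
    by (rule absolutely_integrable_on_subinterval) (use assms(2) in auto)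
qed

lemma L2_loc_integrable:
  assumes f: "f \<in> L2 l" shows "f absolutely_integrable_on {l..b}"
proof -
  define ind where "ind x = indicat_real {l..b} x *\<^sub>R f x" for x
  have "integrable (lebesgue_on {l..}) ind"
  proof (rule Bochner_Integration.integrable_bound)
    show "integrable (lebesgue_on {l..}) (\<lambda>x. indicat_real {l..b} x + (cmod (f x))\<^sup>2)"
      by (intro Bochner_Integration.integrable_add L2D f integrable_indicator_halfline)
    show "ind \<in> borel_measurable (lebesgue_on {l..})"
      unfolding ind_def
      by (intro borel_measurable_scaleR L2D f borel_measurable_integrable integrable_indicator_halfline)
    show "AE x in lebesgue_on {l..}. norm (ind x) \<le> norm (indicat_real {l..b} x + (cmod (f x))\<^sup>2)"
    proof (rule AE_I2)
      fix x assume "x \<in> space (lebesgue_on {l..})"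
      then have "x \<ge> l" by simp
      moreover have "cmod (f x) \<le> 1 + (cmod (f x))\<^sup>2"
        using sum_squares_bound[of "cmod (f x)" 1] norm_ge_zero[of "f x"] by (simp del: norm_ge_zero)
      ultimately show "norm (ind x) \<le> norm (indicat_real {l..b} x + (cmod (f x))\<^sup>2)"
        by (cases "x \<le> b") (simp_all add: ind_def)
    qed
  qed
  then have "ind absolutely_integrable_on {l..b}" by (rule integrable_halfline_loc) simp
  then show ?thesis
    by (rule absolutely_integrable_spike[where S="{}"]) (auto simp: ind_def)
qed

lemma integral_halfline_limit:
  fixes h :: "real \<Rightarrow> 'b::euclidean_space"
  assumes h: "integrable (lebesgue_on {l..}) h"
  shows "((\<lambda>x. integral {l..x} h) \<longlongrightarrow> integral\<^sup>L (lebesgue_on {l..}) h) at_top"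
proof -
  note trunc = integral_halfline_truncation[OF integrable_halfline_loc[OF h order_refl]]
  have "((\<lambda>t. integral\<^sup>L (lebesgue_on {l..}) (\<lambda>x. indicat_real {l..t} x *\<^sub>R h x)) \<longlongrightarrow> integral\<^sup>L (lebesgue_on {l..}) h) at_top"
  proof (rule integral_dominated_convergence_at_top)
    show "integrable (lebesgue_on {l..}) (\<lambda>x. norm (h x))" using h by simp
    show "AE x in lebesgue_on {l..}. ((\<lambda>t. indicat_real {l..t} x *\<^sub>R h x) \<longlongrightarrow> h x) at_top"
    proof (rule AE_I2)
      fix x assume "x \<in> space (lebesgue_on {l..})"
      then have "\<forall>\<^sub>F t in at_top. indicat_real {l..t} x *\<^sub>R h x = h x"
        by (intro eventually_at_top_linorderI[of x]) auto
      then show "((\<lambda>t. indicat_real {l..t} x *\<^sub>R h x) \<longlongrightarrow> h x) at_top" by (rule tendsto_eventually)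
    qed
    show "\<forall>\<^sub>F t in at_top. AE x in lebesgue_on {l..}. norm (indicat_real {l..t} x *\<^sub>R h x) \<le> norm (h x)"
      by (intro always_eventually allI AE_I2) (auto simp: indicator_def)
  qed (use h borel_measurable_integrable[OF trunc(1)] in auto)
  then show ?thesis by (simp only: trunc(2))
qed

lemma ip_add_left: "f \<in> L2 l \<Longrightarrow> g \<in> L2 l \<Longrightarrow> h \<in> L2 l \<Longrightarrow> ip l (\<lambda>x. f x + g x) h = ip l f h + ip l g h"
  unfolding ip_def by (simp add: distrib_right L2_integrable_mult_cnj)

lemma ip_cmult_left: "ip l (\<lambda>x. c * f x) h = c * ip l f h"
  unfolding ip_def by (simp add: mult.assoc)

lemma ip_cnj: "cnj (ip l f g) = ip l g f"
  unfolding ip_def by (subst Bochner_Integration.integral_cnj[symmetric]) (simp add: mult.commute)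

lemma ip_add_right: "f \<in> L2 l \<Longrightarrow> g \<in> L2 l \<Longrightarrow> h \<in> L2 l \<Longrightarrow> ip l h (\<lambda>x. f x + g x) = ip l h f + ip l h g"
  using ip_add_left[of f l g h, THEN arg_cong[of _ _ cnj]] by (simp add: ip_cnj)

lemma ip_cmult_right: "ip l h (\<lambda>x. c * f x) = cnj c * ip l h f"
  by (metis complex_cnj_mult ip_cmult_left ip_cnj)

lemma ip_self_nonneg: "0 \<le> Re (ip l f f)"
proof -
  have "ip l f f = integral\<^sup>L (lebesgue_on {l..}) (\<lambda>x. complex_of_real ((cmod (f x))\<^sup>2))"
    unfolding ip_def by (simp only: complex_norm_square[symmetric])
  also have "\<dots> = complex_of_real (integral\<^sup>L (lebesgue_on {l..}) (\<lambda>x. (cmod (f x))\<^sup>2))"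
    by (rule integral_complex_of_real)
  finally show ?thesis by (simp add: Bochner_Integration.integral_nonneg)
qed

lemma ip_AE_cong:
  assumes "AE x in lebesgue_on {l..}. f x = f' x" "f \<in> L2 l" "g \<in> L2 l"
  shows "ip l f g = ip l f' g"
proof -
  have "f' \<in> L2 l" using L2_AE_cong assms by blast
  then show ?thesis unfolding ip_def
    using assms L2_integrable_mult_cnj[of f l g] L2_integrable_mult_cnj[of f' l g]
    by (intro integral_cong_AE) auto
qed

section \<open>The maximal domain\<close>

text \<open>Elements of \<open>\<H>\<^sub>+\<close> together with their derivative and their image \<open>f\<close>. In contrast to \<^const>\<open>Hplus\<close>, neither the
  values left of \<open>l\<close> nor the representative of \<open>f\<close> are prescribed, which makes sums, multiples and conjugates
  immediate.\<close>

definition max_elem :: "(real \<Rightarrow> real) \<Rightarrow> real \<Rightarrow> fn \<Rightarrow> fn \<Rightarrow> fn \<Rightarrow> bool" where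
  "max_elem q l f y y' \<longleftrightarrow> schr_eq q l f y y' \<and> y \<in> L2 l \<and> f \<in> L2 l"

lemma Hplus_imp_max_elem:
  assumes "y \<in> Hplus q l" and q: "\<And>b. q absolutely_integrable_on {l..b}"
  shows "max_elem q l (schr q l y) y (hderiv l y)"
  using assms unfolding Hplus_def max_elem_def
  by (auto intro!: loc_abs_cont2_imp_schr_eq L2_loc_integrable)

lemma max_elem_imp_Hplus:
  assumes y: "max_elem q l f y y'" and 0: "\<And>x. x < l \<Longrightarrow> y x = 0"
  shows "y \<in> Hplus q l" "\<And>x. x \<ge> l \<Longrightarrow> hderiv l y x = y' x" "AE x in lebesgue_on {l..}. f x = schr q l y x"
proof -
  have se: "schr_eq q l f y y'" using y by (simp add: max_elem_def)
  note * = schr_eq_imp_loc_abs_cont2[OF se]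
  have "AE x in lebesgue_on {l..}. schr q l y x = f x" by (rule *(3)) (rule 0)
  then show "AE x in lebesgue_on {l..}. f x = schr q l y x" by eventually_elim simp
  then show "y \<in> Hplus q l"
    using y *(1)[OF 0] by (auto simp: Hplus_def max_elem_def intro: L2_AE_cong)
qed (use schr_eq_imp_loc_abs_cont2 y 0 in \<open>auto simp: max_elem_def\<close>)

lemma max_elem_add:
  "max_elem q l f y y' \<Longrightarrow> max_elem q l g u u' \<Longrightarrow> max_elem q l (\<lambda>x. f x + g x) (\<lambda>x. y x + u x) (\<lambda>x. y' x + u' x)"
  unfolding max_elem_def by (auto intro: schr_eq_add L2_add)

lemma max_elem_cmult:
  "max_elem q l f y y' \<Longrightarrow> max_elem q l (\<lambda>x. c * f x) (\<lambda>x. c * y x) (\<lambda>x. c * y' x)"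
  unfolding max_elem_def by (auto intro: schr_eq_cmult L2_cmult)

lemma max_elem_cnj:
  "max_elem q l f y y' \<Longrightarrow> max_elem q l (\<lambda>x. cnj (f x)) (\<lambda>x. cnj (y x)) (\<lambda>x. cnj (y' x))"
  unfolding max_elem_def by (auto intro: schr_eq_cnj L2_cnj)

section \<open>The limit point case and Green's formula\<close>

lemma wronskian_limit:
  assumes y: "max_elem q l f y y'" and w: "max_elem q l g w w'"
  shows "((\<lambda>x. y x * w' x - y' x * w x) \<longlongrightarrow>
     y l * w' l - y' l * w l + integral\<^sup>L (lebesgue_on {l..}) (\<lambda>x. f x * w x - y x * g x)) at_top"
proof -
  have P: "loc_primitive l (\<lambda>x. y x * w' x - y' x * w x) (\<lambda>x. f x * w x - y x * g x)"
    using y w by (auto simp: max_elem_def intro: wronskian_primitive)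
  have "integrable (lebesgue_on {l..}) (\<lambda>x. f x * w x - y x * g x)"
    using y w by (auto simp: max_elem_def intro!: L2_integrable_mult)
  then have "((\<lambda>x. y l * w' l - y' l * w l + integral {l..x} (\<lambda>x. f x * w x - y x * g x)) \<longlongrightarrow>
     y l * w' l - y' l * w l + integral\<^sup>L (lebesgue_on {l..}) (\<lambda>x. f x * w x - y x * g x)) at_top"
    by (intro tendsto_intros integral_halfline_limit)
  then show ?thesis
  proof (rule Lim_transform_eventually)
    show "\<forall>\<^sub>F x in at_top. y l * w' l - y' l * w l + integral {l..x} (\<lambda>x. f x * w x - y x * g x) = y x * w' x - y' x * w x"
      by (intro eventually_at_top_linorderI[of l]) (rule loc_primitiveD[OF P, symmetric])
  qed
qed

text \<open>If the Wronskian of \<open>y\<close> and \<open>w\<close> stays away from \<open>0\<close> near infinity, then \<open>y\<close> and \<open>w\<close> act there like a fundamental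
  system: \<open>u\<close> is a combination of them whose coefficients are, up to a bounded factor, the Wronskians \<open>A\<close> and \<open>B\<close> of
  \<open>u\<close> with \<open>w\<close> and \<open>y\<close>. The derivatives of \<open>A\<close> and \<open>B\<close> are products of \<open>u\<close> with square integrable functions, so
  \<open>\<bar>A\<bar> + \<bar>B\<bar>\<close> obeys a Gronwall inequality whose kernel is integrable up to infinity. Hence \<open>A\<close> and \<open>B\<close> are bounded and
  \<open>u\<close> is dominated by \<open>\<bar>y\<bar> + \<bar>w\<bar>\<close>.\<close>

lemma solution_in_L2_if_wronskian_limit_nonzero:
  assumes y: "max_elem q l f y y'" and w: "max_elem q l g w w'"
    and lim: "((\<lambda>x. y x * w' x - y' x * w x) \<longlongrightarrow> W) at_top" and W: "W \<noteq> 0"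
    and u: "schr_eq q l (\<lambda>x. z * u x) u u'"
  shows "u \<in> L2 l"
proof -
  have sy: "schr_eq q l f y y'" and sw: "schr_eq q l g w w'"
    and L: "y \<in> L2 l" "f \<in> L2 l" "w \<in> L2 l" "g \<in> L2 l"
    using y w by (auto simp: max_elem_def)
  define m where "m = cmod W / 2"
  have m: "m > 0" "m < cmod W" using W by (auto simp: m_def)
  have "\<forall>\<^sub>F x in at_top. m < cmod (y x * w' x - y' x * w x)"
    using order_tendstoD(1)[OF tendsto_norm[OF lim] m(2)] .
  then obtain c0 where c0: "\<And>x. x \<ge> c0 \<Longrightarrow> m < cmod (y x * w' x - y' x * w x)"
    unfolding eventually_at_top_linorder by blast
  define c where "c = max c0 l"
  have c: "l \<le> c" "\<And>x. x \<ge> c \<Longrightarrow> m < cmod (y x * w' x - y' x * w x)" using c0 by (auto simp: c_def)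
  define A where "A x = u x * w' x - u' x * w x" for x
  define B where "B x = u x * y' x - u' x * y x" for x
  define N where "N x = cmod (A x) + cmod (B x)" for x
  define k where "k x = (cmod (y x) + cmod (w x)) / m * (cmod (z * w x - g x) + cmod (z * y x - f x))" for x
  have AP: "loc_primitive l A (\<lambda>x. z * u x * w x - u x * g x)"
    unfolding A_def by (rule wronskian_primitive[OF u sw])
  have BP: "loc_primitive l B (\<lambda>x. z * u x * y x - u x * f x)"
    unfolding B_def by (rule wronskian_primitive[OF u sy])
  have kint: "integrable (lebesgue_on {l..}) k"
  proof -
    have cm: "(\<lambda>x. complex_of_real (cmod (h x))) \<in> L2 l" if "h \<in> L2 l" for h
      using that unfolding L2_def by auto
    have d: "(\<lambda>x. z * h x - e x) \<in> L2 l" if "h \<in> L2 l" "e \<in> L2 l" for h e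
      using L2_add[OF L2_cmult[OF that(1), of z] L2_cmult[OF that(2), of "-1"]] by simp
    have "integrable (lebesgue_on {l..}) (\<lambda>x. (complex_of_real (1/m) * (complex_of_real (cmod (y x)) + complex_of_real (cmod (w x)))) *
       (complex_of_real (cmod (z * w x - g x)) + complex_of_real (cmod (z * y x - f x))))"
      by (intro L2_integrable_mult L2_cmult L2_add cm d L)
    then have "integrable (lebesgue_on {l..}) (\<lambda>x. Re ((complex_of_real (1/m) * (complex_of_real (cmod (y x)) + complex_of_real (cmod (w x)))) *
       (complex_of_real (cmod (z * w x - g x)) + complex_of_real (cmod (z * y x - f x)))))"
      by (rule integrable_Re)
    then show ?thesis unfolding k_def[abs_def] by simp
  qed
  have k0: "0 \<le> k x" for x using m by (simp add: k_def)
  have ub: "cmod (u x) \<le> (cmod (y x) + cmod (w x)) / m * N x" if x: "x \<ge> c" for x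
  proof -
    \<comment> \<open>Cramer's rule for the expansion of \<open>u\<close> in terms of \<open>y\<close> and \<open>w\<close>.\<close>
    have "u x * (y x * w' x - y' x * w x) = y x * A x - w x * B x"
      by (simp add: A_def B_def algebra_simps)
    then have "cmod (u x) * cmod (y x * w' x - y' x * w x) = cmod (y x * A x - w x * B x)"
      by (metis norm_mult)
    also have "\<dots> \<le> cmod (y x) * cmod (A x) + cmod (w x) * cmod (B x)"
      by (metis norm_mult norm_triangle_ineq4)
    also have "\<dots> \<le> (cmod (y x) + cmod (w x)) * N x"
      by (simp add: N_def algebra_simps)
    finally have "cmod (u x) * cmod (y x * w' x - y' x * w x) \<le> (cmod (y x) + cmod (w x)) * N x" .
    moreover have "cmod (u x) * m \<le> cmod (u x) * cmod (y x * w' x - y' x * w x)"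
      using c(2)[OF x] by (intro mult_left_mono) auto
    ultimately show ?thesis using m by (simp add: field_simps)
  qed
  have cN: "continuous_on {l..} N" unfolding N_def
    by (intro continuous_intros loc_primitive_continuous_on[OF AP] loc_primitive_continuous_on[OF BP])
  define D where "D = N c * exp (integral\<^sup>L (lebesgue_on {l..}) k)"
  have Nb: "N x \<le> D" if x: "x \<ge> c" for x
  proof -
    have "N x \<le> N c * exp (integral {c..x} k)"
    proof (rule gronwall[OF _ k0])
      show "k absolutely_integrable_on {c..b}" for b using kint c(1) by (rule integrable_halfline_loc)
      show "continuous_on {c..} N" by (rule continuous_on_subset[OF cN]) (use c in auto)
      fix x assume x: "c \<le> x"
      have iA: "(\<lambda>x. z * u x * w x - u x * g x) absolutely_integrable_on {c..x}"
       and iB: "(\<lambda>x. z * u x * y x - u x * f x) absolutely_integrable_on {c..x}"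
        using AP BP c by (auto intro: loc_primitiveD_int)
      have kN: "(\<lambda>t. k t * N t) integrable_on {c..x}"
        by (intro set_lebesgue_integral_eq_integral(1) absolutely_integrable_mult_continuous
              integrable_halfline_loc[OF kint c(1)] continuous_on_subset[OF cN]) (use c in auto)
      have "cmod (A x) \<le> cmod (A c) + cmod (A x - A c)" "cmod (B x) \<le> cmod (B c) + cmod (B x - B c)"
        using norm_triangle_ineq[of "A c" "A x - A c"] norm_triangle_ineq[of "B c" "B x - B c"] by simp_all
      then have "N x \<le> N c + (cmod (A x - A c) + cmod (B x - B c))" by (simp add: N_def)
      also have "cmod (A x - A c) + cmod (B x - B c) = cmod (integral {c..x} (\<lambda>x. z * u x * w x - u x * g x))
          + cmod (integral {c..x} (\<lambda>x. z * u x * y x - u x * f x))"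
        using loc_primitive_diff[OF AP c(1) x] loc_primitive_diff[OF BP c(1) x] by simp
      also have "\<dots> \<le> integral {c..x} (\<lambda>x. cmod (z * u x * w x - u x * g x)) + integral {c..x} (\<lambda>x. cmod (z * u x * y x - u x * f x))"
        using iA iB by (intro add_mono integral_norm_bound_integral) (auto simp: absolutely_integrable_on_def)
      also have "\<dots> = integral {c..x} (\<lambda>x. cmod (z * u x * w x - u x * g x) + cmod (z * u x * y x - u x * f x))"
        using iA iB by (intro Henstock_Kurzweil_Integration.integral_add[symmetric]) (auto simp: absolutely_integrable_on_def)
      also have "\<dots> \<le> integral {c..x} (\<lambda>t. k t * N t)"
      proof (rule integral_le[OF _ kN])
        show "(\<lambda>x. cmod (z * u x * w x - u x * g x) + cmod (z * u x * y x - u x * f x)) integrable_on {c..x}"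
          using iA iB by (intro integrable_add) (auto simp: absolutely_integrable_on_def)
        fix t assume t: "t \<in> {c..x}"
        have "z * u t * w t - u t * g t = u t * (z * w t - g t)" "z * u t * y t - u t * f t = u t * (z * y t - f t)"
          by (simp_all add: algebra_simps)
        then have "cmod (z * u t * w t - u t * g t) + cmod (z * u t * y t - u t * f t)
           = cmod (u t) * (cmod (z * w t - g t) + cmod (z * y t - f t))"
          by (simp add: norm_mult distrib_left)
        also have "\<dots> \<le> (cmod (y t) + cmod (w t)) / m * N t * (cmod (z * w t - g t) + cmod (z * y t - f t))"
          using t by (intro mult_right_mono ub) auto
        finally show "cmod (z * u t * w t - u t * g t) + cmod (z * u t * y t - u t * f t) \<le> k t * N t"
          by (simp add: k_def algebra_simps)
      qed
      finally show "N x \<le> N c + integral {c..x} (\<lambda>t. k t * N t)" by simp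
    qed (use x in \<open>auto simp: N_def\<close>)
    also have "\<dots> \<le> D" unfolding D_def
    proof (intro mult_left_mono iffD2[OF exp_le_cancel_iff])
      have "integral {c..x} k \<le> integral {l..} k"
      proof (rule integral_subset_le)
        show "k integrable_on {l..}" using kint by (rule integrable_on_lebesgue_on) auto
        show "k integrable_on {c..x}" using integrable_halfline_loc[OF kint c(1)] by (rule set_lebesgue_integral_eq_integral(1))
      qed (use c k0 in auto)
      also have "\<dots> = integral\<^sup>L (lebesgue_on {l..}) k" using kint by (simp add: lebesgue_integral_eq_integral)
      finally show "integral {c..x} k \<le> integral\<^sup>L (lebesgue_on {l..}) k" .
    qed (auto simp: N_def)
    finally show ?thesis .
  qed
  have cu: "continuous_on {l..} u" using schr_eq_continuous[OF u] by simp
  have "bounded (u ` {l..c})" by (intro compact_imp_bounded compact_continuous_image continuous_on_subset[OF cu]) auto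
  then obtain U where U: "\<And>x. x \<in> {l..c} \<Longrightarrow> cmod (u x) \<le> U" unfolding bounded_iff by (meson imageI)
  show ?thesis
  proof (rule L2_bound)
    show "u \<in> borel_measurable (lebesgue_on {l..})"
      by (rule continuous_imp_measurable_on_sets_lebesgue[OF cu]) auto
    show "integrable (lebesgue_on {l..}) (\<lambda>x. U\<^sup>2 * indicat_real {l..c} x + (D / m)\<^sup>2 * (2 * (cmod (y x))\<^sup>2 + 2 * (cmod (w x))\<^sup>2))"
      by (intro Bochner_Integration.integrable_add integrable_mult_right L2D L integrable_indicator_halfline)
    fix x assume x: "l \<le> x"
    show "(cmod (u x))\<^sup>2 \<le> U\<^sup>2 * indicat_real {l..c} x + (D / m)\<^sup>2 * (2 * (cmod (y x))\<^sup>2 + 2 * (cmod (w x))\<^sup>2)"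
    proof (cases "x \<le> c")
      case True
      then have "(cmod (u x))\<^sup>2 \<le> U\<^sup>2" using U[of x] x by (intro power_mono) auto
      then show ?thesis using True x by (simp add: add_increasing2)
    next
      case False
      then have xc: "c \<le> x" by simp
      have "cmod (u x) \<le> (cmod (y x) + cmod (w x)) / m * N x" by (rule ub[OF xc])
      also have "\<dots> \<le> (cmod (y x) + cmod (w x)) / m * D" using Nb[OF xc] m by (intro mult_left_mono) auto
      also have "\<dots> = (D / m) * (cmod (y x) + cmod (w x))" by simp
      finally have "(cmod (u x))\<^sup>2 \<le> ((D / m) * (cmod (y x) + cmod (w x)))\<^sup>2"
        by (intro power_mono) auto
      also have "\<dots> = (D / m)\<^sup>2 * (cmod (y x) + cmod (w x))\<^sup>2" by (simp only: power_mult_distrib)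
      also have "\<dots> \<le> (D / m)\<^sup>2 * (2 * (cmod (y x))\<^sup>2 + 2 * (cmod (w x))\<^sup>2)"
        using sum_squares_bound[of "cmod (y x)" "cmod (w x)"]
        by (intro mult_left_mono) (auto simp: power2_sum)
      finally show ?thesis using False by simp
    qed
  qed
qed

lemma fn_vector_space: "vector_space (\<lambda>c (f :: fn) x. c * f x)"
  by unfold_locales (auto simp: fun_eq_iff algebra_simps)

lemma hderiv_zero: "hderiv l (\<lambda>x. 0) l = 0"
  unfolding hderiv_def by (rule vector_derivative_within_halfline) auto

text \<open>Otherwise every solution for \<open>z\<close> would be square integrable, and the two solutions with initial data \<open>(0, 1)\<close> and
  \<open>(1, 0)\<close> would be independent elements of the defect space.\<close>

theorem limit_point_wronskian:
  assumes q: "\<And>b. q absolutely_integrable_on {l..b}" and def: "deficiency_index q l z = 1"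
    and y: "max_elem q l f y y'" and w: "max_elem q l g w w'"
  shows "((\<lambda>x. y x * w' x - y' x * w x) \<longlongrightarrow> 0) at_top"
proof -
  define W where "W = y l * w' l - y' l * w l + integral\<^sup>L (lebesgue_on {l..}) (\<lambda>x. f x * w x - y x * g x)"
  have lim: "((\<lambda>x. y x * w' x - y' x * w x) \<longlongrightarrow> W) at_top"
    unfolding W_def by (rule wronskian_limit[OF y w])
  have "W = 0"
  proof (rule ccontr)
    assume W: "W \<noteq> 0"
    have sol: "u \<in> defect_space q l z" "hderiv l u l = u' l"
      if u: "schr_eq q l (\<lambda>x. z * u x) u u'" and 0: "\<And>x. x < l \<Longrightarrow> u x = 0" for u u'
    proof -
      have "u \<in> L2 l" by (rule solution_in_L2_if_wronskian_limit_nonzero[OF y w lim W u])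
      then have me: "max_elem q l (\<lambda>x. z * u x) u u'" using u by (simp add: max_elem_def L2_cmult)
      show "u \<in> defect_space q l z" unfolding defect_space_def
        using max_elem_imp_Hplus(1)[OF me 0] schr_eq_imp_loc_abs_cont2(3)[OF u 0] by simp
      show "hderiv l u l = u' l" using max_elem_imp_Hplus(2)[OF me 0] by simp
    qed
    interpret V: vector_space "\<lambda>c (f :: fn) x. c * f x" by (rule fn_vector_space)
    obtain B where B: "defect_space q l z \<subseteq> V.span B" "card B = 1"
      using V.basis_exists[of "defect_space q l z"] def unfolding deficiency_index_def by metis
    then obtain b where b: "B = {b}" using card_1_singletonE by blast
    have sp: "\<exists>c. u = (\<lambda>x. c * b x)" if "u \<in> defect_space q l z" for u
      using B(1) that unfolding b V.span_singleton by auto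
    obtain u u' where u: "schr_eq q l (\<lambda>x. z * u x) u u'" "u l = 0" "u' l = 1" "\<And>x. x < l \<Longrightarrow> u x = 0"
      using schr_eq_exists[OF q] by metis
    obtain v v' where v: "schr_eq q l (\<lambda>x. z * v x) v v'" "v l = 1" "v' l = 0" "\<And>x. x < l \<Longrightarrow> v x = 0"
      using schr_eq_exists[OF q] by metis
    obtain c where c: "u = (\<lambda>x. c * b x)" using sp[OF sol(1)[OF u(1,4)]] by blast
    obtain d where d: "v = (\<lambda>x. d * b x)" using sp[OF sol(1)[OF v(1,4)]] by blast
    have "b l \<noteq> 0" using v(2) d by auto
    then have "c = 0" using u(2) c by auto
    then have "u = (\<lambda>x. 0)" using c by simp
    then show False using sol(2)[OF u(1,4)] u(3) hderiv_zero by simp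
  qed
  then show ?thesis using lim by simp
qed

text \<open>The limit of the Wronskian of \<open>y\<close> and \<open>cnj w\<close>, computed in two ways: the end point at infinity contributes
  nothing.\<close>

lemma green:
  assumes q: "\<And>b. q absolutely_integrable_on {l..b}" and def: "deficiency_index q l z = 1"
    and y: "max_elem q l f y y'" and w: "max_elem q l g w w'"
  shows "ip l f w - ip l y g = y' l * cnj (w l) - y l * cnj (w' l)"
proof -
  note w' = max_elem_cnj[OF w]
  have "y l * cnj (w' l) - y' l * cnj (w l) + integral\<^sup>L (lebesgue_on {l..}) (\<lambda>x. f x * cnj (w x) - y x * cnj (g x)) = 0"
    by (rule tendsto_unique[OF _ wronskian_limit[OF y w'] limit_point_wronskian[OF q def y w']]) simp
  moreover have "integral\<^sup>L (lebesgue_on {l..}) (\<lambda>x. f x * cnj (w x) - y x * cnj (g x)) = ip l f w - ip l y g"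
    unfolding ip_def using y w
    by (intro Bochner_Integration.integral_diff L2_integrable_mult_cnj) (auto simp: max_elem_def)
  ultimately show ?thesis by (simp add: algebra_simps)
qed

section \<open>Cutoff functions\<close>

text \<open>Freezing \<open>P\<close> outside \<open>[0, 1]\<close> keeps it differentiable because \<open>P'\<close> vanishes at both ends.\<close>

lemma has_real_derivative_clamp:
  fixes P P' :: "real \<Rightarrow> real"
  assumes P: "\<And>t. (P has_real_derivative P' t) (at t)" and 0: "P' 0 = 0" "P' 1 = 0"
  shows "((\<lambda>t. P (max 0 (min 1 t))) has_real_derivative P' (max 0 (min 1 t))) (at t)"
proof -
  let ?c = "\<lambda>t::real. max 0 (min 1 t)"
  consider "t < 0" | "t > 1" | "0 < t" "t < 1" | "t = 0 \<or> t = 1" by linarith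
  then show ?thesis
  proof cases
    case 1
    have "((\<lambda>_. P 0) has_real_derivative 0) (at t)" by (rule DERIV_const)
    then have "((\<lambda>t. P (?c t)) has_real_derivative 0) (at t)"
      by (rule has_field_derivative_transform_within_open[of _ _ _ "{..<0}"]) (use 1 in auto)
    then show ?thesis using 1 0 by simp
  next
    case 2
    have "((\<lambda>_. P 1) has_real_derivative 0) (at t)" by (rule DERIV_const)
    then have "((\<lambda>t. P (?c t)) has_real_derivative 0) (at t)"
      by (rule has_field_derivative_transform_within_open[of _ _ _ "{1<..}"]) (use 2 in auto)
    then show ?thesis using 2 0 by simp
  next
    case 3
    have "((\<lambda>t. P (?c t)) has_real_derivative P' t) (at t)"
      by (rule has_field_derivative_transform_within_open[OF P, of "{0<..<1}"]) (use 3 in auto)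
    then show ?thesis using 3 by simp
  next
    case 4
    then have ct: "?c t = t" and P't: "P' t = 0" using 0 by auto
    have "((\<lambda>t. P (?c t)) has_derivative ((*) 0)) (at t)"
      unfolding has_derivative_within_alt
    proof (intro conjI allI impI)
      fix e :: real assume e: "e > 0"
      have "(P has_derivative ((*) 0)) (at t)"
        using P[of t] unfolding P't has_field_derivative_def .
      then obtain d where d: "d > 0" "\<And>y. norm (y - t) < d \<Longrightarrow> norm (P y - P t - 0 * (y - t)) \<le> e * norm (y - t)"
        unfolding has_derivative_within_alt using e by blast
      show "\<exists>d>0. \<forall>y\<in>UNIV. norm (y - t) < d \<longrightarrow> norm (P (?c y) - P (?c t) - 0 * (y - t)) \<le> e * norm (y - t)"
      proof (intro exI[of _ d] conjI d(1) ballI impI)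
        fix y assume y: "norm (y - t) < d"
        have le: "norm (?c y - t) \<le> norm (y - t)" using 4 by auto
        then have "norm (P (?c y) - P t - 0 * (?c y - t)) \<le> e * norm (?c y - t)" using y by (intro d(2)) auto
        also have "\<dots> \<le> e * norm (y - t)" using le e by (intro mult_left_mono) auto
        finally show "norm (P (?c y) - P (?c t) - 0 * (y - t)) \<le> e * norm (y - t)" unfolding ct by simp
      qed
    qed (auto intro: bounded_linear_mult_right)
    then show ?thesis unfolding ct P't has_field_derivative_def .
  qed
qed

definition C2_function :: "(real \<Rightarrow> real) \<Rightarrow> (real \<Rightarrow> real) \<Rightarrow> (real \<Rightarrow> real) \<Rightarrow> bool" where
  "C2_function \<eta> \<eta>' \<eta>'' \<longleftrightarrow>
    (\<forall>t. (\<eta> has_real_derivative \<eta>' t) (at t)) \<and> (\<forall>t. (\<eta>' has_real_derivative \<eta>'' t) (at t)) \<and>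
    continuous_on UNIV \<eta>''"

lemma C2_functionD:
  assumes "C2_function \<eta> \<eta>' \<eta>''"
  shows "(\<eta> has_real_derivative \<eta>' t) (at t)" "(\<eta>' has_real_derivative \<eta>'' t) (at t)"
    "continuous_on S \<eta>" "continuous_on S \<eta>'" "continuous_on S \<eta>''"
proof -
  show *: "(\<eta> has_real_derivative \<eta>' t) (at t)" "(\<eta>' has_real_derivative \<eta>'' t) (at t)" for t
    using assms by (auto simp: C2_function_def)
  show "continuous_on S \<eta>" "continuous_on S \<eta>'"
    by (auto intro!: continuous_at_imp_continuous_on DERIV_isCont *)
  show "continuous_on S \<eta>''" using assms by (auto simp: C2_function_def intro: continuous_on_subset)
qed

lemma C2_function_affine:
  assumes "C2_function \<eta> \<eta>' \<eta>''"
  shows "C2_function (\<lambda>x. \<eta> (s * (x - c))) (\<lambda>x. s * \<eta>' (s * (x - c))) (\<lambda>x. s\<^sup>2 * \<eta>'' (s * (x - c)))"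
proof -
  note \<eta> = C2_functionD[OF assms]
  have lin: "((\<lambda>x. s * (x - c)) has_real_derivative s) (at x)" for x
    by (auto intro!: derivative_eq_intros)
  have "((\<lambda>x. \<eta> (s * (x - c))) has_real_derivative s * \<eta>' (s * (x - c))) (at x)" for x
    using DERIV_chain2[OF \<eta>(1) lin] by (simp add: mult.commute)
  moreover have "((\<lambda>x. s * \<eta>' (s * (x - c))) has_real_derivative s\<^sup>2 * \<eta>'' (s * (x - c))) (at x)" for x
    using DERIV_cmult[OF DERIV_chain2[OF \<eta>(2) lin], of s x] by (simp add: power2_eq_square mult_ac)
  ultimately show ?thesis unfolding C2_function_def
    by (auto intro!: continuous_intros continuous_on_compose2[OF \<eta>(5)[of UNIV]])
qed

lemma C2_function_complement:
  assumes "C2_function \<eta> \<eta>' \<eta>''"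
  shows "C2_function (\<lambda>x. 1 - \<eta> x) (\<lambda>x. - \<eta>' x) (\<lambda>x. - \<eta>'' x)"
proof -
  note \<eta> = C2_functionD[OF assms]
  have "((\<lambda>x. 1 - \<eta> x) has_real_derivative - \<eta>' x) (at x)" for x
    using DERIV_diff[OF DERIV_const \<eta>(1), of 1 x] by simp
  then show ?thesis unfolding C2_function_def by (auto intro!: DERIV_minus \<eta> continuous_intros)
qed

definition smooth_step :: "(real \<Rightarrow> real) \<Rightarrow> (real \<Rightarrow> real) \<Rightarrow> (real \<Rightarrow> real) \<Rightarrow> real \<Rightarrow> bool" where
  "smooth_step \<sigma> \<sigma>' \<sigma>'' K \<longleftrightarrow> C2_function \<sigma> \<sigma>' \<sigma>'' \<and>
    (\<forall>t\<le>0. \<sigma> t = 0) \<and> (\<forall>t\<ge>1. \<sigma> t = 1) \<and> (\<forall>t. t \<le> 0 \<or> t \<ge> 1 \<longrightarrow> \<sigma>' t = 0 \<and> \<sigma>'' t = 0) \<and>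
    K \<ge> 0 \<and> (\<forall>t. \<bar>\<sigma> t\<bar> \<le> K) \<and> (\<forall>t. \<bar>\<sigma>' t\<bar> \<le> K) \<and> (\<forall>t. \<bar>\<sigma>'' t\<bar> \<le> K)"

lemma smooth_stepD:
  assumes "smooth_step \<sigma> \<sigma>' \<sigma>'' K"
  shows "C2_function \<sigma> \<sigma>' \<sigma>''" "t \<le> 0 \<Longrightarrow> \<sigma> t = 0" "t \<ge> 1 \<Longrightarrow> \<sigma> t = 1"
    "t \<le> 0 \<or> t \<ge> 1 \<Longrightarrow> \<sigma>' t = 0 \<and> \<sigma>'' t = 0"
    "K \<ge> 0" "\<bar>\<sigma> t\<bar> \<le> K" "\<bar>\<sigma>' t\<bar> \<le> K" "\<bar>\<sigma>'' t\<bar> \<le> K"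
  using assms unfolding smooth_step_def by blast+

lemma smooth_step_exists: "\<exists>\<sigma> \<sigma>' \<sigma>'' K. smooth_step \<sigma> \<sigma>' \<sigma>'' K"
proof -
  define c where "c t = max 0 (min 1 t)" for t :: real
  \<comment> \<open>The polynomial of least degree that rises from \<open>0\<close> to \<open>1\<close> with two vanishing derivatives at both ends.\<close>
  define P where "P t = 10 * t ^ 3 - 15 * t ^ 4 + 6 * t ^ 5" for t :: real
  define P1 where "P1 t = 30 * t ^ 2 - 60 * t ^ 3 + 30 * t ^ 4" for t :: real
  define P2 where "P2 t = 60 * t - 180 * t ^ 2 + 120 * t ^ 3" for t :: real
  have D1: "(P has_real_derivative P1 t) (at t)" for t
    unfolding P_def P1_def by (auto intro!: derivative_eq_intros simp: eval_nat_numeral algebra_simps)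
  have D2: "(P1 has_real_derivative P2 t) (at t)" for t
    unfolding P1_def P2_def by (auto intro!: derivative_eq_intros simp: eval_nat_numeral algebra_simps)
  have cc: "continuous_on UNIV c" unfolding c_def by (intro continuous_intros)
  have P0: "P 0 = 0" "P 1 = 1" "P1 0 = 0" "P1 1 = 0" "P2 0 = 0" "P2 1 = 0"
    by (auto simp: P_def P1_def P2_def)
  have "\<exists>B. \<forall>t\<in>{0..1}. \<bar>f t\<bar> \<le> B" if "continuous_on {0..1::real} f" for f :: "real \<Rightarrow> real"
    using compact_imp_bounded[OF compact_continuous_image[OF that]] by (auto simp: bounded_iff)
  note bd = this
  have "continuous_on {0..1} P" "continuous_on {0..1} P1" "continuous_on {0..1} P2"
    unfolding P_def P1_def P2_def by (intro continuous_intros)+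
  then obtain B0 B1 B2 where B: "\<And>t. t \<in> {0..1} \<Longrightarrow> \<bar>P t\<bar> \<le> B0" "\<And>t. t \<in> {0..1} \<Longrightarrow> \<bar>P1 t\<bar> \<le> B1"
    "\<And>t. t \<in> {0..1} \<Longrightarrow> \<bar>P2 t\<bar> \<le> B2"
    using bd[of P] bd[of P1] bd[of P2] by blast
  define K where "K = max B0 (max B1 B2)"
  have c01: "c t \<in> {0..1}" for t by (auto simp: c_def)
  have K: "\<bar>P (c t)\<bar> \<le> K" "\<bar>P1 (c t)\<bar> \<le> K" "\<bar>P2 (c t)\<bar> \<le> K" for t
    using B[OF c01[of t]] by (auto simp: K_def)
  have "smooth_step (\<lambda>t. P (c t)) (\<lambda>t. P1 (c t)) (\<lambda>t. P2 (c t)) K"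
    unfolding smooth_step_def C2_function_def
  proof (intro conjI allI)
    show "((\<lambda>t. P (c t)) has_real_derivative P1 (c t)) (at t)" for t
      unfolding c_def by (intro has_real_derivative_clamp D1 P0)
    show "((\<lambda>t. P1 (c t)) has_real_derivative P2 (c t)) (at t)" for t
      unfolding c_def by (intro has_real_derivative_clamp D2 P0)
    show "continuous_on UNIV (\<lambda>t. P2 (c t))" unfolding P2_def by (intro continuous_intros cc)
    show "K \<ge> 0" using K(1)[of 0] by linarith
  qed (use K P0 in \<open>auto simp: c_def\<close>)
  then show ?thesis by blast
qed

lemma loc_primitive_of_real:
  fixes \<eta> \<eta>' :: "real \<Rightarrow> real"
  assumes "\<And>t. (\<eta> has_real_derivative \<eta>' t) (at t)" "continuous_on UNIV \<eta>'"
  shows "loc_primitive l (\<lambda>x. complex_of_real (\<eta> x)) (\<lambda>x. complex_of_real (\<eta>' x))"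
proof (rule loc_primitive_C1)
  show "((\<lambda>x. complex_of_real (\<eta> x)) has_vector_derivative complex_of_real (\<eta>' x)) (at x within {l..})" for x
    using has_vector_derivative_of_real[of \<eta> "\<eta>' x" "at x within {l..}"] has_field_derivative_at_within[OF assms(1)]
    by simp
  show "continuous_on {l..} (\<lambda>x. complex_of_real (\<eta>' x))"
    using assms(2) by (intro continuous_intros) (auto intro: continuous_on_subset)
qed

text \<open>Multiplication by a smooth function changes the image only by terms in \<open>h\<close> and \<open>h'\<close>, which are continuous. Thus
  cutoffs stay in the maximal domain without any regularity of \<open>q\<close>.\<close>

lemma schr_eq_mult_smooth:
  fixes f h h' :: fn
    and \<eta> \<eta>' \<eta>'' :: "real \<Rightarrow> real"
  assumes h: "schr_eq q l f h h'"
    and "C2_function \<eta> \<eta>' \<eta>''"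
  shows "schr_eq q l (\<lambda>x. \<eta> x * f x - 2 * complex_of_real (\<eta>' x) * h' x - \<eta>'' x * h x) (\<lambda>x. \<eta> x * h x) (\<lambda>x. \<eta>' x * h x + \<eta> x * h' x)"
proof -
  note \<eta> = C2_functionD[OF assms(2)]
  note P = loc_primitive_of_real[OF \<eta>(1,4), of l] loc_primitive_of_real[OF \<eta>(2,5), of l]
  have h1: "loc_primitive l h h'" and h2: "loc_primitive l h' (\<lambda>x. complex_of_real (q x) * h x - f x)"
    using h by (auto simp: schr_eq_def)
  show ?thesis unfolding schr_eq_def
  proof
    show "loc_primitive l (\<lambda>x. \<eta> x * h x) (\<lambda>x. \<eta>' x * h x + \<eta> x * h' x)"
      by (rule loc_primitive_mult[OF P(1) h1])
    have "loc_primitive l (\<lambda>x. \<eta>' x * h x + \<eta> x * h' x) (\<lambda>x. (\<eta>'' x * h x + \<eta>' x * h' x) + (\<eta>' x * h' x + \<eta> x * (q x * h x - f x)))"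
      by (intro loc_primitive_add loc_primitive_mult P h1 h2)
    then show "loc_primitive l (\<lambda>x. \<eta>' x * h x + \<eta> x * h' x) (\<lambda>x. q x * (\<eta> x * h x) - (\<eta> x * f x - 2 * complex_of_real (\<eta>' x) * h' x - \<eta>'' x * h x))"
      by (rule loc_primitive_cong[OF _ _ negligible_empty]) (auto simp: algebra_simps)
  qed
qed

text \<open>A cutoff that varies over a length \<open>1 / n\<close> has derivatives of size \<open>n\<close> and \<open>n\<^sup>2\<close>. Where \<open>\<bar>h\<bar>\<close> is at most
  \<open>H / n\<close>, as it is near a zero of \<open>h\<close>, these sizes are compensated and the density of the form changes by a
  bounded amount; integration over the length \<open>1 / n\<close> makes the change small.\<close>

lemma cutoff_error:
  fixes f h h' :: fn and \<eta> \<eta>' \<eta>'' :: "real \<Rightarrow> real"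
  defines "E \<equiv> \<lambda>x. (\<eta> x * f x - 2 * complex_of_real (\<eta>' x) * h' x - \<eta>'' x * h x) * cnj (\<eta> x * h x) - f x * cnj (h x)"
  assumes E: "E integrable_on {c..d}" and f: "f absolutely_integrable_on {c..d}"
    and n: "n \<ge> 1" and cd: "d - c = 1 / n" and K: "K \<ge> 0" and H: "H \<ge> 0"
    and F: "integral {c..d} (\<lambda>x. cmod (f x)) \<le> F"
    and b: "\<And>x. x \<in> {c..d} \<Longrightarrow> \<bar>\<eta> x\<bar> \<le> K" "\<And>x. x \<in> {c..d} \<Longrightarrow> \<bar>\<eta>' x\<bar> \<le> K * n"
      "\<And>x. x \<in> {c..d} \<Longrightarrow> \<bar>\<eta>'' x\<bar> \<le> K * n\<^sup>2" "\<And>x. x \<in> {c..d} \<Longrightarrow> cmod (h x) \<le> H / n" "\<And>x. x \<in> {c..d} \<Longrightarrow> cmod (h' x) \<le> H"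
  shows "cmod (integral {c..d} E) \<le> ((K\<^sup>2 + 1) * H * F + 3 * K\<^sup>2 * H\<^sup>2) / n"
proof -
  have fi: "(\<lambda>x. cmod (f x)) integrable_on {c..d}" using f by (simp add: absolutely_integrable_on_def)
  have "cmod (integral {c..d} E) \<le> integral {c..d} (\<lambda>x. (K\<^sup>2 + 1) * H / n * cmod (f x) + 3 * K\<^sup>2 * H\<^sup>2)"
  proof (rule integral_norm_bound_integral[OF E])
    show "(\<lambda>x. (K\<^sup>2 + 1) * H / n * cmod (f x) + 3 * K\<^sup>2 * H\<^sup>2) integrable_on {c..d}"
      by (intro integrable_add integrable_on_mult_right fi integrable_const_ivl)
    fix x assume x: "x \<in> {c..d}"
    have eq: "E x = complex_of_real ((\<eta> x)\<^sup>2 - 1) * f x * cnj (h x) - complex_of_real (2 * \<eta>' x * \<eta> x) * h' x * cnj (h x)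
        - complex_of_real (\<eta>'' x * \<eta> x) * h x * cnj (h x)"
      by (simp add: E_def algebra_simps power2_eq_square)
    have 1: "cmod (complex_of_real ((\<eta> x)\<^sup>2 - 1) * f x * cnj (h x)) \<le> (K\<^sup>2 + 1) * cmod (f x) * (H / n)"
    proof -
      have "(\<eta> x)\<^sup>2 \<le> K\<^sup>2" using b(1)[OF x] by (metis abs_ge_zero power2_abs power_mono)
      then have "\<bar>(\<eta> x)\<^sup>2 - 1\<bar> \<le> K\<^sup>2 + 1" using zero_le_power2[of "\<eta> x"] zero_le_power2[of K] by (intro abs_leI; linarith)
      then show ?thesis unfolding norm_mult norm_of_real complex_mod_cnj using b(4)[OF x] H n
        by (intro mult_mono) auto
    qed
    have 2: "cmod (complex_of_real (2 * \<eta>' x * \<eta> x) * h' x * cnj (h x)) \<le> (2 * (K * n) * K) * H * (H / n)"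
      unfolding norm_mult norm_of_real complex_mod_cnj abs_mult using b(1,2,4,5)[OF x] K H n
      by (intro mult_mono) auto
    have 3: "cmod (complex_of_real (\<eta>'' x * \<eta> x) * h x * cnj (h x)) \<le> ((K * n\<^sup>2) * K) * (H / n) * (H / n)"
      unfolding norm_mult norm_of_real complex_mod_cnj abs_mult using b(1,3,4)[OF x] K H n
      by (intro mult_mono) auto
    have "cmod (E x) \<le> (K\<^sup>2 + 1) * cmod (f x) * (H / n) + (2 * (K * n) * K) * H * (H / n) + ((K * n\<^sup>2) * K) * (H / n) * (H / n)"
      unfolding eq by (intro order_trans[OF norm_triangle_ineq4] add_mono 1 2 3)
    also have "\<dots> = (K\<^sup>2 + 1) * H / n * cmod (f x) + 3 * K\<^sup>2 * H\<^sup>2"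
      using n by (simp add: field_simps power2_eq_square)
    finally show "cmod (E x) \<le> (K\<^sup>2 + 1) * H / n * cmod (f x) + 3 * K\<^sup>2 * H\<^sup>2" .
  qed
  also have "\<dots> = (K\<^sup>2 + 1) * H / n * integral {c..d} (\<lambda>x. cmod (f x)) + (d - c) * (3 * K\<^sup>2 * H\<^sup>2)"
  proof -
    have "c \<le> d" using cd n by (smt (verit) divide_pos_pos)
    moreover have "integral {c..d} (\<lambda>x. (K\<^sup>2 + 1) * H / n * cmod (f x) + 3 * K\<^sup>2 * H\<^sup>2)
        = integral {c..d} (\<lambda>x. (K\<^sup>2 + 1) * H / n * cmod (f x)) + integral {c..d} (\<lambda>_. 3 * K\<^sup>2 * H\<^sup>2)"
      by (intro Henstock_Kurzweil_Integration.integral_add integrable_on_mult_right fi integrable_const_ivl)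
    ultimately show ?thesis by simp
  qed
  also have "\<dots> \<le> (K\<^sup>2 + 1) * H / n * F + (d - c) * (3 * K\<^sup>2 * H\<^sup>2)"
  proof -
    have "0 \<le> (K\<^sup>2 + 1) * H / n" using H n by simp
    from mult_left_mono[OF F this] show ?thesis by simp
  qed
  also have "\<dots> = ((K\<^sup>2 + 1) * H * F + 3 * K\<^sup>2 * H\<^sup>2) / n" unfolding cd using n by (simp add: field_simps)
  finally show ?thesis .
qed

lemma lebesgue_integral_eq_integral_support:
  fixes g :: fn
  assumes "integrable (lebesgue_on {l..}) g" "\<And>x. x > d \<Longrightarrow> g x = 0"
  shows "integral\<^sup>L (lebesgue_on {l..}) g = integral {l..d} g"
proof -
  have "integral\<^sup>L (lebesgue_on {l..}) g = integral {l..} g"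
    using assms(1) by (rule lebesgue_integral_eq_integral) auto
  also have "\<dots> = integral {l..} (\<lambda>x. if x \<in> {l..d} then g x else 0)"
    using assms(2) by (intro Henstock_Kurzweil_Integration.integral_cong) auto
  also have "\<dots> = integral ({l..} \<inter> {l..d}) g"
    by (simp only: integral_restrict_Int Int_commute)
  also have "{l..} \<inter> {l..d} = {l..d}" by auto
  finally show ?thesis .
qed

section \<open>Nonnegativity under Dirichlet conditions\<close>

lemma le_zero_of_inverse_nat:
  assumes "\<And>n::nat. n \<ge> N \<Longrightarrow> - C / real n \<le> x" shows "0 \<le> (x :: real)"
proof (rule LIMSEQ_le_const2)
  show "(\<lambda>n. - C / real n) \<longlonglongrightarrow> 0" by (rule lim_const_over_n)
qed (use assms in blast)

lemma derivative_bounds: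
  assumes h: "schr_eq q l f h h'" and "l \<le> c"
  obtains H where "H \<ge> 0" "\<And>x. x \<in> {l..c} \<Longrightarrow> cmod (h' x) \<le> H"
    "\<And>x y. l \<le> x \<Longrightarrow> x \<le> y \<Longrightarrow> y \<le> c \<Longrightarrow> cmod (h y - h x) \<le> H * (y - x)"
proof -
  have P: "loc_primitive l h h'" using h by (simp add: schr_eq_def)
  have "bounded (h' ` {l..c})"
    by (intro compact_imp_bounded compact_continuous_image continuous_on_subset[OF schr_eq_continuous(2)[OF h]]) auto
  then obtain H where H: "H > 0" "\<And>x. x \<in> {l..c} \<Longrightarrow> cmod (h' x) \<le> H" unfolding bounded_pos by auto
  show ?thesis
  proof (rule that[of H])
    fix x y assume xy: "l \<le> x" "x \<le> y" "y \<le> c"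
    have "cmod (integral {x..y} h') \<le> integral {x..y} (\<lambda>_. H)"
      using loc_primitiveD_int[OF P xy(1), of y] H xy
      by (intro integral_norm_bound_integral) (auto simp: absolutely_integrable_on_def)
    then show "cmod (h y - h x) \<le> H * (y - x)"
      using loc_primitive_diff[OF P xy(1,2)] xy by (simp add: mult.commute)
  qed (use H in auto)
qed

text \<open>For elements of the minimal domain, where also \<open>h' l = 0\<close>, this is the hypothesis. A cutoff that vanishes near \<open>l\<close>
  moves \<open>h\<close> into the minimal domain at a cost that tends to \<open>0\<close>, because \<open>h l = 0\<close>.\<close>

lemma nonneg_dirichlet:
  assumes nonneg: "nonneg_min q l"
    and h: "max_elem q l f h h'" and hl: "h l = 0"
  shows "0 \<le> Re (ip l f h)"
proof -
  have sh: "schr_eq q l f h h'" and L: "h \<in> L2 l" "f \<in> L2 l" using h by (auto simp: max_elem_def)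
  note ch = schr_eq_continuous[OF sh]
  obtain \<sigma> \<sigma>' \<sigma>'' K where "smooth_step \<sigma> \<sigma>' \<sigma>'' K" using smooth_step_exists by blast
  note \<sigma> = smooth_stepD[OF this]
  obtain H where H: "H \<ge> 0" "\<And>x. x \<in> {l..l+1} \<Longrightarrow> cmod (h' x) \<le> H"
    "\<And>x y. l \<le> x \<Longrightarrow> x \<le> y \<Longrightarrow> y \<le> l+1 \<Longrightarrow> cmod (h y - h x) \<le> H * (y - x)"
    using derivative_bounds[OF sh, of "l+1"] by auto
  define F where "F = integral {l..l+1} (\<lambda>x. cmod (f x))"
  define C where "C = (K\<^sup>2 + 1) * H * F + 3 * K\<^sup>2 * H\<^sup>2"
  have "- C / real n \<le> Re (ip l f h)" if n: "n \<ge> 1" for n :: nat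
  proof -
    define N where "N = real n"
    have N: "N \<ge> 1" using n by (simp add: N_def)
    define \<eta> where "\<eta> = (\<lambda>x. \<sigma> (N * (x - l)))"
    define \<eta>' where "\<eta>' = (\<lambda>x. N * \<sigma>' (N * (x - l)))"
    define \<eta>'' where "\<eta>'' = (\<lambda>x. N\<^sup>2 * \<sigma>'' (N * (x - l)))"
    have C2: "C2_function \<eta> \<eta>' \<eta>''"
      unfolding \<eta>_def \<eta>'_def \<eta>''_def by (rule C2_function_affine[OF \<sigma>(1)])
    note c\<eta> = C2_functionD(3-5)[OF C2]
    have far: "N * (x - l) \<ge> 1" if "x > l + 1 / N" for x using that N by (simp add: field_simps)
    define g where "g x = (if x < l then 0 else \<eta> x * h x)" for x
    define g' where "g' x = \<eta>' x * h x + \<eta> x * h' x" for x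
    define G where "G x = \<eta> x * f x - 2 * complex_of_real (\<eta>' x) * h' x - \<eta>'' x * h x" for x
    have sg: "schr_eq q l G g g'"
      unfolding G_def g'_def by (rule schr_eq_cong[OF schr_eq_mult_smooth[OF sh C2]]) (auto simp: g_def)
    have gL: "(\<lambda>x. \<eta> x * h x) \<in> L2 l"
      by (rule L2_mult_bounded[OF L(1), of _ K]) (use \<sigma>(6) in \<open>auto simp: \<eta>_def intro!: continuous_intros c\<eta>(1)[unfolded \<eta>_def]\<close>)
    have gL': "g \<in> L2 l"
      by (rule L2_AE_cong[OF gL]) (auto intro!: AE_I2 simp: g_def)
    have GL: "G \<in> L2 l"
    proof -
      have "(\<lambda>x. \<eta> x * f x) \<in> L2 l"
        by (rule L2_mult_bounded[OF L(2), of _ K]) (use \<sigma>(6) in \<open>auto simp: \<eta>_def intro!: continuous_intros c\<eta>(1)[unfolded \<eta>_def]\<close>)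
      moreover have "(\<lambda>x. - 2 * complex_of_real (\<eta>' x) * h' x - \<eta>'' x * h x) \<in> L2 l"
      proof (rule L2_compact_support[of _ _ "l + 1/N"])
        show "continuous_on {l..} (\<lambda>x. - 2 * complex_of_real (\<eta>' x) * h' x - \<eta>'' x * h x)"
          by (intro continuous_intros ch c\<eta>)
        show "- 2 * complex_of_real (\<eta>' x) * h' x - \<eta>'' x * h x = 0" if "x > l + 1 / N" for x
          using \<sigma>(4) far[OF that] by (simp add: \<eta>'_def \<eta>''_def)
      qed
      ultimately have "(\<lambda>x. \<eta> x * f x + (- 2 * complex_of_real (\<eta>' x) * h' x - \<eta>'' x * h x)) \<in> L2 l" by (rule L2_add)
      then show ?thesis by (simp add: G_def[abs_def] algebra_simps)
    qed
    have meg: "max_elem q l G g g'" using sg gL' GL by (simp add: max_elem_def)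
    have g0: "g x = 0" if "x < l" for x using that by (simp add: g_def)
    have \<eta>l: "\<eta> l = 0" using \<sigma>(2)[of 0] by (simp add: \<eta>_def)
    have "g l = 0" "g' l = 0" using hl \<eta>l by (auto simp: g_def g'_def)
    then have "g \<in> dom_min q l"
      using max_elem_imp_Hplus(1,2)[OF meg g0] by (simp add: dom_min_def)
    then have "0 \<le> Re (ip l (schr q l g) g)" using nonneg by (simp add: nonneg_min_def)
    also have "ip l (schr q l g) g = ip l G g"
      using ip_AE_cong[OF max_elem_imp_Hplus(3)[OF meg g0] GL gL'] by simp
    finally have pos: "0 \<le> Re (ip l G g)" .
    define E where "E x = (\<eta> x * f x - 2 * complex_of_real (\<eta>' x) * h' x - \<eta>'' x * h x) * cnj (\<eta> x * h x) - f x * cnj (h x)" for x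
    have "ip l G g = ip l G (\<lambda>x. \<eta> x * h x)"
      unfolding ip_def by (intro Bochner_Integration.integral_cong) (auto simp: g_def)
    then have "ip l G g - ip l f h = integral\<^sup>L (lebesgue_on {l..}) (\<lambda>x. G x * cnj (\<eta> x * h x) - f x * cnj (h x))"
      unfolding ip_def using L2_integrable_mult_cnj[OF GL gL] L2_integrable_mult_cnj[OF L(2,1)]
      by (simp add: Bochner_Integration.integral_diff)
    also have "(\<lambda>x. G x * cnj (\<eta> x * h x) - f x * cnj (h x)) = E" by (auto simp: E_def G_def)
    finally have diff: "ip l G g - ip l f h = integral\<^sup>L (lebesgue_on {l..}) E" .
    have Eint: "integrable (lebesgue_on {l..}) E"
      using L2_integrable_mult_cnj[OF GL gL] L2_integrable_mult_cnj[OF L(2,1)]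
      unfolding E_def[abs_def] G_def[abs_def] by (rule Bochner_Integration.integrable_diff)
    have "integral\<^sup>L (lebesgue_on {l..}) E = integral {l..l + 1/N} E"
      using far \<sigma>(3,4) by (intro lebesgue_integral_eq_integral_support Eint) (auto simp: E_def \<eta>_def \<eta>'_def \<eta>''_def)
    moreover have "cmod (integral {l..l + 1/N} E) \<le> C / N"
      unfolding E_def[abs_def] C_def
    proof (rule cutoff_error)
      have n1: "l + 1 / N \<le> l + 1" using N by simp
      show "(\<lambda>x. (\<eta> x * f x - 2 * complex_of_real (\<eta>' x) * h' x - \<eta>'' x * h x) * cnj (\<eta> x * h x) - f x * cnj (h x)) integrable_on {l..l + 1/N}"
        using integrable_halfline_loc[OF Eint order_refl] unfolding E_def[abs_def] by (rule set_lebesgue_integral_eq_integral(1))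
      show "f absolutely_integrable_on {l..l+1/N}" by (rule L2_loc_integrable[OF L(2)])
      show "integral {l..l + 1/N} (\<lambda>x. cmod (f x)) \<le> F"
        unfolding F_def using L2_loc_integrable[OF L(2)] n1
        by (intro integral_subset_le) (auto simp: absolutely_integrable_on_def)
      show "cmod (h x) \<le> H / N" if x: "x \<in> {l..l+1/N}" for x
      proof -
        have "cmod (h x - h l) \<le> H * (x - l)" using x n1 by (intro H(3)) auto
        also have "\<dots> \<le> H * (1 / N)" using x H(1) by (intro mult_left_mono) auto
        finally show ?thesis using hl by simp
      qed
      show "cmod (h' x) \<le> H" if x: "x \<in> {l..l+1/N}" for x using x n1 by (intro H(2)) auto
    qed (use N \<sigma> H in \<open>auto simp: \<eta>_def \<eta>'_def \<eta>''_def abs_mult mult.commute intro!: mult_left_mono\<close>)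
    ultimately have "cmod (ip l G g - ip l f h) \<le> C / N" using diff by simp
    then have "Re (ip l G g) - Re (ip l f h) \<le> C / N"
      using complex_Re_le_cmod[of "ip l G g - ip l f h"] by simp
    with pos show ?thesis by (simp add: N_def)
  qed
  then show ?thesis by (rule le_zero_of_inverse_nat)
qed

text \<open>Nonnegativity is local: a cutoff at a zero \<open>b\<close> of \<open>h\<close> removes the part of \<open>h\<close> beyond \<open>b\<close>.\<close>

lemma nonneg_dirichlet_interval:
  assumes nonneg: "nonneg_min q l"
    and sh: "schr_eq q l f h h'" and cf: "continuous_on {l..} f" and hl: "h l = 0" and lb: "l < b" and hb: "h b = 0"
  shows "0 \<le> Re (integral {l..b} (\<lambda>x. f x * cnj (h x)))"
proof -
  note ch = schr_eq_continuous[OF sh]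
  obtain \<sigma> \<sigma>' \<sigma>'' K where "smooth_step \<sigma> \<sigma>' \<sigma>'' K" using smooth_step_exists by blast
  note \<sigma> = smooth_stepD[OF this]
  obtain H where H: "H \<ge> 0" "\<And>x. x \<in> {l..b} \<Longrightarrow> cmod (h' x) \<le> H"
    "\<And>x y. l \<le> x \<Longrightarrow> x \<le> y \<Longrightarrow> y \<le> b \<Longrightarrow> cmod (h y - h x) \<le> H * (y - x)"
    using derivative_bounds[OF sh, of b] lb by (metis less_imp_le)
  have fint: "f absolutely_integrable_on {c..d}" if "l \<le> c" for c d
    by (intro absolutely_integrable_continuous_real continuous_on_subset[OF cf]) (use that in auto)
  define F where "F = integral {l..b} (\<lambda>x. cmod (f x))"
  define C where "C = (K\<^sup>2 + 1) * H * F + 3 * K\<^sup>2 * H\<^sup>2"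
  obtain n0 :: nat where n0: "1 / (b - l) < real n0" using reals_Archimedean2 by blast
  have "- C / real n \<le> Re (integral {l..b} (\<lambda>x. f x * cnj (h x)))" if n: "n \<ge> max 1 n0" for n :: nat
  proof -
    define N where "N = real n"
    have N: "N \<ge> 1" using n by (simp add: N_def)
    have "1 / (b - l) < N" using n0 n unfolding N_def by (meson less_le_trans max.boundedE of_nat_le_iff)
    then have lN: "l \<le> b - 1 / N" using N lb by (simp add: field_simps)
    define \<eta> where "\<eta> = (\<lambda>x. \<sigma> (- N * (x - b)))"
    define \<eta>' where "\<eta>' = (\<lambda>x. - N * \<sigma>' (- N * (x - b)))"
    define \<eta>'' where "\<eta>'' = (\<lambda>x. (- N)\<^sup>2 * \<sigma>'' (- N * (x - b)))"
    have C2: "C2_function \<eta> \<eta>' \<eta>''"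
      unfolding \<eta>_def \<eta>'_def \<eta>''_def by (rule C2_function_affine[OF \<sigma>(1)])
    note c\<eta> = C2_functionD(3-5)[OF C2]
    have near: "- N * (x - b) \<ge> 1" if "x < b - 1 / N" for x using that N by (simp add: field_simps)
    have zero: "\<eta> x = 0" "\<eta>' x = 0" "\<eta>'' x = 0" if "x > b" for x
    proof -
      have "- N * (x - b) \<le> 0" using that N by simp
      then show "\<eta> x = 0" "\<eta>' x = 0" "\<eta>'' x = 0" using \<sigma>(2,4) by (auto simp: \<eta>_def \<eta>'_def \<eta>''_def)
    qed
    define g where "g x = \<eta> x * h x" for x
    define g' where "g' x = \<eta>' x * h x + \<eta> x * h' x" for x
    define G where "G x = \<eta> x * f x - 2 * complex_of_real (\<eta>' x) * h' x - \<eta>'' x * h x" for x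
    have sg: "schr_eq q l G g g'"
      unfolding G_def g'_def g_def by (rule schr_eq_mult_smooth[OF sh C2])
    have cg: "continuous_on {l..} g" unfolding g_def
      by (intro continuous_intros ch c\<eta>)
    have cG: "continuous_on {l..} G" unfolding G_def
      by (intro continuous_intros ch cf c\<eta>)
    have gL: "g \<in> L2 l" by (rule L2_compact_support[OF cg, of b]) (simp add: g_def zero)
    have GL: "G \<in> L2 l" by (rule L2_compact_support[OF cG, of b]) (simp add: G_def zero)
    have "max_elem q l G g g'" using sg gL GL by (simp add: max_elem_def)
    moreover have "g l = 0" using hl by (simp add: g_def)
    ultimately have pos: "0 \<le> Re (ip l G g)" using nonneg_dirichlet[OF nonneg] by blast
    define E where "E x = (\<eta> x * f x - 2 * complex_of_real (\<eta>' x) * h' x - \<eta>'' x * h x) * cnj (\<eta> x * h x) - f x * cnj (h x)" for x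
    have cfh: "continuous_on {l..} (\<lambda>x. f x * cnj (h x))" by (intro continuous_intros cf ch)
    have cGg: "continuous_on {l..} (\<lambda>x. G x * cnj (g x))" by (intro continuous_intros cG cg)
    have cE: "continuous_on {l..} E" unfolding E_def
      by (intro continuous_intros ch cf c\<eta>)
    have io: "u integrable_on {c..d}" if "continuous_on {l..} u" "l \<le> c" for u :: fn and c d
      by (intro integrable_continuous_real continuous_on_subset[OF that(1)]) (use that in auto)
    have "ip l G g = integral {l..b} (\<lambda>x. G x * cnj (g x))"
      unfolding ip_def using zero by (intro lebesgue_integral_eq_integral_support L2_integrable_mult_cnj GL gL) (simp add: g_def)
    then have "ip l G g - integral {l..b} (\<lambda>x. f x * cnj (h x)) = integral {l..b} (\<lambda>x. G x * cnj (g x) - f x * cnj (h x))"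
      using io[OF cfh order_refl] io[OF cGg order_refl] by (simp add: Henstock_Kurzweil_Integration.integral_diff)
    also have "(\<lambda>x. G x * cnj (g x) - f x * cnj (h x)) = E" by (auto simp: E_def G_def g_def)
    also have "integral {l..b} E = integral {l..b - 1/N} E + integral {b - 1/N..b} E"
      using lN N by (intro Henstock_Kurzweil_Integration.integral_combine[symmetric] io[OF cE order_refl]) auto
    also have "integral {l..b - 1/N} E = integral {l..b - 1/N} (\<lambda>_. 0)"
      by (rule integral_spike[of "{b - 1/N}"]) (use near \<sigma>(3,4) in \<open>auto simp: E_def \<eta>_def \<eta>'_def \<eta>''_def\<close>)
    finally have diff: "ip l G g - integral {l..b} (\<lambda>x. f x * cnj (h x)) = integral {b - 1/N..b} E" by simp
    have "cmod (integral {b - 1/N..b} E) \<le> C / N"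
      unfolding E_def[abs_def] C_def
    proof (rule cutoff_error)
      show "(\<lambda>x. (\<eta> x * f x - 2 * complex_of_real (\<eta>' x) * h' x - \<eta>'' x * h x) * cnj (\<eta> x * h x) - f x * cnj (h x)) integrable_on {b - 1/N..b}"
        using io[OF cE lN] unfolding E_def[abs_def] .
      show "f absolutely_integrable_on {b - 1/N..b}" by (rule fint[OF lN])
      show "integral {b - 1/N..b} (\<lambda>x. cmod (f x)) \<le> F"
        unfolding F_def using fint[OF lN, of b] fint[OF order_refl, of b] lN
        by (intro integral_subset_le) (auto simp: absolutely_integrable_on_def)
      show "cmod (h x) \<le> H / N" if x: "x \<in> {b - 1/N..b}" for x
      proof -
        have "cmod (h b - h x) \<le> H * (b - x)" using x lN by (intro H(3)) auto
        also have "\<dots> \<le> H * (1 / N)" using x H(1) by (intro mult_left_mono) auto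
        finally show ?thesis using hb by simp
      qed
      show "cmod (h' x) \<le> H" if x: "x \<in> {b - 1/N..b}" for x using x lN by (intro H(2)) auto
    qed (use N \<sigma> H in \<open>auto simp: \<eta>_def \<eta>'_def \<eta>''_def abs_mult mult.commute intro!: mult_left_mono\<close>)
    then have "cmod (ip l G g - integral {l..b} (\<lambda>x. f x * cnj (h x))) \<le> C / N" using diff by simp
    then have "Re (ip l G g) - Re (integral {l..b} (\<lambda>x. f x * cnj (h x))) \<le> C / N"
      using complex_Re_le_cmod[of "ip l G g - integral {l..b} (\<lambda>x. f x * cnj (h x))"] by simp
    with pos show ?thesis by (simp add: N_def)
  qed
  then show ?thesis by (rule le_zero_of_inverse_nat)
qed

section \<open>The Weyl solution below the spectrum\<close>

lemma L2_of_bounded_integrals: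
  assumes g: "continuous_on {l..} g" and C: "\<And>c. c \<ge> l \<Longrightarrow> integral {l..c} (\<lambda>x. (cmod (g x))\<^sup>2) \<le> C"
  shows "g \<in> L2 l"
proof -
  define u where "u x = (cmod (g x))\<^sup>2" for x
  have cu: "continuous_on {l..} u" unfolding u_def by (intro continuous_intros g)
  have mu: "u \<in> borel_measurable (lebesgue_on {l..})"
    by (rule continuous_imp_measurable_on_sets_lebesgue[OF cu]) auto
  have mg: "g \<in> borel_measurable (lebesgue_on {l..})"
    by (rule continuous_imp_measurable_on_sets_lebesgue[OF g]) auto
  define v where "v n x = indicat_real {l..l + real n} x * u x" for n x
  have uint: "u absolutely_integrable_on {l..c}" for c
    by (intro absolutely_integrable_continuous_real continuous_on_subset[OF cu]) auto
  have vint: "integrable (lebesgue_on {l..}) (v n)"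
    and vval: "integral\<^sup>L (lebesgue_on {l..}) (v n) = integral {l..l + real n} u" for n
    using integral_halfline_truncation[OF uint, of "l + real n"] by (simp_all add: v_def[abs_def])
  have mono: "integral {l..l + real m} u \<le> integral {l..l + real n} u" if "m \<le> n" for m n
    using that set_lebesgue_integral_eq_integral(1)[OF uint]
    by (intro integral_subset_le) (auto simp: u_def)
  have bdd: "integral {l..l + real n} u \<le> C" for n using C[of "l + real n"] by (simp add: u_def[abs_def])
  obtain L where L: "(\<lambda>n. integral {l..l + real n} u) \<longlonglongrightarrow> L"
  proof -
    have "incseq (\<lambda>n. integral {l..l + real n} u)" using mono by (simp add: incseq_def)
    then show ?thesis using incseq_convergent[of "\<lambda>n. integral {l..l + real n} u" C] bdd that by blast
  qed
  have "integrable (lebesgue_on {l..}) u"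
  proof (rule integrable_monotone_convergence)
    show "integrable (lebesgue_on {l..}) (v n)" for n by (rule vint)
    show "AE x in lebesgue_on {l..}. mono (\<lambda>n. v n x)"
      by (intro AE_I2) (auto simp: mono_def v_def u_def indicator_def)
    show "AE x in lebesgue_on {l..}. (\<lambda>n. v n x) \<longlonglongrightarrow> u x"
    proof (rule AE_I2)
      fix x assume x: "x \<in> space (lebesgue_on {l..})"
      obtain N :: nat where N: "x - l \<le> real N" using real_arch_simple by blast
      have "\<forall>\<^sub>F n in sequentially. v n x = u x"
        using x N by (intro eventually_sequentiallyI[of N]) (auto simp: v_def indicator_def)
      then show "(\<lambda>n. v n x) \<longlonglongrightarrow> u x" by (rule tendsto_eventually)
    qed
    show "(\<lambda>n. integral\<^sup>L (lebesgue_on {l..}) (v n)) \<longlonglongrightarrow> L" using L by (simp add: vval)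
  qed (rule mu)
  then show ?thesis using mg by (simp add: L2_def u_def[abs_def])
qed

lemma integral_of_real_eq:
  fixes g :: "real \<Rightarrow> real"
  assumes "g integrable_on S"
  shows "integral S (\<lambda>x. complex_of_real (g x)) = complex_of_real (integral S g)"
  using integral_linear[OF assms bounded_linear_of_real] by (simp add: o_def)

lemma integral_Re_eq:
  assumes "g integrable_on S"
  shows "integral S (\<lambda>x. Re (g x)) = Re (integral S g)"
  using has_integral_Re[OF integrable_integral[OF assms]] by (rule integral_unique)

lemma solution_norm_positive:
  assumes \<phi>: "schr_eq q l f \<phi> \<phi>'" and 1: "\<phi>' l = 1" and c: "c > l"
  shows "0 < integral {l..c} (\<lambda>x. (cmod (\<phi> x))\<^sup>2)"
proof -
  note ch = schr_eq_continuous[OF \<phi>]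
  have cc: "continuous_on {l..c} (\<lambda>x. (cmod (\<phi> x))\<^sup>2)"
    by (intro continuous_intros continuous_on_subset[OF ch(1)]) auto
  have "0 \<le> integral {l..c} (\<lambda>x. (cmod (\<phi> x))\<^sup>2)"
    by (intro Henstock_Kurzweil_Integration.integral_nonneg integrable_continuous_real cc) auto
  moreover have "integral {l..c} (\<lambda>x. (cmod (\<phi> x))\<^sup>2) \<noteq> 0"
  proof
    assume "integral {l..c} (\<lambda>x. (cmod (\<phi> x))\<^sup>2) = 0"
    then have 0: "\<phi> x = 0" if "x \<in> {l..c}" for x
      using integral_eq_0_iff[OF cc c] that by auto
    have "loc_primitive l \<phi> \<phi>'" using \<phi> by (simp add: schr_eq_def)
    from loc_primitive_continuous_derivative[OF this ch(2) order_refl]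
    have "(\<phi> has_vector_derivative 1) (at l within {l..c})"
      unfolding 1 by (rule has_vector_derivative_within_subset) auto
    moreover have "(\<phi> has_vector_derivative 0) (at l within {l..c})"
      using c 0 by (intro has_vector_derivative_transform[of l "{l..c}" \<phi> "\<lambda>_. 0" 0]) auto
    moreover have "at l within {l..c} \<noteq> bot" using c by (simp add: at_within_Icc_at_right)
    ultimately show False using vector_derivative_unique_within by (metis zero_neq_one)
  qed
  ultimately show ?thesis by simp
qed

lemma solves_unique:
  assumes q: "\<And>b. q absolutely_integrable_on {l..b}"
    and y: "solves q l z y" and u: "solves q l z u" and eq: "y l = u l" "hderiv l y l = hderiv l u l"
  shows "y = u"
proof
  fix x
  have "schr_eq q l (\<lambda>x. z * y x + (-1) * (z * u x)) (\<lambda>x. y x + (-1) * u x) (\<lambda>x. hderiv l y x + (-1) * hderiv l u x)"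
    by (intro schr_eq_add schr_eq_cmult solves_imp_schr_eq y u q)
  then have "schr_eq q l (\<lambda>x. z * (y x + (-1) * u x)) (\<lambda>x. y x + (-1) * u x) (\<lambda>x. hderiv l y x + (-1) * hderiv l u x)"
    by (simp add: algebra_simps)
  from schr_eq_zero_initial(1)[OF this q, of x] eq have "y x = u x" if "x \<ge> l"
    using that by simp
  moreover have "y x = u x" if "x < l"
    using y u that by (simp add: solves_def loc_abs_cont2_def)
  ultimately show "y x = u x" by linarith
qed

lemma ivp_ex1:
  assumes q: "\<And>b. q absolutely_integrable_on {l..b}"
  shows "\<exists>!y. solves q l z y \<and> y l = a \<and> hderiv l y l = b"
proof -
  obtain y y' where y: "schr_eq q l (\<lambda>x. z * y x) y y'" "y l = a" "y' l = b" "\<And>x. x < l \<Longrightarrow> y x = 0"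
    using schr_eq_exists[OF q] by metis
  have "solves q l z y \<and> y l = a \<and> hderiv l y l = b"
    using schr_eq_imp_solves[OF y(1,4)] schr_eq_imp_loc_abs_cont2(2)[OF y(1,4), of l] y(2,3) by auto
  moreover have "u = y" if "solves q l z u \<and> u l = a \<and> hderiv l u l = b" for u
    using that calculation by (intro solves_unique[OF q, where z = z]) auto
  ultimately show ?thesis by blast
qed

lemma phi1_solves_ivp:
  assumes q: "\<And>b. q absolutely_integrable_on {l..b}"
  shows "schr_eq q l (\<lambda>x. z * phi1 q l z x) (phi1 q l z) (hderiv l (phi1 q l z))"
    "phi1 q l z l = 0" "hderiv l (phi1 q l z) l = 1" "x < l \<Longrightarrow> phi1 q l z x = 0"
proof -
  have *: "solves q l z (phi1 q l z) \<and> phi1 q l z l = 0 \<and> hderiv l (phi1 q l z) l = 1"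
    unfolding phi1_def by (rule theI'[OF ivp_ex1[OF q]])
  then show "schr_eq q l (\<lambda>x. z * phi1 q l z x) (phi1 q l z) (hderiv l (phi1 q l z))"
    using solves_imp_schr_eq[OF _ q] by blast
  show "phi1 q l z l = 0" "hderiv l (phi1 q l z) l = 1" "x < l \<Longrightarrow> phi1 q l z x = 0"
    using * by (auto simp: solves_def loc_abs_cont2_def)
qed

lemma phi2_solves_ivp:
  assumes q: "\<And>b. q absolutely_integrable_on {l..b}"
  shows "schr_eq q l (\<lambda>x. z * phi2 q l z x) (phi2 q l z) (hderiv l (phi2 q l z))"
    "phi2 q l z l = -1" "hderiv l (phi2 q l z) l = 0" "x < l \<Longrightarrow> phi2 q l z x = 0"
proof -
  have *: "solves q l z (phi2 q l z) \<and> phi2 q l z l = -1 \<and> hderiv l (phi2 q l z) l = 0"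
    unfolding phi2_def by (rule theI'[OF ivp_ex1[OF q]])
  then show "schr_eq q l (\<lambda>x. z * phi2 q l z x) (phi2 q l z) (hderiv l (phi2 q l z))"
    using solves_imp_schr_eq[OF _ q] by blast
  show "phi2 q l z l = -1" "hderiv l (phi2 q l z) l = 0" "x < l \<Longrightarrow> phi2 q l z x = 0"
    using * by (auto simp: solves_def loc_abs_cont2_def)
qed

locale nonneg_limit_point =
  fixes q :: "real \<Rightarrow> real" and l :: real
  assumes q: "\<And>b. q absolutely_integrable_on {l..b}"
    and deficiency: "deficiency_index q l \<i> = 1"
    and nonneg: "nonneg_min q l"
begin

text \<open>A zero at \<open>b\<close> would make \<open>\<phi>\<close> an eigenfunction of the Dirichlet problem on \<open>[l, b]\<close> with the negative eigenvalue
  \<open>- lam\<close>.\<close>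

lemma dirichlet_solution_nonzero:
  assumes \<phi>: "schr_eq q l (\<lambda>x. complex_of_real (- lam) * \<phi> x) \<phi> \<phi>'" and "\<phi> l = 0" "\<phi>' l = 1"
    and lam: "lam > 0" and b: "b > l"
  shows "\<phi> b \<noteq> 0"
proof
  assume "\<phi> b = 0"
  note c\<phi> = schr_eq_continuous(1)[OF \<phi>]
  have int: "(\<lambda>x. - lam * (cmod (\<phi> x))\<^sup>2) integrable_on {l..b}"
    by (intro integrable_continuous_real continuous_intros continuous_on_subset[OF c\<phi>]) auto
  have "0 \<le> Re (integral {l..b} (\<lambda>x. complex_of_real (- lam) * \<phi> x * cnj (\<phi> x)))"
    by (intro nonneg_dirichlet_interval[OF nonneg \<phi> _ \<open>\<phi> l = 0\<close> b \<open>\<phi> b = 0\<close>] continuous_intros c\<phi>)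
  also have "(\<lambda>x. complex_of_real (- lam) * \<phi> x * cnj (\<phi> x)) = (\<lambda>x. complex_of_real (- lam * (cmod (\<phi> x))\<^sup>2))"
    by (rule ext) (simp only: of_real_mult complex_norm_square mult.assoc)
  also have "Re (integral {l..b} \<dots>) = - lam * integral {l..b} (\<lambda>x. (cmod (\<phi> x))\<^sup>2)"
    unfolding integral_of_real_eq[OF int] by simp
  finally show False
    using solution_norm_positive[OF \<phi> \<open>\<phi>' l = 1\<close> b] lam by (simp add: zero_le_mult_iff mult_le_0_iff)
qed

text \<open>For each \<open>b\<close> choose \<open>M\<close> such that \<open>\<theta> + M * \<phi>\<close> vanishes at \<open>b\<close>. Replacing \<open>\<theta>\<close> by \<open>A = \<eta> * \<theta>\<close>, where \<open>\<eta>\<close> is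
  a step that vanishes at \<open>l\<close>, gives a function \<open>h\<close> that satisfies Dirichlet conditions at \<open>l\<close> and \<open>b\<close> and is mapped
  by the expression plus \<open>lam\<close> to a function \<open>r\<close> which depends neither on \<open>b\<close> nor on \<open>M\<close> and vanishes beyond \<open>l + 1\<close>.
  Nonnegativity bounds the norm of \<open>h\<close> on \<open>[l, b]\<close> by that of \<open>r\<close> divided by \<open>lam\<close>. Hence the coefficients \<open>M\<close> stay
  bounded as \<open>b\<close> grows, and any of their limit points gives a square integrable solution.\<close>

lemma weyl_solution_exists:
  assumes \<phi>: "schr_eq q l (\<lambda>x. complex_of_real (- lam) * \<phi> x) \<phi> \<phi>'" and \<phi>l: "\<phi> l = 0" "\<phi>' l = 1"
    and \<theta>: "schr_eq q l (\<lambda>x. complex_of_real (- lam) * \<theta> x) \<theta> \<theta>'"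
    and lam: "lam > 0"
  shows "\<exists>M. (\<lambda>x. \<theta> x + M * \<phi> x) \<in> L2 l"
proof -
  obtain \<sigma> \<sigma>' \<sigma>'' K where "smooth_step \<sigma> \<sigma>' \<sigma>'' K" using smooth_step_exists by blast
  note \<sigma> = smooth_stepD[OF this]
  note c\<phi> = schr_eq_continuous[OF \<phi>] and c\<theta> = schr_eq_continuous[OF \<theta>]
  define \<eta> where "\<eta> = (\<lambda>x. \<sigma> (1 * (x - l)))"
  define \<eta>' where "\<eta>' = (\<lambda>x. 1 * \<sigma>' (1 * (x - l)))"
  define \<eta>'' where "\<eta>'' = (\<lambda>x. 1\<^sup>2 * \<sigma>'' (1 * (x - l)))"
  have C2: "C2_function \<eta> \<eta>' \<eta>''"
    unfolding \<eta>_def \<eta>'_def \<eta>''_def by (rule C2_function_affine[OF \<sigma>(1)])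
  note c\<eta> = C2_functionD(3-5)[OF C2]
  define A where "A x = complex_of_real (\<eta> x) * \<theta> x" for x
  define r where "r x = - 2 * complex_of_real (\<eta>' x) * \<theta>' x - complex_of_real (\<eta>'' x) * \<theta> x" for x
  define h where "h M x = A x + M * \<phi> x" for M x
  have cA: "continuous_on {l..} A" unfolding A_def by (intro continuous_intros c\<theta> c\<eta>)
  have cr: "continuous_on {l..} r" unfolding r_def
    by (intro continuous_intros c\<theta> c\<eta>)
  have ch: "continuous_on {l..} (h M)" for M unfolding h_def by (intro continuous_intros cA c\<phi>)
  have r0: "r x = 0" if "x \<ge> l + 1" for x using \<sigma>(4)[of "x - l"] that by (simp add: r_def \<eta>'_def \<eta>''_def)
  have io: "u integrable_on {a..c}" if "continuous_on {l..} u" "l \<le> a" for u :: "real \<Rightarrow> real" and a c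
    by (intro integrable_continuous_real continuous_on_subset[OF that(1)]) (use that in auto)
  have io': "u integrable_on {a..c}" if "continuous_on {l..} u" "l \<le> a" for u :: fn and a c
    by (intro integrable_continuous_real continuous_on_subset[OF that(1)]) (use that in auto)
  define R where "R = integral {l..l+1} (\<lambda>x. (cmod (r x))\<^sup>2)"
  \<comment> \<open>The right-hand side has the same norm on all intervals that are long enough.\<close>
  have Rb: "integral {l..b} (\<lambda>x. (cmod (r x))\<^sup>2) = R" if b: "b \<ge> l + 1" for b
  proof -
    have "integral {l..b} (\<lambda>x. (cmod (r x))\<^sup>2) = R + integral {l+1..b} (\<lambda>x. (cmod (r x))\<^sup>2)"
      unfolding R_def using b
      by (intro Henstock_Kurzweil_Integration.integral_combine[symmetric] io continuous_intros cr) auto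
    also have "integral {l+1..b} (\<lambda>x. (cmod (r x))\<^sup>2) = integral {l+1..b} (\<lambda>x. 0)"
      by (intro Henstock_Kurzweil_Integration.integral_cong) (simp add: r0)
    finally show ?thesis by simp
  qed
  have hb: "integral {l..b} (\<lambda>x. (cmod (h M x))\<^sup>2) \<le> R / lam\<^sup>2" if b: "b \<ge> l + 1" and 0: "\<theta> b + M * \<phi> b = 0" for b M
  proof -
    define f where "f x = complex_of_real (- lam) * h M x + r x" for x
    have "schr_eq q l (\<lambda>x. (\<eta> x * (complex_of_real (- lam) * \<theta> x) - 2 * complex_of_real (\<eta>' x) * \<theta>' x - \<eta>'' x * \<theta> x)
        + M * (complex_of_real (- lam) * \<phi> x)) (\<lambda>x. \<eta> x * \<theta> x + M * \<phi> x) (\<lambda>x. (\<eta>' x * \<theta> x + \<eta> x * \<theta>' x) + M * \<phi>' x)"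
      by (intro schr_eq_add schr_eq_cmult \<phi> schr_eq_mult_smooth[OF \<theta> C2])
    then have sh: "schr_eq q l f (h M) (\<lambda>x. (\<eta>' x * \<theta> x + \<eta> x * \<theta>' x) + M * \<phi>' x)"
      by (rule schr_eq_cong) (auto simp: f_def h_def A_def r_def algebra_simps)
    have cf: "continuous_on {l..} f" unfolding f_def by (intro continuous_intros ch cr)
    have hl: "h M l = 0" using \<sigma>(2)[of 0] \<phi>l by (simp add: h_def A_def \<eta>_def)
    have hbb: "h M b = 0" using \<sigma>(3)[of "b - l"] b 0 by (simp add: h_def A_def \<eta>_def)
    have lb: "l < b" using b by simp
    have "0 \<le> Re (integral {l..b} (\<lambda>x. f x * cnj (h M x)))"
      by (rule nonneg_dirichlet_interval[OF nonneg sh cf hl lb hbb])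
    also have "\<dots> = integral {l..b} (\<lambda>x. Re (f x * cnj (h M x)))"
      by (intro integral_Re_eq[symmetric] io' continuous_intros cf ch) auto
    also have "\<dots> \<le> integral {l..b} (\<lambda>x. - (lam / 2) * (cmod (h M x))\<^sup>2 + 1 / (2 * lam) * (cmod (r x))\<^sup>2)"
    proof (rule integral_le)
      fix x
      have e1: "f x * cnj (h M x) = complex_of_real (- lam * (cmod (h M x))\<^sup>2) + r x * cnj (h M x)"
        unfolding f_def of_real_mult complex_norm_square by (simp add: algebra_simps)
      have "Re (r x * cnj (h M x)) \<le> cmod (r x) * cmod (h M x)"
        by (metis complex_Re_le_cmod complex_mod_cnj norm_mult)
      also have "\<dots> \<le> lam / 2 * (cmod (h M x))\<^sup>2 + 1 / (2 * lam) * (cmod (r x))\<^sup>2"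
      proof -
        have "0 \<le> (lam * cmod (h M x) - cmod (r x))\<^sup>2 / (2 * lam)" using lam by simp
        also have "\<dots> = lam / 2 * (cmod (h M x))\<^sup>2 + 1 / (2 * lam) * (cmod (r x))\<^sup>2 - cmod (r x) * cmod (h M x)"
          using lam by (simp add: field_simps power2_eq_square)
        finally show ?thesis by simp
      qed
      finally show "Re (f x * cnj (h M x)) \<le> - (lam / 2) * (cmod (h M x))\<^sup>2 + 1 / (2 * lam) * (cmod (r x))\<^sup>2"
        unfolding e1 by simp
    qed (intro io continuous_intros cf ch cr order_refl)+
    also have "\<dots> = integral {l..b} (\<lambda>x. - (lam / 2) * (cmod (h M x))\<^sup>2) + integral {l..b} (\<lambda>x. 1 / (2 * lam) * (cmod (r x))\<^sup>2)"
      by (intro Henstock_Kurzweil_Integration.integral_add io continuous_intros ch cr order_refl)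
    also have "\<dots> = - (lam / 2) * integral {l..b} (\<lambda>x. (cmod (h M x))\<^sup>2) + 1 / (2 * lam) * R"
      by (simp only: Henstock_Kurzweil_Integration.integral_mult_right Rb[OF b])
    finally have "lam / 2 * integral {l..b} (\<lambda>x. (cmod (h M x))\<^sup>2) \<le> 1 / (2 * lam) * R" by simp
    then show ?thesis using lam by (simp add: field_simps power2_eq_square)
  qed
  \<comment> \<open>The right end points \<open>l + 1 + n\<close> lie beyond the support of \<open>r\<close>.\<close>
  define Mn where "Mn n = - \<theta> (l + 1 + real n) / \<phi> (l + 1 + real n)" for n
  define C where "C = R / lam\<^sup>2"
  have Mn: "\<theta> (l + 1 + real n) + Mn n * \<phi> (l + 1 + real n) = 0" for n
    using dirichlet_solution_nonzero[OF \<phi> \<phi>l lam, of "l + 1 + real n"] by (simp add: Mn_def)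
  have hc: "integral {l..c} (\<lambda>x. (cmod (h (Mn n) x))\<^sup>2) \<le> C" if "c \<le> l + 1 + real n" for c n
  proof -
    have "integral {l..c} (\<lambda>x. (cmod (h (Mn n) x))\<^sup>2) \<le> integral {l..l + 1 + real n} (\<lambda>x. (cmod (h (Mn n) x))\<^sup>2)"
      using that by (intro integral_subset_le io continuous_intros ch) auto
    also have "\<dots> \<le> C" unfolding C_def by (rule hb[OF _ Mn]) simp
    finally show ?thesis .
  qed
  define \<gamma> where "\<gamma> = integral {l..l+1} (\<lambda>x. (cmod (\<phi> x))\<^sup>2)"
  define \<alpha> where "\<alpha> = integral {l..l+1} (\<lambda>x. (cmod (A x))\<^sup>2)"
  have \<gamma>: "\<gamma> > 0" unfolding \<gamma>_def by (rule solution_norm_positive[OF \<phi> \<phi>l(2)]) simp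
  have "(cmod (Mn n))\<^sup>2 * \<gamma> \<le> 2 * C + 2 * \<alpha>" for n
  proof -
    have "(cmod (Mn n))\<^sup>2 * \<gamma> = integral {l..l+1} (\<lambda>x. (cmod (Mn n))\<^sup>2 * (cmod (\<phi> x))\<^sup>2)"
      unfolding \<gamma>_def by simp
    also have "\<dots> \<le> integral {l..l+1} (\<lambda>x. 2 * (cmod (h (Mn n) x))\<^sup>2 + 2 * (cmod (A x))\<^sup>2)"
    proof (rule integral_le)
      fix x
      have "Mn n * \<phi> x = h (Mn n) x - A x" by (simp add: h_def)
      then have "cmod (Mn n) * cmod (\<phi> x) \<le> cmod (h (Mn n) x) + cmod (A x)"
        by (metis norm_mult norm_triangle_ineq4)
      then have "(cmod (Mn n) * cmod (\<phi> x))\<^sup>2 \<le> (cmod (h (Mn n) x) + cmod (A x))\<^sup>2"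
        by (intro power_mono) auto
      then show "(cmod (Mn n))\<^sup>2 * (cmod (\<phi> x))\<^sup>2 \<le> 2 * (cmod (h (Mn n) x))\<^sup>2 + 2 * (cmod (A x))\<^sup>2"
        using sum_squares_bound[of "cmod (h (Mn n) x)" "cmod (A x)"]
        by (simp add: power_mult_distrib power2_sum)
    qed (intro io continuous_intros ch cA c\<phi> order_refl)+
    also have "\<dots> = 2 * integral {l..l+1} (\<lambda>x. (cmod (h (Mn n) x))\<^sup>2) + 2 * \<alpha>"
      unfolding \<alpha>_def by (subst Henstock_Kurzweil_Integration.integral_add) (auto intro!: io continuous_intros ch cA)
    also have "\<dots> \<le> 2 * C + 2 * \<alpha>" using hc[of "l+1" n] by simp
    finally show ?thesis .
  qed
  then have "(cmod (Mn n))\<^sup>2 \<le> (2 * C + 2 * \<alpha>) / \<gamma>" for n using \<gamma> by (simp add: field_simps)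
  then have "cmod (Mn n) \<le> sqrt ((2 * C + 2 * \<alpha>) / \<gamma>)" for n by (rule real_le_rsqrt)
  then have "\<forall>n. Mn n \<in> cball 0 (sqrt ((2 * C + 2 * \<alpha>) / \<gamma>))" by simp
  then obtain M s where M: "strict_mono (s :: nat \<Rightarrow> nat)" "(Mn \<circ> s) \<longlonglongrightarrow> M"
    using compact_cball[of "0::complex" "sqrt ((2 * C + 2 * \<alpha>) / \<gamma>)"] unfolding compact_def by blast
  have "h M \<in> L2 l"
  proof (rule L2_of_bounded_integrals[OF ch])
    fix c assume c: "c \<ge> l"
    define a where "a = integral {l..c} (\<lambda>x. (cmod (A x))\<^sup>2)"
    define b where "b = integral {l..c} (\<lambda>x. A x * cnj (\<phi> x))"
    define d where "d = integral {l..c} (\<lambda>x. (cmod (\<phi> x))\<^sup>2)"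
    \<comment> \<open>The norm on \<open>[l, c]\<close> is a polynomial in the coefficient and its conjugate, hence continuous in it.\<close>
    have Q: "integral {l..c} (\<lambda>x. (cmod (h M x))\<^sup>2) = a + 2 * Re (cnj M * b) + (cmod M)\<^sup>2 * d" for M
    proof -
      have "(cmod (h M x))\<^sup>2 = (cmod (A x))\<^sup>2 + 2 * Re (cnj M * (A x * cnj (\<phi> x))) + (cmod M)\<^sup>2 * (cmod (\<phi> x))\<^sup>2" for x
        unfolding h_def cmod_power2 by (simp add: algebra_simps power2_eq_square)
      moreover have "((\<lambda>x. (cmod (A x))\<^sup>2 + 2 * Re (cnj M * (A x * cnj (\<phi> x))) + (cmod M)\<^sup>2 * (cmod (\<phi> x))\<^sup>2)
          has_integral (a + 2 * Re (cnj M * b) + (cmod M)\<^sup>2 * d)) {l..c}"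
        unfolding a_def b_def d_def
        by (intro has_integral_add has_integral_mult_right has_integral_Re integrable_integral io io' continuous_intros cA c\<phi> order_refl)
      ultimately show ?thesis by (simp add: integral_unique)
    qed
    have "(\<lambda>n. a + 2 * Re (cnj ((Mn \<circ> s) n) * b) + (cmod ((Mn \<circ> s) n))\<^sup>2 * d) \<longlonglongrightarrow> a + 2 * Re (cnj M * b) + (cmod M)\<^sup>2 * d"
      by (intro tendsto_intros M(2))
    moreover obtain N :: nat where N: "c \<le> l + 1 + real N" using real_arch_simple[of "c - l - 1"] by (auto simp: algebra_simps)
    have "a + 2 * Re (cnj ((Mn \<circ> s) n) * b) + (cmod ((Mn \<circ> s) n))\<^sup>2 * d \<le> C" if n: "n \<ge> N" for n
    proof -
      have "real n \<le> real (s n)" using seq_suble[OF M(1)] by simp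
      then have "c \<le> l + 1 + real (s n)" using N n by (smt (verit) of_nat_le_iff)
      from hc[OF this] show ?thesis by (simp add: Q)
    qed
    ultimately have "a + 2 * Re (cnj M * b) + (cmod M)\<^sup>2 * d \<le> C"
      by (intro LIMSEQ_le_const2) auto
    then show "integral {l..c} (\<lambda>x. (cmod (h M x))\<^sup>2) \<le> C" by (simp add: Q)
  qed
  moreover have "(\<lambda>x. \<theta> x - A x) \<in> L2 l"
  proof (rule L2_compact_support[of _ _ "l + 1"])
    show "continuous_on {l..} (\<lambda>x. \<theta> x - A x)" by (intro continuous_intros c\<theta> cA)
    show "\<theta> x - A x = 0" if "x > l + 1" for x using \<sigma>(3)[of "x - l"] that by (simp add: A_def \<eta>_def)
  qed
  ultimately have "(\<lambda>x. h M x + (\<theta> x - A x)) \<in> L2 l" by (rule L2_add)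
  then show ?thesis by (intro exI[of _ M]) (simp add: h_def algebra_simps)
qed

text \<open>The description of \<^const>\<open>m_inf\<close> determines a number: two different coefficients would give two square
  integrable solutions with a constant nonzero Wronskian, which the limit point case excludes.\<close>

lemma weyl_solution:
  assumes lam: "lam > 0"
  defines "z \<equiv> complex_of_real (- lam)"
  obtains \<psi> \<psi>' where "max_elem q l (\<lambda>x. z * \<psi> x) \<psi> \<psi>'" "\<psi> l = 1" "\<psi>' l = - m_inf q l z" "\<And>x. x < l \<Longrightarrow> \<psi> x = 0"
proof -
  let ?p1 = "phi1 q l z" and ?p2 = "phi2 q l z"
  note p1 = phi1_solves_ivp[OF q, where z=z] and p2 = phi2_solves_ivp[OF q, where z=z]
  have comb: "max_elem q l (\<lambda>x. z * (?p2 x + m * ?p1 x)) (\<lambda>x. ?p2 x + m * ?p1 x) (\<lambda>x. hderiv l ?p2 x + m * hderiv l ?p1 x)"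
    if "(\<lambda>x. ?p2 x + m * ?p1 x) \<in> L2 l" for m
  proof -
    have "schr_eq q l (\<lambda>x. z * ?p2 x + m * (z * ?p1 x)) (\<lambda>x. ?p2 x + m * ?p1 x) (\<lambda>x. hderiv l ?p2 x + m * hderiv l ?p1 x)"
      by (intro schr_eq_add schr_eq_cmult p1 p2)
    then show ?thesis using that L2_cmult[OF that, of z] by (simp add: max_elem_def algebra_simps)
  qed
  have uniq: "m = n" if m: "(\<lambda>x. ?p2 x + m * ?p1 x) \<in> L2 l" and n: "(\<lambda>x. ?p2 x + n * ?p1 x) \<in> L2 l" for m n
  proof -
    note W = limit_point_wronskian[OF q deficiency comb[OF m] comb[OF n]] wronskian_limit[OF comb[OF m] comb[OF n]]
    have "(\<lambda>x. z * (?p2 x + m * ?p1 x) * (?p2 x + n * ?p1 x) - (?p2 x + m * ?p1 x) * (z * (?p2 x + n * ?p1 x))) = (\<lambda>x. 0)"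
      by (simp add: algebra_simps)
    with tendsto_unique[OF _ W(1) W(2)] p1(2,3) p2(2,3) show ?thesis by simp
  qed
  obtain M where "(\<lambda>x. ?p2 x + M * ?p1 x) \<in> L2 l"
    using weyl_solution_exists[OF p1(1)[unfolded z_def] _ _ p2(1)[unfolded z_def] lam] p1(2,3) by (auto simp: z_def)
  then have "\<exists>!m. (\<lambda>x. ?p2 x + m * ?p1 x) \<in> L2 l" using uniq by blast
  then have m: "(\<lambda>x. ?p2 x + m_inf q l z * ?p1 x) \<in> L2 l" unfolding m_inf_def by (rule theI')
  show ?thesis
  proof (rule that)
    show "max_elem q l (\<lambda>x. z * ((-1) * (?p2 x + m_inf q l z * ?p1 x))) (\<lambda>x. (-1) * (?p2 x + m_inf q l z * ?p1 x))
       (\<lambda>x. (-1) * (hderiv l ?p2 x + m_inf q l z * hderiv l ?p1 x))"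
      using max_elem_cmult[OF comb[OF m], of "-1"] by (simp add: algebra_simps)
  qed (use p1 p2 in auto)
qed

section \<open>The infimum of the form for given boundary values\<close>

text \<open>Since \<open>\<psi>\<close> is annihilated by the expression plus \<open>lam\<close>, Green's formula reduces the mixed term of \<open>h\<close> and \<open>\<psi>\<close> to the
  boundary value \<open>h' l\<close>, and the form splits into a boundary part and the form of \<open>h\<close>.\<close>

lemma form_decomposition:
  fixes a :: complex
  assumes \<psi>: "max_elem q l (\<lambda>x. complex_of_real (- lam) * \<psi> x) \<psi> \<psi>'" and \<psi>l: "\<psi> l = 1"
    and h: "max_elem q l g h h'" and hl: "h l = 0"
  defines "y \<equiv> \<lambda>x. h x + a * \<psi> x" and "f \<equiv> \<lambda>x. g x + a * (complex_of_real (- lam) * \<psi> x)"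
  shows "Re (ip l f y) + lam * Re (ip l y y) =
     Re ((h' l + a * \<psi>' l) * cnj a) - Re (\<psi>' l) * (cmod a)\<^sup>2 + Re (ip l g h) + lam * Re (ip l h h)"
proof -
  have L: "\<psi> \<in> L2 l" "h \<in> L2 l" "g \<in> L2 l" using \<psi> h by (auto simp: max_elem_def)
  have yL: "y \<in> L2 l" unfolding y_def by (intro L2_add L2_cmult L)
  have fL: "f \<in> L2 l" unfolding f_def by (intro L2_add L2_cmult L)
  define G where "G x = g x + complex_of_real lam * h x" for x
  have GL: "G \<in> L2 l" unfolding G_def by (intro L2_add L2_cmult L)
  have Gf: "G = (\<lambda>x. f x + complex_of_real lam * y x)"
    by (auto simp: G_def f_def y_def algebra_simps)
  have "ip l f y + complex_of_real lam * ip l y y = ip l G y"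
    unfolding Gf by (simp only: ip_add_left[OF fL L2_cmult[OF yL] yL] ip_cmult_left)
  also have "\<dots> = ip l G h + cnj a * ip l G \<psi>"
    unfolding y_def by (simp only: ip_add_right[OF L(2) L2_cmult[OF L(1)] GL] ip_cmult_right)
  also have "ip l G h = ip l g h + complex_of_real lam * ip l h h"
    unfolding G_def by (simp only: ip_add_left[OF L(3) L2_cmult[OF L(2)] L(2)] ip_cmult_left)
  also have "ip l G \<psi> = ip l g \<psi> + complex_of_real lam * ip l h \<psi>"
    unfolding G_def by (simp only: ip_add_left[OF L(3) L2_cmult[OF L(2)] L(1)] ip_cmult_left)
  also have "\<dots> = h' l"
    using green[OF q deficiency h \<psi>] unfolding ip_cmult_right hl \<psi>l by simp
  finally have "Re (ip l f y + complex_of_real lam * ip l y y) = Re (ip l g h + complex_of_real lam * ip l h h + cnj a * h' l)" by simp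
  moreover have "Re ((h' l + a * \<psi>' l) * cnj a) - Re (\<psi>' l) * (cmod a)\<^sup>2 = Re (cnj a * h' l)"
  proof -
    have "(h' l + a * \<psi>' l) * cnj a = cnj a * h' l + \<psi>' l * complex_of_real ((cmod a)\<^sup>2)"
      unfolding complex_norm_square by (simp add: algebra_simps)
    then show ?thesis by simp
  qed
  ultimately show ?thesis by simp
qed

lemma form_lower_bound_neg:
  assumes lam: "lam > 0" and y: "max_elem q l f y y'"
  shows "Re (y' l * cnj (y l)) + Re (m_inf q l (complex_of_real (- lam))) * (cmod (y l))\<^sup>2 - lam * Re (ip l y y) \<le> Re (ip l f y)"
proof -
  obtain \<psi> \<psi>' where \<psi>: "max_elem q l (\<lambda>x. complex_of_real (- lam) * \<psi> x) \<psi> \<psi>'" "\<psi> l = 1"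
      "\<psi>' l = - m_inf q l (complex_of_real (- lam))"
    using weyl_solution[OF lam] by metis
  define a where "a = y l"
  have h: "max_elem q l (\<lambda>x. f x + (-a) * (complex_of_real (- lam) * \<psi> x)) (\<lambda>x. y x + (-a) * \<psi> x) (\<lambda>x. y' x + (-a) * \<psi>' x)"
    by (intro max_elem_add max_elem_cmult y \<psi>)
  have hl: "y l + (-a) * \<psi> l = 0" using \<psi> by (simp add: a_def)
  have "0 \<le> Re (ip l (\<lambda>x. f x + (-a) * (complex_of_real (- lam) * \<psi> x)) (\<lambda>x. y x + (-a) * \<psi> x))"
    using nonneg_dirichlet[OF nonneg h hl] .
  moreover have "0 \<le> lam * Re (ip l (\<lambda>x. y x + (-a) * \<psi> x) (\<lambda>x. y x + (-a) * \<psi> x))"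
    using lam ip_self_nonneg by simp
  moreover have "(\<lambda>x. y x + (-a) * \<psi> x + a * \<psi> x) = y" "(\<lambda>x. f x + (-a) * (complex_of_real (- lam) * \<psi> x) + a * (complex_of_real (- lam) * \<psi> x)) = f"
    by auto
  ultimately show ?thesis
    using form_decomposition[OF \<psi>(1,2) h hl, of a] \<psi>(3) by (simp add: a_def)
qed

text \<open>For \<open>lam > 0\<close> the part \<open>h = y - y l * \<psi>\<close> has nonnegative form; then \<open>lam\<close> tends to \<open>0\<close>.\<close>

lemma form_lower_bound:
  assumes m0: "((\<lambda>x. m_inf q l (complex_of_real x)) \<longlongrightarrow> complex_of_real m\<^sub>0) (at_left 0)"
    and y: "max_elem q l f y y'"
  shows "Re (y' l * cnj (y l)) + m\<^sub>0 * (cmod (y l))\<^sup>2 \<le> Re (ip l f y)"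
proof -
  have "((\<lambda>x. Re (y' l * cnj (y l)) + Re (m_inf q l (complex_of_real x)) * (cmod (y l))\<^sup>2 + x * Re (ip l y y)) \<longlongrightarrow>
     Re (y' l * cnj (y l)) + Re (complex_of_real m\<^sub>0) * (cmod (y l))\<^sup>2 + 0 * Re (ip l y y)) (at_left 0)"
    by (intro tendsto_intros m0)
  moreover have "\<forall>\<^sub>F x in at_left 0. Re (y' l * cnj (y l)) + Re (m_inf q l (complex_of_real x)) * (cmod (y l))\<^sup>2 + x * Re (ip l y y) \<le> Re (ip l f y)"
  proof -
    have "Re (y' l * cnj (y l)) + Re (m_inf q l (complex_of_real x)) * (cmod (y l))\<^sup>2 + x * Re (ip l y y) \<le> Re (ip l f y)"
      if "x < 0" for x
      using form_lower_bound_neg[OF _ y, of "- x"] that by simp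
    then show ?thesis by (auto simp: eventually_at_filter)
  qed
  ultimately show ?thesis
    using tendsto_upperbound[of _ _ "at_left (0::real)"] by (simp add: trivial_limit_at_left_real)
qed

text \<open>The form does not control the derivative at \<open>l\<close>: near \<open>l\<close> the solution \<open>\<phi>\<close> with initial data \<open>(0, 1)\<close> behaves like
  \<open>x - l\<close>, and it is cut off over the length \<open>1 / N\<close>.\<close>

lemma small_form_elements:
  assumes "\<delta> > 0"
  obtains k k' g where "max_elem q l g k k'" "k l = 0" "k' l = 1" "\<And>x. x < l \<Longrightarrow> k x = 0"
    "Re (ip l g k) \<le> \<delta>" "Re (ip l k k) \<le> \<delta>"
proof -
  obtain \<phi> \<phi>' where \<phi>0: "schr_eq q l (\<lambda>x. 0 * \<phi> x) \<phi> \<phi>'" "\<phi> l = 0" "\<phi>' l = 1" "\<And>x. x < l \<Longrightarrow> \<phi> x = 0"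
    using schr_eq_exists[OF q, where z = 0 and a = 0 and b = 1] by metis
  then have \<phi>: "schr_eq q l (\<lambda>x. 0) \<phi> \<phi>'" by simp
  note c\<phi> = schr_eq_continuous[OF \<phi>]
  obtain \<sigma> \<sigma>' \<sigma>'' K where "smooth_step \<sigma> \<sigma>' \<sigma>'' K" using smooth_step_exists by blast
  note \<sigma> = smooth_stepD[OF this]
  obtain H where H: "H \<ge> 0" "\<And>x. x \<in> {l..l+1} \<Longrightarrow> cmod (\<phi>' x) \<le> H"
    "\<And>x y. l \<le> x \<Longrightarrow> x \<le> y \<Longrightarrow> y \<le> l+1 \<Longrightarrow> cmod (\<phi> y - \<phi> x) \<le> H * (y - x)"
    using derivative_bounds[OF \<phi>, of "l+1"] by auto
  define B where "B = 3 * (K + 1)\<^sup>2 * H\<^sup>2"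
  have B0: "B \<ge> 0" by (simp add: B_def)
  obtain n :: nat where n: "B / \<delta> + 1 \<le> real n" using real_arch_simple by blast
  define N where "N = real n"
  have "B / \<delta> \<ge> 0" using B0 assms by simp
  then have N: "N \<ge> 1" "B / \<delta> \<le> N" using n by (auto simp: N_def)
  have BN: "B / N \<le> \<delta>" using N assms by (simp add: field_simps)
  define \<eta> where "\<eta> = (\<lambda>x. 1 - \<sigma> (N * (x - l)))"
  define \<eta>' where "\<eta>' = (\<lambda>x. - (N * \<sigma>' (N * (x - l))))"
  define \<eta>'' where "\<eta>'' = (\<lambda>x. - (N\<^sup>2 * \<sigma>'' (N * (x - l))))"
  have C2: "C2_function \<eta> \<eta>' \<eta>''"
    unfolding \<eta>_def \<eta>'_def \<eta>''_def by (intro C2_function_complement C2_function_affine \<sigma>(1))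
  note c\<eta> = C2_functionD(3-5)[OF C2]
  have far: "\<eta> x = 0" "\<eta>' x = 0" "\<eta>'' x = 0" if "x > l + 1 / N" for x
  proof -
    have "N * (x - l) \<ge> 1" using that N by (simp add: field_simps)
    then show "\<eta> x = 0" "\<eta>' x = 0" "\<eta>'' x = 0" using \<sigma>(3,4) by (auto simp: \<eta>_def \<eta>'_def \<eta>''_def)
  qed
  define k where "k x = complex_of_real (\<eta> x) * \<phi> x" for x
  define k' where "k' x = complex_of_real (\<eta>' x) * \<phi> x + complex_of_real (\<eta> x) * \<phi>' x" for x
  define g where "g x = complex_of_real (\<eta> x) * 0 - 2 * complex_of_real (\<eta>' x) * \<phi>' x - complex_of_real (\<eta>'' x) * \<phi> x" for x
  have sk: "schr_eq q l g k k'" unfolding g_def k_def k'_def by (rule schr_eq_mult_smooth[OF \<phi> C2])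
  have ck: "continuous_on {l..} k" unfolding k_def by (intro continuous_intros c\<phi> c\<eta>)
  have cg: "continuous_on {l..} g" unfolding g_def
    by (intro continuous_intros c\<phi> c\<eta>)
  have kL: "k \<in> L2 l" by (rule L2_compact_support[OF ck, of "l + 1/N"]) (simp add: k_def far)
  have gL: "g \<in> L2 l" by (rule L2_compact_support[OF cg, of "l + 1/N"]) (simp add: g_def far)
  have n1: "l + 1 / N \<le> l + 1" using N by simp
  have \<eta>b: "\<bar>\<eta> x\<bar> \<le> K + 1" for x using \<sigma>(6)[of "N * (x - l)"] by (simp add: \<eta>_def)
  have \<phi>b: "cmod (\<phi> x) \<le> H / N" if x: "x \<in> {l..l+1/N}" for x
  proof -
    have "cmod (\<phi> x - \<phi> l) \<le> H * (x - l)" using x n1 by (intro H(3)) auto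
    also have "\<dots> \<le> H * (1 / N)" using x H(1) by (intro mult_left_mono) auto
    finally show ?thesis using \<phi>0(2) by simp
  qed
  have "ip l g k = integral {l..l + 1/N} (\<lambda>x. g x * cnj (k x))"
    unfolding ip_def by (intro lebesgue_integral_eq_integral_support L2_integrable_mult_cnj gL kL) (simp add: k_def far)
  moreover have "cmod (integral {l..l + 1/N} (\<lambda>x. (complex_of_real (\<eta> x) * 0 - 2 * complex_of_real (\<eta>' x) * \<phi>' x - \<eta>'' x * \<phi> x) * cnj (\<eta> x * \<phi> x) - 0 * cnj (\<phi> x)))
      \<le> (((K+1)\<^sup>2 + 1) * H * 0 + 3 * (K+1)\<^sup>2 * H\<^sup>2) / N"
  proof (rule cutoff_error[where f = "\<lambda>_. 0"])
    have "(\<lambda>x. g x * cnj (k x)) integrable_on {l..l+1/N}"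
      by (intro integrable_continuous_real continuous_intros continuous_on_subset[OF cg] continuous_on_subset[OF ck]) auto
    then show "(\<lambda>x. (complex_of_real (\<eta> x) * 0 - 2 * complex_of_real (\<eta>' x) * \<phi>' x - \<eta>'' x * \<phi> x) * cnj (\<eta> x * \<phi> x) - 0 * cnj (\<phi> x)) integrable_on {l..l+1/N}"
      by (simp add: g_def[abs_def] k_def[abs_def])
    show "\<bar>\<eta>' x\<bar> \<le> (K + 1) * N" for x
      using \<sigma>(7)[of "N * (x - l)"] N by (simp add: \<eta>'_def abs_mult mult.commute mult_right_mono)
    show "\<bar>\<eta>'' x\<bar> \<le> (K + 1) * N\<^sup>2" for x
      using \<sigma>(8)[of "N * (x - l)"] N by (simp add: \<eta>''_def abs_mult mult.commute mult_left_mono)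
    show "cmod (\<phi>' x) \<le> H" if x: "x \<in> {l..l+1/N}" for x using x n1 by (intro H(2)) auto
  qed (use N \<sigma>(5) H \<eta>b \<phi>b in auto)
  ultimately have "cmod (ip l g k) \<le> B / N" by (simp add: g_def[abs_def] k_def[abs_def] B_def)
  then have f1: "Re (ip l g k) \<le> \<delta>" using complex_Re_le_cmod[of "ip l g k"] BN by linarith
  have "ip l k k = integral {l..l + 1/N} (\<lambda>x. k x * cnj (k x))"
    unfolding ip_def by (intro lebesgue_integral_eq_integral_support L2_integrable_mult_cnj kL) (simp add: k_def far)
  also have "cmod \<dots> \<le> integral {l..l + 1/N} (\<lambda>_. B)"
  proof (rule integral_norm_bound_integral)
    show "(\<lambda>x. k x * cnj (k x)) integrable_on {l..l+1/N}"
      by (intro integrable_continuous_real continuous_intros continuous_on_subset[OF ck]) auto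
    fix x assume x: "x \<in> {l..l+1/N}"
    have "H / N \<le> H" using mult_left_mono[OF N(1) H(1)] N by (simp add: divide_le_eq)
    then have "cmod (k x) \<le> (K + 1) * H"
      unfolding k_def norm_mult norm_of_real using \<eta>b[of x] \<phi>b[OF x] \<sigma>(5) by (intro mult_mono) auto
    then have "cmod (k x) * cmod (k x) \<le> ((K + 1) * H) * ((K + 1) * H)" by (intro mult_mono) (use \<sigma>(5) H in auto)
    also have "\<dots> = (K + 1)\<^sup>2 * H\<^sup>2" by (simp add: power2_eq_square)
    also have "\<dots> \<le> B" unfolding B_def using zero_le_power2[of "(K + 1) * H"]
      by (simp add: power_mult_distrib)
    finally show "cmod (k x * cnj (k x)) \<le> B" by (simp add: norm_mult)
  qed auto
  also have "\<dots> = B / N" using N by simp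
  finally have f2: "Re (ip l k k) \<le> \<delta>" using complex_Re_le_cmod[of "ip l k k"] BN by linarith
  show ?thesis
  proof (rule that[OF _ _ _ _ f1 f2])
    show "max_elem q l g k k'" using sk kL gL by (simp add: max_elem_def)
    show "k l = 0" "k' l = 1" "\<And>x. x < l \<Longrightarrow> k x = 0"
      using \<phi>0 \<sigma>(2)[of 0] by (auto simp: k_def k'_def \<eta>_def)
  qed
qed

text \<open>The lower bound is attained in the limit by \<open>a * \<psi>\<close> for small \<open>lam\<close>, corrected by a function of small form that
  adjusts the derivative at \<open>l\<close>.\<close>

lemma form_sharp:
  assumes m0: "((\<lambda>x. m_inf q l (complex_of_real x)) \<longlongrightarrow> complex_of_real m\<^sub>0) (at_left 0)"
    and e: "e > 0"
  obtains y where "y \<in> Hplus q l" "y l = a" "hderiv l y l = b"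
    "Re (ip l (schr q l y) y) \<le> Re (b * cnj a) + m\<^sub>0 * (cmod a)\<^sup>2 + e"
proof -
  have half: "x / (2 * P) * P = x / 2" if "P > 0" for x P :: real using that by simp
  define e1 where "e1 = e / (2 * ((cmod a)\<^sup>2 + 1))"
  have pa: "(cmod a)\<^sup>2 + 1 > 0" by (simp add: add_nonneg_pos)
  have e1: "e1 > 0" using e pa by (simp add: e1_def)
  have e1a: "e1 * (cmod a)\<^sup>2 \<le> e / 2"
  proof -
    have "e1 * (cmod a)\<^sup>2 \<le> e1 * ((cmod a)\<^sup>2 + 1)" using e1 by simp
    also have "\<dots> = e / 2" unfolding e1_def by (rule half[OF pa])
    finally show ?thesis .
  qed
  have "((\<lambda>x. Re (m_inf q l (complex_of_real x))) \<longlongrightarrow> Re (complex_of_real m\<^sub>0)) (at_left 0)" by (intro tendsto_intros m0)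
  then have "\<forall>\<^sub>F x in at_left 0. Re (m_inf q l (complex_of_real x)) < m\<^sub>0 + e1"
    using e1 by (intro order_tendstoD(2)[of _ m\<^sub>0]) auto
  moreover have "\<forall>\<^sub>F x in at_left (0::real). x < 0" by (simp add: eventually_at_filter)
  ultimately have "\<forall>\<^sub>F x in at_left (0::real). x < 0 \<and> Re (m_inf q l (complex_of_real x)) < m\<^sub>0 + e1"
    by eventually_elim simp
  then obtain x where x: "x < 0" "Re (m_inf q l (complex_of_real x)) < m\<^sub>0 + e1"
    using eventually_happens'[OF trivial_limit_at_left_real] by blast
  define lam where "lam = - x"
  have lam: "lam > 0" "Re (m_inf q l (complex_of_real (- lam))) < m\<^sub>0 + e1" using x by (auto simp: lam_def)
  obtain \<psi> \<psi>' where \<psi>: "max_elem q l (\<lambda>x. complex_of_real (- lam) * \<psi> x) \<psi> \<psi>'" "\<psi> l = 1"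
      "\<psi>' l = - m_inf q l (complex_of_real (- lam))" "\<And>x. x < l \<Longrightarrow> \<psi> x = 0"
    using weyl_solution[OF lam(1)] by metis
  define c where "c = b - a * \<psi>' l"
  define \<delta> where "\<delta> = e / (2 * ((cmod c)\<^sup>2 * (1 + lam) + 1))"
  have pc: "(cmod c)\<^sup>2 * (1 + lam) + 1 > 0" using lam by (simp add: add_nonneg_pos)
  have \<delta>: "\<delta> > 0" using e pc by (simp add: \<delta>_def)
  have \<delta>c: "(cmod c)\<^sup>2 * (\<delta> + lam * \<delta>) \<le> e / 2"
  proof -
    have "(cmod c)\<^sup>2 * (\<delta> + lam * \<delta>) \<le> \<delta> * ((cmod c)\<^sup>2 * (1 + lam) + 1)" using \<delta> by (simp add: algebra_simps)
    also have "\<dots> = e / 2" unfolding \<delta>_def by (rule half[OF pc])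
    finally show ?thesis .
  qed
  obtain k k' g where k: "max_elem q l g k k'" "k l = 0" "k' l = 1" "\<And>x. x < l \<Longrightarrow> k x = 0"
    "Re (ip l g k) \<le> \<delta>" "Re (ip l k k) \<le> \<delta>" using small_form_elements[OF \<delta>] by metis
  have h: "max_elem q l (\<lambda>x. c * g x) (\<lambda>x. c * k x) (\<lambda>x. c * k' x)" by (rule max_elem_cmult[OF k(1)])
  define y where "y x = c * k x + a * \<psi> x" for x
  define f where "f x = c * g x + a * (complex_of_real (- lam) * \<psi> x)" for x
  have y: "max_elem q l f y (\<lambda>x. c * k' x + a * \<psi>' x)"
    unfolding f_def y_def by (intro max_elem_add max_elem_cmult k \<psi>)
  have y0: "y x = 0" if "x < l" for x using k(4) \<psi>(4) that by (simp add: y_def)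
  have bl: "c * k' l + a * \<psi>' l = b" using k(3) by (simp add: c_def)
  have ck: "c * k l = 0" using k(2) by simp
  have "Re (ip l f y) + lam * Re (ip l y y) = Re (b * cnj a) - Re (\<psi>' l) * (cmod a)\<^sup>2
      + Re (ip l (\<lambda>x. c * g x) (\<lambda>x. c * k x)) + lam * Re (ip l (\<lambda>x. c * k x) (\<lambda>x. c * k x))"
    using form_decomposition[OF \<psi>(1,2) h ck, of a] unfolding bl by (simp add: y_def[abs_def] f_def[abs_def])
  also have "ip l (\<lambda>x. c * g x) (\<lambda>x. c * k x) = complex_of_real ((cmod c)\<^sup>2) * ip l g k"
    by (simp only: ip_cmult_left ip_cmult_right complex_norm_square mult.assoc)
  also have "ip l (\<lambda>x. c * k x) (\<lambda>x. c * k x) = complex_of_real ((cmod c)\<^sup>2) * ip l k k"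
    by (simp only: ip_cmult_left ip_cmult_right complex_norm_square mult.assoc)
  also have "Re (complex_of_real ((cmod c)\<^sup>2) * ip l g k) = (cmod c)\<^sup>2 * Re (ip l g k)" by simp
  also have "Re (complex_of_real ((cmod c)\<^sup>2) * ip l k k) = (cmod c)\<^sup>2 * Re (ip l k k)" by simp
  finally have eq: "Re (ip l f y) + lam * Re (ip l y y) = Re (b * cnj a) - Re (\<psi>' l) * (cmod a)\<^sup>2
      + (cmod c)\<^sup>2 * Re (ip l g k) + lam * ((cmod c)\<^sup>2 * Re (ip l k k))" .
  have 1: "(cmod c)\<^sup>2 * Re (ip l g k) \<le> (cmod c)\<^sup>2 * \<delta>" using k(5) by (intro mult_left_mono) auto
  have 2: "lam * ((cmod c)\<^sup>2 * Re (ip l k k)) \<le> lam * ((cmod c)\<^sup>2 * \<delta>)" using k(6) lam(1) by (intro mult_left_mono) auto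
  have 3: "- Re (\<psi>' l) * (cmod a)\<^sup>2 \<le> (m\<^sub>0 + e1) * (cmod a)\<^sup>2" using lam(2) \<psi>(3) by (intro mult_right_mono) auto
  have 4: "0 \<le> lam * Re (ip l y y)" using lam(1) ip_self_nonneg by simp
  have "(cmod c)\<^sup>2 * \<delta> + lam * ((cmod c)\<^sup>2 * \<delta>) \<le> e / 2" using \<delta>c by (simp add: algebra_simps)
  moreover have "(m\<^sub>0 + e1) * (cmod a)\<^sup>2 \<le> m\<^sub>0 * (cmod a)\<^sup>2 + e / 2" using e1a by (simp add: algebra_simps)
  ultimately have fin: "Re (ip l f y) \<le> Re (b * cnj a) + m\<^sub>0 * (cmod a)\<^sup>2 + e"
    using eq 1 2 3 4 by simp
  have fy: "f \<in> L2 l" "y \<in> L2 l" using y by (auto simp: max_elem_def)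
  show ?thesis
  proof (rule that)
    show "y \<in> Hplus q l" using max_elem_imp_Hplus(1)[OF y y0] .
    show "y l = a" using k(2) \<psi>(2) by (simp add: y_def)
    show "hderiv l y l = b" using max_elem_imp_Hplus(2)[OF y y0, of l] bl by simp
    show "Re (ip l (schr q l y) y) \<le> Re (b * cnj a) + m\<^sub>0 * (cmod a)\<^sup>2 + e"
      using ip_AE_cong[OF max_elem_imp_Hplus(3)[OF y y0] fy] fin by simp
  qed
qed

end

section \<open>The associated operator\<close>

lemma (in nonneg_limit_point) Im_form_eq_boundary:
  assumes y: "y \<in> Hplus q l"
  shows "Im (ip l (schr q l y) y) = Im (hderiv l y l * cnj (y l))"
proof -
  note m = Hplus_imp_max_elem[OF y q]
  have "ip l (schr q l y) y - cnj (ip l (schr q l y) y) = hderiv l y l * cnj (y l) - cnj (hderiv l y l * cnj (y l))"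
    using green[OF q deficiency m m] by (simp add: ip_cnj mult.commute)
  moreover have "Im z = Im w" if "z - cnj z = w - cnj w" for z w :: complex
    using arg_cong[OF that, of Im] by simp
  ultimately show ?thesis by blast
qed

lemma assoc_op_diag:
  "assoc_op q l (schr_system q l \<mu>) y y = cnj (ip l (schr q l y) y) + (max_op q l y y - A_op q l \<mu> y y)"
  by (simp add: assoc_op_def Re_op_def adj_def schr_system_def max_op_def emb_H_def)

lemma assoc_op_diag_real:
  fixes y :: fn and l m :: real and a b :: complex
  defines "a \<equiv> y l" and "b \<equiv> hderiv l y l"
  shows "assoc_op q l (schr_system q l (ereal m)) y y
    = cnj (ip l (schr q l y) y) + (b - \<i> * a) * (m * cnj a - cnj b) / (complex_of_real m - \<i>)"
  unfolding assoc_op_diag by (simp add: A_op_def delta_def delta'_def a_def b_def)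

lemma assoc_op_diag_infinity:
  "assoc_op q l (schr_system q l \<infinity>) y y
    = cnj (ip l (schr q l y) y) + (hderiv l y l - \<i> * y l) * cnj (y l)"
  unfolding assoc_op_diag by (simp add: A_op_def delta_def)

lemma boundary_term:
  fixes a b :: complex and m :: real
  shows "Re ((b - \<i> * a) * (m * cnj a - cnj b) / (complex_of_real m - \<i>)) =
      ((m\<^sup>2 - 1) * Re (b * cnj a) + m * (cmod a)\<^sup>2 - m * (cmod b)\<^sup>2) / (m\<^sup>2 + 1)"
    "Im ((b - \<i> * a) * (m * cnj a - cnj b) / (complex_of_real m - \<i>)) =
      Im (b * cnj a) - (cmod (m * a - b))\<^sup>2 / (m\<^sup>2 + 1)"
proof -
  have m: "m\<^sup>2 + 1 \<noteq> 0" by (metis add_nonneg_pos less_numeral_extra(3) zero_le_power2 zero_less_one)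
  have mi: "complex_of_real m - \<i> \<noteq> 0" by (auto simp: complex_eq_iff)
  have "(complex_of_real m - \<i>) * (complex_of_real m + \<i>) = complex_of_real (m\<^sup>2 + 1)"
    by (simp add: algebra_simps power2_eq_square)
  then have inv: "1 / (complex_of_real m - \<i>) = (complex_of_real m + \<i>) / complex_of_real (m\<^sup>2 + 1)"
  proof -
    have "1 / D = P / r" if "D * P = r" "D \<noteq> 0" "r \<noteq> 0" for D P r :: complex
      using that by (simp add: field_simps)
    moreover have "complex_of_real (m\<^sup>2 + 1) \<noteq> 0" using m by (metis of_real_eq_0_iff)
    ultimately show ?thesis using mi \<open>(complex_of_real m - \<i>) * (complex_of_real m + \<i>) = complex_of_real (m\<^sup>2 + 1)\<close>
      by blast
  qed
  define X where "X = (b - \<i> * a) * (m * cnj a - cnj b) * (complex_of_real m + \<i>)"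
  have X: "(b - \<i> * a) * (m * cnj a - cnj b) / (complex_of_real m - \<i>) = X / complex_of_real (m\<^sup>2 + 1)"
    using inv by (simp add: X_def divide_inverse mult.assoc)
  have RX: "Re X = (m\<^sup>2 - 1) * Re (b * cnj a) + m * (cmod a)\<^sup>2 - m * (cmod b)\<^sup>2"
    unfolding X_def cmod_power2 by (simp add: algebra_simps power2_eq_square)
  have IX: "Im X = (m\<^sup>2 + 1) * Im (b * cnj a) - (cmod (m * a - b))\<^sup>2"
    unfolding X_def cmod_power2 by (simp add: algebra_simps power2_eq_square)
  show "Re ((b - \<i> * a) * (m * cnj a - cnj b) / (complex_of_real m - \<i>)) =
      ((m\<^sup>2 - 1) * Re (b * cnj a) + m * (cmod a)\<^sup>2 - m * (cmod b)\<^sup>2) / (m\<^sup>2 + 1)"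
    unfolding X Re_divide_of_real RX ..
  show "Im ((b - \<i> * a) * (m * cnj a - cnj b) / (complex_of_real m - \<i>)) =
      Im (b * cnj a) - (cmod (m * a - b))\<^sup>2 / (m\<^sup>2 + 1)"
    unfolding X Im_divide_of_real IX using m by (simp add: diff_divide_distrib)
qed

text \<open>With \<open>\<mu> = - \<nu>\<close> the boundary terms complete a square. The real part of the form of the maximal operator enters only after
  subtraction of \<open>Re (b * cnj a)\<close>; this difference has infimum \<open>m\<^sub>0 * \<bar>a\<bar>\<^sup>2\<close>, whatever \<open>b\<close> is.\<close>

lemma assoc_op_form:
  fixes y :: fn and l \<nu> :: real and a b :: complex
  assumes "nonneg_limit_point q l" and y: "y \<in> Hplus q l"
  defines "a \<equiv> y l" and "b \<equiv> hderiv l y l"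
  shows "Re (assoc_op q l (schr_system q l (ereal (- \<nu>))) y y)
      = (Re (ip l (schr q l y) y) - Re (b * cnj a)) - \<nu> * (cmod a)\<^sup>2 + \<nu> * (cmod (b + \<nu> * a))\<^sup>2 / (\<nu>\<^sup>2 + 1)"
    "\<bar>Im (assoc_op q l (schr_system q l (ereal (- \<nu>))) y y)\<bar> = (cmod (b + \<nu> * a))\<^sup>2 / (\<nu>\<^sup>2 + 1)"
proof -
  interpret nonneg_limit_point q l by fact
  have p: "\<nu>\<^sup>2 + 1 > 0" by (simp add: add_nonneg_pos)
  have eq: "(cmod (b + \<nu> * a))\<^sup>2 = (cmod b)\<^sup>2 + 2 * \<nu> * Re (b * cnj a) + \<nu>\<^sup>2 * (cmod a)\<^sup>2"
    unfolding cmod_power2 by (simp add: algebra_simps power2_eq_square)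
  have "Re (assoc_op q l (schr_system q l (ereal (- \<nu>))) y y) = Re (ip l (schr q l y) y)
      + (((- \<nu>)\<^sup>2 - 1) * Re (b * cnj a) + (- \<nu>) * (cmod a)\<^sup>2 - (- \<nu>) * (cmod b)\<^sup>2) / ((- \<nu>)\<^sup>2 + 1)"
    unfolding assoc_op_diag_real a_def[symmetric] b_def[symmetric] using boundary_term(1)[of b a "- \<nu>"] by simp
  also have "(((- \<nu>)\<^sup>2 - 1) * Re (b * cnj a) + (- \<nu>) * (cmod a)\<^sup>2 - (- \<nu>) * (cmod b)\<^sup>2) / ((- \<nu>)\<^sup>2 + 1)
     = - Re (b * cnj a) - \<nu> * (cmod a)\<^sup>2 + \<nu> * (cmod (b + \<nu> * a))\<^sup>2 / (\<nu>\<^sup>2 + 1)"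
    unfolding eq using p by (simp add: field_simps power2_eq_square)
  finally show "Re (assoc_op q l (schr_system q l (ereal (- \<nu>))) y y)
      = (Re (ip l (schr q l y) y) - Re (b * cnj a)) - \<nu> * (cmod a)\<^sup>2 + \<nu> * (cmod (b + \<nu> * a))\<^sup>2 / (\<nu>\<^sup>2 + 1)" by simp
  have "Im (assoc_op q l (schr_system q l (ereal (- \<nu>))) y y)
      = - Im (ip l (schr q l y) y) + (Im (b * cnj a) - (cmod (complex_of_real (- \<nu>) * a - b))\<^sup>2 / ((- \<nu>)\<^sup>2 + 1))"
    unfolding assoc_op_diag_real a_def[symmetric] b_def[symmetric] using boundary_term(2)[of b a "- \<nu>"] by simp
  also have "\<dots> = - (cmod (complex_of_real (- \<nu>) * a - b))\<^sup>2 / ((- \<nu>)\<^sup>2 + 1)"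
    using Im_form_eq_boundary[OF y] by (simp add: a_def b_def)
  also have "cmod (complex_of_real (- \<nu>) * a - b) = cmod (b + \<nu> * a)"
    by (metis (no_types, lifting) minus_add_distrib mult_minus_left norm_minus_cancel of_real_minus uminus_add_conv_diff add.commute)
  finally show "\<bar>Im (assoc_op q l (schr_system q l (ereal (- \<nu>))) y y)\<bar> = (cmod (b + \<nu> * a))\<^sup>2 / (\<nu>\<^sup>2 + 1)"
    using p by simp
qed

lemma accumulative_iff_accretive:
  "accumulative q l (schr_system q l \<mu>) \<longleftrightarrow> accretive (Hplus q l) (assoc_op q l (schr_system q l \<mu>))"
proof -
  have "Re (Re_op (state_op (schr_system q l \<mu>)) f f) \<le> Re (ip l (schr q l f) f + ip l f (schr q l f))
      \<longleftrightarrow> 0 \<le> Re (assoc_op q l (schr_system q l \<mu>) f f)" for f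
  proof -
    have "Re (ip l f (schr q l f)) = Re (ip l (schr q l f) f)" using arg_cong[OF ip_cnj[of l f "schr q l f"], of Re] by simp
    moreover have "Re (Re_op A f f) = Re (A f f)" for A by (simp add: Re_op_def adj_def)
    ultimately show ?thesis by (simp add: assoc_op_def max_op_def emb_H_def)
  qed
  then show ?thesis by (simp add: accumulative_def accretive_def)
qed

text \<open>The boundary condition \<open>y' l = \<i> * y l\<close> of the main operator makes the real part of \<open>y' l * cnj (y l)\<close> vanish. So the
  imaginary part of the form is \<open>\<bar>y l\<bar>\<^sup>2\<close> and the infimum of its real part is \<open>m\<^sub>0 * \<bar>y l\<bar>\<^sup>2\<close>; the tangent of the exact
  angle is the quotient of the two.\<close>

lemma exact_angle_main_op:
  assumes "nonneg_limit_point q l"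
    and m0: "((\<lambda>x. m_inf q l (complex_of_real x)) \<longlongrightarrow> complex_of_real m\<^sub>0) (at_left 0)"
    and \<beta>: "0 < \<beta>" "\<beta> < pi / 2"
    and T: "exact_angle \<beta> (main_dom (schr_system q l \<mu>)) (\<lambda>y. emb_H l (main_op (schr_system q l \<mu>) y))"
  shows "m\<^sub>0 = cot \<beta>"
proof (rule antisym)
  interpret nonneg_limit_point q l by fact
  define S where "S = {y \<in> Hplus q l. hderiv l y l = \<i> * y l}"
  define t where "t y = ip l (schr q l y) y" for y
  have T1: "cot \<beta> * \<bar>Im (t y)\<bar> \<le> Re (t y)" if "y \<in> S" for y
    using T that unfolding exact_angle_def sectorial_def by (simp add: schr_system_def S_def emb_H_def t_def)
  have T2: "tan \<beta> = (SUP y\<in>S. \<bar>Im (t y)\<bar> / Re (t y))"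
    using T unfolding exact_angle_def by (simp add: schr_system_def S_def emb_H_def t_def)
  have tan: "tan \<beta> > 0" using \<beta> by (simp add: tan_gt_zero)
  have cot: "cot \<beta> > 0" "cot \<beta> = 1 / tan \<beta>" using tan by (simp_all add: cot_altdef divide_inverse)
  have Im: "\<bar>Im (t y)\<bar> = (cmod (y l))\<^sup>2" if "y \<in> S" for y
  proof -
    have "Im (t y) = Im (\<i> * y l * cnj (y l))" using that Im_form_eq_boundary[of y] by (simp add: S_def t_def)
    also have "\<i> * y l * cnj (y l) = \<i> * complex_of_real ((cmod (y l))\<^sup>2)" by (simp only: complex_norm_square mult.assoc)
    finally show ?thesis by simp
  qed
  show "cot \<beta> \<le> m\<^sub>0"
  proof (rule field_le_epsilon)
    fix e :: real assume "e > 0"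
    from form_sharp[OF m0 this, of 1 \<i>] obtain y where y: "y \<in> Hplus q l" "y l = 1" "hderiv l y l = \<i>"
      "Re (t y) \<le> m\<^sub>0 + e" by (auto simp: t_def)
    then have "y \<in> S" by (simp add: S_def)
    from T1[OF this] Im[OF this] y show "cot \<beta> \<le> m\<^sub>0 + e" by simp
  qed
  then have m0pos: "m\<^sub>0 > 0" using cot(1) by linarith
  have "tan \<beta> \<le> 1 / m\<^sub>0"
    unfolding T2
  proof (rule cSUP_least)
    have "(\<lambda>x. 0) \<in> Hplus q l"
    proof -
      have "schr_eq q l (\<lambda>x. 0) (\<lambda>x. 0) (\<lambda>x. 0)" by (simp add: schr_eq_def loc_primitive_def)
      moreover have "(\<lambda>x. 0) \<in> L2 l" by (simp add: L2_def)
      ultimately show ?thesis by (intro max_elem_imp_Hplus(1)[of q l "\<lambda>x. 0" _ "\<lambda>x. 0"]) (auto simp: max_elem_def)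
    qed
    then show "S \<noteq> {}" using hderiv_zero[of l] by (auto simp: S_def intro!: exI[of _ "\<lambda>x. 0"])
    fix y assume y: "y \<in> S"
    then have yH: "y \<in> Hplus q l" by (simp add: S_def)
    have "Re (hderiv l y l * cnj (y l)) = 0"
    proof -
      have "hderiv l y l * cnj (y l) = \<i> * complex_of_real ((cmod (y l))\<^sup>2)"
        using y unfolding complex_norm_square by (simp add: S_def)
      then show ?thesis by simp
    qed
    then have lb: "m\<^sub>0 * (cmod (y l))\<^sup>2 \<le> Re (t y)"
      using form_lower_bound[OF m0 Hplus_imp_max_elem[OF yH q]] by (simp add: t_def)
    show "\<bar>Im (t y)\<bar> / Re (t y) \<le> 1 / m\<^sub>0"
    proof (cases "Re (t y) > 0")
      case True
      then show ?thesis unfolding Im[OF y] using lb m0pos by (simp add: field_simps)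
    next
      case False
      have "0 \<le> m\<^sub>0 * (cmod (y l))\<^sup>2" using m0pos by simp
      then have "Re (t y) = 0" using lb False by linarith
      then show ?thesis using m0pos by simp
    qed
  qed
  then show "m\<^sub>0 \<le> cot \<beta>" using tan m0pos unfolding cot(2) by (simp add: field_simps)
qed

lemma tan_ext_eq_zero_iff: "tan_ext \<alpha> = ereal 0 \<longleftrightarrow> (\<exists>k::int. \<alpha> = of_int k * pi)"
proof -
  have "tan_ext \<alpha> = ereal 0 \<longleftrightarrow> cos \<alpha> \<noteq> 0 \<and> sin \<alpha> = 0"
    by (auto simp: tan_ext_def tan_def)
  also have "\<dots> \<longleftrightarrow> sin \<alpha> = 0" using sin_zero_abs_cos_one[of \<alpha>] by force
  also have "\<dots> \<longleftrightarrow> (\<exists>k::int. \<alpha> = of_int k * pi)" by (simp add: sin_zero_iff_int2)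
  finally show ?thesis .
qed

theorem theorem9:
  fixes q :: "real \<Rightarrow> real" and l \<alpha> \<beta> m\<^sub>0 :: real and \<Theta> :: l_system
  assumes l: "0 \<le> l"
    and q: "\<And>b. q absolutely_integrable_on {l..b}"
    and deficiency: "deficiency_index q l \<i> = 1" "deficiency_index q l (- \<i>) = 1"
    and nonneg: "nonneg_min q l"
    and m\<^sub>0: "((\<lambda>x. m_inf q l (complex_of_real x)) \<longlongrightarrow> complex_of_real m\<^sub>0) (at_left 0)"
    and \<Theta>: "\<Theta> = schr_system q l (tan_ext \<alpha>)"
    and accum: "accumulative q l \<Theta>"
    and \<beta>: "0 < \<beta>" "\<beta> < pi / 2"
    and T: "exact_angle \<beta> (main_dom \<Theta>) (\<lambda>y. emb_H l (main_op \<Theta> y))"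
  shows "(sectorial \<beta> (Hplus q l) (assoc_op q l \<Theta>) \<longleftrightarrow> tan_ext \<alpha> = ereal (- m\<^sub>0)) \<and>
         (tan_ext \<alpha> = ereal (- m\<^sub>0) \<longrightarrow> exact_angle \<beta> (Hplus q l) (assoc_op q l \<Theta>)) \<and>
         (accretive (Hplus q l) (assoc_op q l \<Theta>) \<and>
            (\<forall>\<beta>'. 0 < \<beta>' \<and> \<beta>' < pi / 2 \<longrightarrow> \<not> sectorial \<beta>' (Hplus q l) (assoc_op q l \<Theta>))
          \<longleftrightarrow> (\<exists>k::int. \<alpha> = of_int k * pi))"
proof -
  have N: "nonneg_limit_point q l" using q deficiency(1) nonneg by (simp add: nonneg_limit_point_def)
  interpret nonneg_limit_point q l by fact
  have m0: "m\<^sub>0 = cot \<beta>" using exact_angle_main_op[OF N m\<^sub>0 \<beta>] T \<Theta> by simp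
  have tan: "tan \<beta> > 0" using \<beta> by (simp add: tan_gt_zero)
  have m0pos: "m\<^sub>0 > 0" and tan_m0: "tan \<beta> = 1 / m\<^sub>0" using tan by (simp_all add: m0 cot_altdef divide_inverse)
  have acc: "accretive (Hplus q l) (assoc_op q l \<Theta>)" using accum accumulative_iff_accretive \<Theta> by simp
  then have acc': "0 \<le> Re (assoc_op q l \<Theta> y y)" if "y \<in> Hplus q l" for y using that by (simp add: accretive_def)
  define t where "t y = Re (ip l (schr q l y) y) - Re (hderiv l y l * cnj (y l))" for y :: fn
  have lower: "m\<^sub>0 * (cmod (y l))\<^sup>2 \<le> t y" if "y \<in> Hplus q l" for y
    using form_lower_bound[OF m\<^sub>0 Hplus_imp_max_elem[OF that q]] by (simp add: t_def)
  have sharp: "\<exists>y. y \<in> Hplus q l \<and> y l = a \<and> hderiv l y l = b \<and> t y \<le> m\<^sub>0 * (cmod a)\<^sup>2 + e" if "e > 0" for a b e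
  proof -
    obtain y where "y \<in> Hplus q l" "y l = a" "hderiv l y l = b"
      "Re (ip l (schr q l y) y) \<le> Re (b * cnj a) + m\<^sub>0 * (cmod a)\<^sup>2 + e"
      using form_sharp[OF m\<^sub>0 \<open>e > 0\<close>, where a = a and b = b] by blast
    then show ?thesis by (auto simp: t_def)
  qed
  have "tan_ext \<alpha> \<noteq> \<infinity>"
  proof
    assume inf: "tan_ext \<alpha> = \<infinity>"
    \<comment> \<open>For \<open>\<mu> = \<infinity>\<close> the term \<open>2 * Re (b * cnj a)\<close> remains, which is unbounded below for fixed \<open>a\<close>.\<close>
    obtain y where y: "y \<in> Hplus q l" "y l = 1" "hderiv l y l = - complex_of_real (m\<^sub>0 + 1)" "t y \<le> m\<^sub>0 + 1"
      using sharp[of 1 1 "- complex_of_real (m\<^sub>0 + 1)"] by auto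
    have "Re (assoc_op q l \<Theta> y y) = t y - 2 * (m\<^sub>0 + 1)"
      unfolding \<Theta> inf assoc_op_diag_infinity using y by (simp add: t_def)
    then show False using acc'[OF y(1)] y(4) m0pos by simp
  qed
  then obtain \<mu> where \<mu>: "tan_ext \<alpha> = ereal \<mu>" by (auto simp: tan_ext_def split: if_splits)
  define \<nu> where "\<nu> = - \<mu>"
  have \<Theta>\<nu>: "\<Theta> = schr_system q l (ereal (- \<nu>))" using \<Theta> \<mu> by (simp add: \<nu>_def)
  have p: "\<nu>\<^sup>2 + 1 > 0" by (simp add: add_nonneg_pos)
  define w where "w y = (cmod (hderiv l y l + \<nu> * y l))\<^sup>2 / (\<nu>\<^sup>2 + 1)" for y :: fn
  have w0: "w y \<ge> 0" for y using p by (simp add: w_def)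
  have ReA: "Re (assoc_op q l \<Theta> y y) = t y - \<nu> * (cmod (y l))\<^sup>2 + \<nu> * w y"
    and ImA: "\<bar>Im (assoc_op q l \<Theta> y y)\<bar> = w y" if "y \<in> Hplus q l" for y
    using assoc_op_form[OF N that, of \<nu>] unfolding \<Theta>\<nu> by (simp_all add: t_def w_def)
  have \<nu>0: "\<nu> \<ge> 0"
  proof (rule ccontr)
    assume "\<not> \<nu> \<ge> 0"
    then have neg: "\<nu> < 0" by simp
    \<comment> \<open>With \<open>a = 0\<close> and \<open>b = c\<close> the real part is \<open>\<nu> * w = - 2\<close> up to an error of at most \<open>1\<close>.\<close>
    define c where "c = sqrt ((\<nu>\<^sup>2 + 1) * (2 / (- \<nu>)))"
    obtain y where y: "y \<in> Hplus q l" "y l = 0" "hderiv l y l = complex_of_real c" "t y \<le> 1"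
      using sharp[of 1 0 "complex_of_real c"] by auto
    have "0 \<le> 2 / (- \<nu>)" using neg by simp
    then have c2: "c\<^sup>2 = (\<nu>\<^sup>2 + 1) * (2 / (- \<nu>))"
      unfolding c_def using p by (intro real_sqrt_pow2 mult_nonneg_nonneg) auto
    have "w y = c\<^sup>2 / (\<nu>\<^sup>2 + 1)" using y by (simp add: w_def)
    also have "\<dots> = 2 / (- \<nu>)" unfolding c2 by (rule nonzero_mult_div_cancel_left) (use p in simp)
    finally have "\<nu> * w y = - 2" using neg by simp
    then show False using acc'[OF y(1)] ReA[OF y(1)] y by simp
  qed
  have \<nu>m: "\<nu> \<le> m\<^sub>0"
  proof (rule field_le_epsilon)
    fix e :: real assume "e > 0"
    \<comment> \<open>With \<open>a = 1\<close> and \<open>b = - \<nu>\<close> the square \<open>w\<close> vanishes.\<close>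
    then obtain y where y: "y \<in> Hplus q l" "y l = 1" "hderiv l y l = - complex_of_real \<nu>" "t y \<le> m\<^sub>0 + e"
      using sharp[of e 1 "- complex_of_real \<nu>"] by auto
    then have "w y = 0" by (simp add: w_def)
    then show "\<nu> \<le> m\<^sub>0 + e" using acc'[OF y(1)] ReA[OF y(1)] y by simp
  qed
  have ub: "\<nu> * w y \<le> Re (assoc_op q l \<Theta> y y)" if "y \<in> Hplus q l" for y
  proof -
    have "\<nu> * (cmod (y l))\<^sup>2 \<le> m\<^sub>0 * (cmod (y l))\<^sup>2" using \<nu>m by (intro mult_right_mono) auto
    then show ?thesis using lower[OF that] ReA[OF that] by simp
  qed
  have lb: "\<exists>y\<in>Hplus q l. w y = 1 \<and> Re (assoc_op q l \<Theta> y y) \<le> \<nu> + e" if "e > 0" for e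
  proof -
    \<comment> \<open>With \<open>a = 0\<close> only \<open>w\<close> is left, and \<open>b\<close> normalises it to \<open>1\<close>.\<close>
    obtain y where y: "y \<in> Hplus q l" "y l = 0" "hderiv l y l = complex_of_real (sqrt (\<nu>\<^sup>2 + 1))" "t y \<le> e"
      using sharp[OF \<open>e > 0\<close>, of 0 "complex_of_real (sqrt (\<nu>\<^sup>2 + 1))"] by auto
    have "w y = 1" using y p by (simp add: w_def)
    then show ?thesis using y ReA[OF y(1)] by (intro bexI[of _ y]) auto
  qed
  have sect: "sectorial \<beta>' (Hplus q l) (assoc_op q l \<Theta>) \<longleftrightarrow> cot \<beta>' \<le> \<nu>" for \<beta>'
  proof
    assume S: "sectorial \<beta>' (Hplus q l) (assoc_op q l \<Theta>)"
    show "cot \<beta>' \<le> \<nu>"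
    proof (rule field_le_epsilon)
      fix e :: real assume "e > 0"
      then obtain y where y: "y \<in> Hplus q l" "w y = 1" "Re (assoc_op q l \<Theta> y y) \<le> \<nu> + e" using lb by blast
      have "cot \<beta>' * w y \<le> Re (assoc_op q l \<Theta> y y)" using S y(1) unfolding sectorial_def ImA[OF y(1), symmetric] by blast
      then show "cot \<beta>' \<le> \<nu> + e" using y by simp
    qed
  next
    assume c: "cot \<beta>' \<le> \<nu>"
    show "sectorial \<beta>' (Hplus q l) (assoc_op q l \<Theta>)"
      unfolding sectorial_def
    proof
      fix y assume y: "y \<in> Hplus q l"
      have "cot \<beta>' * w y \<le> \<nu> * w y" using c w0 by (rule mult_right_mono)
      then show "cot \<beta>' * \<bar>Im (assoc_op q l \<Theta> y y)\<bar> \<le> Re (assoc_op q l \<Theta> y y)"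
        using ub[OF y] ImA[OF y] by simp
    qed
  qed
  have A: "tan_ext \<alpha> = ereal (- m\<^sub>0) \<longleftrightarrow> \<nu> = m\<^sub>0" using \<mu> by (auto simp: \<nu>_def)
  have 1: "sectorial \<beta> (Hplus q l) (assoc_op q l \<Theta>) \<longleftrightarrow> tan_ext \<alpha> = ereal (- m\<^sub>0)"
    unfolding sect A m0[symmetric] using \<nu>m by auto
  have 2: "exact_angle \<beta> (Hplus q l) (assoc_op q l \<Theta>)" if "tan_ext \<alpha> = ereal (- m\<^sub>0)"
    unfolding exact_angle_def
  proof
    show "sectorial \<beta> (Hplus q l) (assoc_op q l \<Theta>)" using 1 that by simp
    have \<nu>: "\<nu> = m\<^sub>0" using that A by simp
    define Q where "Q y = \<bar>Im (assoc_op q l \<Theta> y y)\<bar> / Re (assoc_op q l \<Theta> y y)" for y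
    have Qle: "Q y \<le> 1 / m\<^sub>0" if y: "y \<in> Hplus q l" for y
    proof (cases "Re (assoc_op q l \<Theta> y y) > 0")
      case True
      then show ?thesis using ub[OF y] m0pos unfolding Q_def ImA[OF y] \<nu> by (simp add: field_simps)
    next
      case False
      then have "Re (assoc_op q l \<Theta> y y) = 0" using acc'[OF y] by simp
      then show ?thesis using m0pos by (simp add: Q_def)
    qed
    have "(SUP y\<in>Hplus q l. Q y) = 1 / m\<^sub>0"
    proof (rule cSup_eq_non_empty)
      show "Q ` Hplus q l \<noteq> {}" using lb[of 1] by auto
      show "x \<le> 1 / m\<^sub>0" if "x \<in> Q ` Hplus q l" for x using that Qle by auto
      fix x assume x: "\<And>z. z \<in> Q ` Hplus q l \<Longrightarrow> z \<le> x"
      have "1 / (m\<^sub>0 + e) \<le> x" if e: "e > 0" for e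
      proof -
        obtain y where y: "y \<in> Hplus q l" "w y = 1" "Re (assoc_op q l \<Theta> y y) \<le> m\<^sub>0 + e" using lb[OF e] \<nu> by auto
        have "m\<^sub>0 \<le> Re (assoc_op q l \<Theta> y y)" using ub[OF y(1)] y(2) \<nu> by simp
        then have "1 / (m\<^sub>0 + e) \<le> Q y" unfolding Q_def ImA[OF y(1)] y(2)
          using y(3) m0pos by (intro divide_left_mono mult_pos_pos) auto
        also have "\<dots> \<le> x" using x y(1) by simp
        finally show ?thesis .
      qed
      then have "\<forall>\<^sub>F e in at_right 0. 1 / (m\<^sub>0 + e) \<le> x" by (auto simp: eventually_at_filter)
      moreover have "((\<lambda>e. 1 / (m\<^sub>0 + e)) \<longlongrightarrow> 1 / (m\<^sub>0 + 0)) (at_right 0)"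
        using m0pos by (intro tendsto_intros) auto
      ultimately show "1 / m\<^sub>0 \<le> x"
        using tendsto_upperbound[of _ _ "at_right (0::real)"] by (simp add: trivial_limit_at_right_real)
    qed
    then show "tan \<beta> = (SUP f\<in>Hplus q l. \<bar>Im (assoc_op q l \<Theta> f f)\<bar> / Re (assoc_op q l \<Theta> f f))"
      by (simp add: tan_m0 Q_def[abs_def])
  qed
  have B: "(\<exists>k::int. \<alpha> = of_int k * pi) \<longleftrightarrow> \<nu> = 0"
    unfolding tan_ext_eq_zero_iff[symmetric] \<mu> by (auto simp: \<nu>_def)
  have 3: "(\<forall>\<beta>'. 0 < \<beta>' \<and> \<beta>' < pi / 2 \<longrightarrow> \<not> sectorial \<beta>' (Hplus q l) (assoc_op q l \<Theta>)) \<longleftrightarrow> \<nu> = 0"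
  proof
    assume H: "\<forall>\<beta>'. 0 < \<beta>' \<and> \<beta>' < pi / 2 \<longrightarrow> \<not> sectorial \<beta>' (Hplus q l) (assoc_op q l \<Theta>)"
    show "\<nu> = 0"
    proof (rule ccontr)
      assume "\<nu> \<noteq> 0"
      then have pos: "\<nu> > 0" using \<nu>0 by simp
      define \<beta>' where "\<beta>' = arctan (1 / \<nu>)"
      have "0 < \<beta>'" "\<beta>' < pi / 2" using pos arctan_ubound by (auto simp: \<beta>'_def)
      moreover have "cot \<beta>' = \<nu>" using pos by (simp add: \<beta>'_def cot_altdef tan_arctan)
      then have "sectorial \<beta>' (Hplus q l) (assoc_op q l \<Theta>)" unfolding sect by simp
      ultimately show False using H by blast
    qed
  next
    assume \<nu>: "\<nu> = 0"
    show "\<forall>\<beta>'. 0 < \<beta>' \<and> \<beta>' < pi / 2 \<longrightarrow> \<not> sectorial \<beta>' (Hplus q l) (assoc_op q l \<Theta>)"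
    proof (intro allI impI)
      fix \<beta>' :: real assume "0 < \<beta>' \<and> \<beta>' < pi / 2"
      then have "tan \<beta>' > 0" by (simp add: tan_gt_zero)
      then have "cot \<beta>' > 0" by (simp add: cot_altdef)
      then show "\<not> sectorial \<beta>' (Hplus q l) (assoc_op q l \<Theta>)" unfolding sect \<nu> by simp
    qed
  qed
  show ?thesis using 1 2 3 B acc by blast
qed

end
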